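(* Let $n\geq 1$ be an integer, let $L$ be one of the lens spaces $L(4n,2n+1)$, $L(4n,2n-1)$, and let $L\to\mathbb{RP}^2(n)$ be a Seifert fibration of $L$ over the projective plane with one orbifold point of order $n$. Let $C\subset\mathbb{RP}^2(n)$ be a simple closed curve, disjoint from the orbifold point, along which the orientation of the projective plane is reversed. Then the restriction of the Seifert fibration to $C$ is the nontrivial $S^1$-bundle over $S^1$; that is, the preimage of $C$ is an embedded Klein bottle in $L$.
   Context: For coprime integers $p\geq 1$ and $q$, the lens space $L(p,q)$ is the quotient of $S^3\subset\mathbb{C}^2$ by the free $\mathbb{Z}_p$-action generated by $\sigma(z_1,z_2)=(e^{2\pi i/p}z_1,\,e^{2\pi i q/p}z_2)$. $\mathbb{RP}^2(n)$ denotes the real projective plane with one orbifold point of order $n$ (for $n=1$ this point is not singular); a Seifert fibration over $\mathbb{RP}^2(n)$ has base $\mathbb{RP}^2$ and one singular fibre of multiplicity $n$. It is known from earlier work that $L(4n,2n\pm1)$ admits such a Seifert fibration. *)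

theory Defs
  imports "HOL-Homology.Homology"
begin

text \<open>Everything is set in the topological category: manifolds are abstract topologies, bundle
  and fibration charts are homeomorphisms, curves are continuous.\<close>

subsection \<open>Quotient spaces\<close>

definition quotient_topology :: "'a topology \<Rightarrow> ('a \<Rightarrow> 'b) \<Rightarrow> 'b topology" where
  "quotient_topology X f =
     topology (\<lambda>U. U \<subseteq> f ` topspace X \<and> openin X {x \<in> topspace X. f x \<in> U})"

lemma openin_quotient_topology:
  "openin (quotient_topology X f) U \<longleftrightarrow>
     U \<subseteq> f ` topspace X \<and> openin X {x \<in> topspace X. f x \<in> U}"
proof -
  have "istopology (\<lambda>U. U \<subseteq> f ` topspace X \<and> openin X {x \<in> topspace X. f x \<in> U})"
    unfolding istopology_def
  proof (intro conjI allI impI; (elim conjE)?)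
    fix S T
    assume "openin X {x \<in> topspace X. f x \<in> S}" "openin X {x \<in> topspace X. f x \<in> T}"
    moreover have "{x \<in> topspace X. f x \<in> S \<inter> T} =
        {x \<in> topspace X. f x \<in> S} \<inter> {x \<in> topspace X. f x \<in> T}"
      by blast
    ultimately show "openin X {x \<in> topspace X. f x \<in> S \<inter> T}"
      by (simp add: openin_Int)
  next
    fix K
    assume K: "\<forall>S\<in>K. S \<subseteq> f ` topspace X \<and> openin X {x \<in> topspace X. f x \<in> S}"
    have "{x \<in> topspace X. f x \<in> \<Union>K} = (\<Union>S\<in>K. {x \<in> topspace X. f x \<in> S})"
      by blast
    moreover have "openin X (\<Union>S\<in>K. {x \<in> topspace X. f x \<in> S})"
      using K by (intro openin_Union) auto
    ultimately show "openin X {x \<in> topspace X. f x \<in> \<Union>K}"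
      by simp
  qed blast+
  then show ?thesis
    by (simp add: quotient_topology_def)
qed

lemma topspace_quotient_topology: "topspace (quotient_topology X f) = f ` topspace X"
proof
  show "topspace (quotient_topology X f) \<subseteq> f ` topspace X"
    using openin_topspace [of "quotient_topology X f"]
    unfolding openin_quotient_topology by (rule conjunct1)
  have "{x \<in> topspace X. f x \<in> f ` topspace X} = topspace X"
    by blast
  then have "openin (quotient_topology X f) (f ` topspace X)"
    by (simp add: openin_quotient_topology)
  then show "f ` topspace X \<subseteq> topspace (quotient_topology X f)"
    by (rule openin_subset)
qed

lemma quotient_map_quotient_topology: "quotient_map X (quotient_topology X f) f"
  by (simp add: quotient_map_def openin_quotient_topology topspace_quotient_topology)


subsection \<open>Lens spaces, the projective plane, the Klein bottle\<close>

definition lens_rotation :: "nat \<Rightarrow> int \<Rightarrow> complex \<times> complex \<Rightarrow> complex \<times> complex" where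
  "lens_rotation p q =
     (\<lambda>(z1, z2). (exp (2 * of_real pi * \<i> / of_nat p) * z1,
                  exp (2 * of_real pi * \<i> * of_int q / of_nat p) * z2))"

text \<open>As \<open>lens_rotation p q\<close> has finite order for \<open>p \<ge> 1\<close>, its nonnegative iterates
  already sweep out the orbits of the group it generates.\<close>

definition lens_orbit :: "nat \<Rightarrow> int \<Rightarrow> complex \<times> complex \<Rightarrow> (complex \<times> complex) set" where
  "lens_orbit p q z = range (\<lambda>k. (lens_rotation p q ^^ k) z)"

definition lens_space :: "nat \<Rightarrow> int \<Rightarrow> (complex \<times> complex) set topology" where
  "lens_space p q = quotient_topology (top_of_set (sphere 0 1)) (lens_orbit p q)"

definition projective_plane :: "(real ^ 3) set topology" where
  "projective_plane = quotient_topology (top_of_set (sphere 0 1)) (\<lambda>x. {x, - x})"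

abbreviation unit_circle :: "complex topology" where
  "unit_circle \<equiv> top_of_set (sphere 0 1)"

abbreviation unit_disc :: "complex topology" where
  "unit_disc \<equiv> top_of_set (ball 0 1)"

text \<open>The Klein bottle as the mapping torus of complex conjugation on the circle: the quotient of
  \<open>\<real> \<times> S\<^sup>1\<close> by the \<open>\<int>\<close>-action generated by \<open>(t, w) \<mapsto> (t + 1, cnj w)\<close>.\<close>

definition klein_orbit :: "real \<times> complex \<Rightarrow> (real \<times> complex) set" where
  "klein_orbit = (\<lambda>(t, w). range (\<lambda>k::int. (t + of_int k, if even k then w else cnj w)))"

definition klein_bottle :: "(real \<times> complex) set topology" where
  "klein_bottle = quotient_topology (prod_topology euclideanreal unit_circle) klein_orbit"


subsection \<open>Seifert fibrations and circle bundles\<close>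

abbreviation preimage_space :: "'a topology \<Rightarrow> ('a \<Rightarrow> 'b) \<Rightarrow> 'b set \<Rightarrow> 'a topology" where
  "preimage_space X f U \<equiv> subtopology X {x \<in> topspace X. f x \<in> U}"

text \<open>The projection of the standard fibred solid torus. For coprime \<open>\<alpha> \<ge> 1\<close> and \<open>\<beta>\<close> its fibres
  are the orbits of the circle action \<open>\<theta> \<cdot> (z, w) = (\<theta> powi (-\<beta>) * z, \<theta> ^ \<alpha> * w)\<close> on the solid
  torus; the core is a fibre of multiplicity \<open>\<alpha>\<close> and all other fibres are regular. The base is
  the cone \<open>D\<^sup>2/\<int>\<^sub>\<alpha>\<close>, identified topologically with the disc via \<open>z \<mapsto> z ^ \<alpha>\<close>.\<close>

definition fibred_torus_proj :: "nat \<Rightarrow> int \<Rightarrow> complex \<times> complex \<Rightarrow> complex" where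
  "fibred_torus_proj \<alpha> \<beta> = (\<lambda>(z, w). z ^ \<alpha> * w powi \<beta>)"

text \<open>Here \<open>\<mu> b\<close> is the multiplicity of the fibre over \<open>b\<close>, that is, the order of the orbifold
  point \<open>b\<close> of the base (order 1 meaning nonsingular).\<close>

definition seifert_fibration ::
    "'a topology \<Rightarrow> 'b topology \<Rightarrow> ('b \<Rightarrow> nat) \<Rightarrow> ('a \<Rightarrow> 'b) \<Rightarrow> bool" where
  "seifert_fibration X B \<mu> f \<longleftrightarrow>
     continuous_map X B f \<and>
     (\<forall>b \<in> topspace B. \<exists>\<beta> U g h.
        coprime (int (\<mu> b)) \<beta> \<and> openin B U \<and> b \<in> U \<and>
        homeomorphic_map (subtopology B U) unit_disc g \<and> g b = 0 \<and>
        homeomorphic_map (preimage_space X f U) (prod_topology unit_disc unit_circle) h \<and>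
        (\<forall>x \<in> topspace X. f x \<in> U \<longrightarrow> g (f x) = fibred_torus_proj (\<mu> b) \<beta> (h x)))"

text \<open>\<open>\<real>P\<^sup>2(n)\<close> with its orbifold point at \<open>x0\<close>.\<close>

definition seifert_fibration_over_RP2 ::
    "'a topology \<Rightarrow> nat \<Rightarrow> (real ^ 3) set \<Rightarrow> ('a \<Rightarrow> (real ^ 3) set) \<Rightarrow> bool" where
  "seifert_fibration_over_RP2 X n x0 f \<longleftrightarrow>
     x0 \<in> topspace projective_plane \<and>
     seifert_fibration X projective_plane (\<lambda>b. if b = x0 then n else 1) f"

definition circle_bundle :: "'a topology \<Rightarrow> 'b topology \<Rightarrow> ('a \<Rightarrow> 'b) \<Rightarrow> bool" where
  "circle_bundle X B f \<longleftrightarrow>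
     continuous_map X B f \<and>
     (\<forall>b \<in> topspace B. \<exists>U h.
        openin B U \<and> b \<in> U \<and>
        homeomorphic_map (preimage_space X f U) (prod_topology (subtopology B U) unit_circle) h \<and>
        (\<forall>x \<in> topspace X. f x \<in> U \<longrightarrow> fst (h x) = f x))"

definition trivial_circle_bundle :: "'a topology \<Rightarrow> 'b topology \<Rightarrow> ('a \<Rightarrow> 'b) \<Rightarrow> bool" where
  "trivial_circle_bundle X B f \<longleftrightarrow>
     (\<exists>h. homeomorphic_map X (prod_topology B unit_circle) h \<and>
          (\<forall>x \<in> topspace X. fst (h x) = f x))"


subsection \<open>Orientation along a curve\<close>

definition simple_closed_curve :: "'a topology \<Rightarrow> (real \<Rightarrow> 'a) \<Rightarrow> bool" where
  "simple_closed_curve X \<gamma> \<longleftrightarrow> pathin X \<gamma> \<and> \<gamma> 0 = \<gamma> 1 \<and> inj_on \<gamma> {0..<1}"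

abbreviation homology_rel_complement :: "int \<Rightarrow> 'a topology \<Rightarrow> 'a set \<Rightarrow> 'a chain set monoid" where
  "homology_rel_complement d M A \<equiv> relative_homology_group d M (topspace M - A)"

text \<open>\<open>\<omega> t\<close> is a local orientation at \<open>\<gamma> t\<close> of the \<open>d\<close>-manifold \<open>M\<close>, i.e. a generator of
  \<open>H\<^sub>d(M, M - {\<gamma> t}) \<cong> \<int>\<close>, varying continuously with \<open>t\<close>: locally all \<open>\<omega> s\<close> are restrictions of
  a single class in \<open>H\<^sub>d(M, M - U)\<close>.\<close>

definition orientation_along ::
    "int \<Rightarrow> 'a topology \<Rightarrow> (real \<Rightarrow> 'a) \<Rightarrow> (real \<Rightarrow> 'a chain set) \<Rightarrow> bool" where
  "orientation_along d M \<gamma> \<omega> \<longleftrightarrow>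
     (\<forall>t \<in> {0..1}. generate (homology_rel_complement d M {\<gamma> t}) {\<omega> t}
                     = carrier (homology_rel_complement d M {\<gamma> t})) \<and>
     (\<forall>t \<in> {0..1}. \<exists>U c \<epsilon>.
        openin M U \<and> c \<in> carrier (homology_rel_complement d M U) \<and> \<epsilon> > 0 \<and>
        (\<forall>s \<in> {0..1}. \<bar>s - t\<bar> < \<epsilon> \<longrightarrow>
           \<gamma> s \<in> U \<and>
           \<omega> s = hom_induced d M (topspace M - U) M (topspace M - {\<gamma> s}) id c))"

definition orientation_reversing_loop :: "int \<Rightarrow> 'a topology \<Rightarrow> (real \<Rightarrow> 'a) \<Rightarrow> bool" where
  "orientation_reversing_loop d M \<gamma> \<longleftrightarrow>
     pathin M \<gamma> \<and> \<gamma> 0 = \<gamma> 1 \<and>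
     (\<exists>\<omega>. orientation_along d M \<gamma> \<omega> \<and>
          \<omega> 1 = inv\<^bsub>homology_rel_complement d M {\<gamma> 0}\<^esub> (\<omega> 0))"

end

theory Submission
  imports Defs "HOL-Analysis.Analysis"
begin

text \<open>A circle bundle over a loop is glued from \<open>[0,1] \<times> S\<^sup>1\<close> by a homeomorphism of the circle, which is
  isotopic to the identity or to complex conjugation; so it is trivial or a Klein bottle, and it
  remains to exclude triviality over the reversing curve \<open>C\<close>.

  As \<open>S\<^sup>3\<close> is simply connected, the Seifert fibration lifts to \<open>F : S\<^sup>3 \<rightarrow> S\<^sup>2\<close>. Suppose the bundle over \<open>C\<close>
  is trivial. A path \<open>x\<close> in \<open>S\<^sup>3\<close> lifting a section over \<open>C\<close> ends at \<open>x 1 = T (x 0)\<close> for a deck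
  transformation \<open>T\<close>, and \<open>F \<circ> T = - F\<close> because \<open>C\<close> reverses orientation. The trivialization orients the
  fibres along \<open>x\<close>; together with the cone over \<open>F\<close> it gives maps from punctured neighbourhoods of
  \<open>x t\<close> in \<open>\<real>\<^sup>4\<close> to \<open>\<real>\<^sup>3 \<times> \<real> - 0\<close>, all of the same homotopy class. Transport by \<open>T\<close>, which is isotopic to
  the identity through linear isometries, shows that this class is invariant under
  \<open>(v, s) \<mapsto> (- v, s)\<close>; but the class is that of a local homeomorphism, and the reflection has degree -1.\<close>

subsection \<open>Finite free actions as coverings\<close>

text \<open>The maps are only continuous, so there is no derivative whose sign could be compared.
  Signs are read off instead from homotopy classes of direction maps on small spheres. For this the
  germs must go between equal dimensions: the cone over \<open>F\<close> maps the punctured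
  \<real>^4 to \<real>^3, a fibre coordinate adds the fourth dimension, and invariance of domain
  applies.

  Two obstacles shape the rest. The trivialization lives over the curve only, which is not open. Its
  circle coordinate is therefore extended arbitrarily to the whole three-sphere, and injectivity on
  a full neighbourhood is borrowed from a bundle chart at one point. Moreover, reversal of
  orientation is given in terms of local homology, whereas the argument needs it as a statement
  about lifts to the two-sphere; the translation goes through an even self-map of the sphere that
  doubles angles.

  The lens space and the projective plane are abstract quotients. They are embedded in Euclidean
  spaces so that the theory of covering spaces can be used.\<close>

lemma open_map_finite_action:
  fixes S :: "'a::metric_space set" and p :: "'a \<Rightarrow> 'b::t2_space"
  assumes "compact S" and contp: "continuous_on S p" and "finite I"
    and hom: "\<And>i. i \<in> I \<Longrightarrow> \<exists>h. homeomorphism S S (g i) h"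
    and fib: "\<And>x y. x \<in> S \<Longrightarrow> y \<in> S \<Longrightarrow> p x = p y \<longleftrightarrow> (\<exists>i\<in>I. y = g i x)"
    and W: "openin (top_of_set S) W"
  shows "openin (top_of_set (p ` S)) (p ` W)"
proof -
  have WS: "W \<subseteq> S"
    using W openin_imp_subset by blast
  have "openin (top_of_set S) (g i ` W)" if i: "i \<in> I" for i
    using hom[OF i] W homeomorphism_imp_open_map by blast
  then have op: "openin (top_of_set S) (\<Union>i\<in>I. g i ` W)"
    by blast
  have img: "g i x \<in> S" if "i \<in> I" "x \<in> S" for i x
    using hom[OF that(1)] that(2) by (auto simp: homeomorphism_def)
  \<comment> \<open>The saturation of \<open>W\<close> is the union of its finitely many translates,
    hence open. Its complement is compact and so has a closed image.\<close>
  have sat: "p ` S - p ` W = p ` (S - (\<Union>i\<in>I. g i ` W))"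
  proof -
    have "p x \<in> p ` W \<longleftrightarrow> x \<in> (\<Union>i\<in>I. g i ` W)" if x: "x \<in> S" for x
    proof
      assume "p x \<in> p ` W"
      then obtain w where "w \<in> W" "p w = p x" by auto
      then show "x \<in> (\<Union>i\<in>I. g i ` W)"
        using fib[of w x] x WS by auto
    next
      assume "x \<in> (\<Union>i\<in>I. g i ` W)"
      then obtain i w where "i \<in> I" "w \<in> W" "x = g i w" by auto
      then have "p w = p x"
        using fib[of w x] x WS by auto
      then show "p x \<in> p ` W" using \<open>w \<in> W\<close> by (metis image_eqI)
    qed
    then have "{x \<in> S. p x \<notin> p ` W} = S - (\<Union>i\<in>I. g i ` W)" by auto
    moreover have "p ` S - p ` W = p ` {x \<in> S. p x \<notin> p ` W}" by auto
    ultimately show ?thesis by simp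
  qed
  have "closedin (top_of_set S) (S - (\<Union>i\<in>I. g i ` W))"
    using op by (simp add: closedin_def double_diff openin_imp_subset)
  then have "compact (S - (\<Union>i\<in>I. g i ` W))"
    using \<open>compact S\<close> closedin_compact by blast
  then have "compact (p ` S - p ` W)"
    unfolding sat by (meson Diff_subset compact_continuous_image contp continuous_on_subset)
  then have "closedin (top_of_set (p ` S)) (p ` S - p ` W)"
    using closed_subset compact_imp_closed by (metis Diff_subset)
  then show ?thesis
    using WS by (simp add: openin_closedin_eq image_mono)
qed

text \<open>By freeness the translates of a point \<open>x\<close> are distinct, hence separated by
  some distance \<open>r\<close>. A neighbourhood \<open>N\<close> whose translates stay in the
  balls of radius \<open>r/2\<close> about the translates of \<open>x\<close> has pairwise disjoint
  translates, and these are the sheets over the image of \<open>N\<close>.\<close>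

lemma covering_space_finite_free_action:
  fixes S :: "'a::metric_space set" and p :: "'a \<Rightarrow> 'b::t2_space"
  assumes "compact S" and contp: "continuous_on S p" and "finite I"
    and hom: "\<And>i. i \<in> I \<Longrightarrow> \<exists>h. homeomorphism S S (g i) h"
    and fib: "\<And>x y. x \<in> S \<Longrightarrow> y \<in> S \<Longrightarrow> p x = p y \<longleftrightarrow> (\<exists>i\<in>I. y = g i x)"
    and e: "e \<in> I" "\<And>x. x \<in> S \<Longrightarrow> g e x = x"
    and free: "\<And>x i j. x \<in> S \<Longrightarrow> i \<in> I \<Longrightarrow> j \<in> I \<Longrightarrow> g i x = g j x \<Longrightarrow> i = j"
  shows "covering_space S p (p ` S)"
proof
  show "continuous_on S p" "p ` S = p ` S" using contp by auto
  fix y assume "y \<in> p ` S"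
  then obtain x where x: "x \<in> S" "y = p x" by auto
  have contg: "continuous_on S (g i)" if "i \<in> I" for i
    using hom[OF that] by (auto simp: homeomorphism_def)
  have img: "g i u \<in> S" if "i \<in> I" "u \<in> S" for i u
    using hom[OF that(1)] that(2) by (auto simp: homeomorphism_def)
  have pg: "p (g i u) = p u" if "i \<in> I" "u \<in> S" for i u
    using fib[of u "g i u"] img that by metis
  obtain r where r: "r > 0" "\<And>a b. a \<in> (\<lambda>i. g i x) ` I \<Longrightarrow> b \<in> (\<lambda>i. g i x) ` I \<Longrightarrow> a \<noteq> b \<Longrightarrow> r \<le> dist a b"
  proof -
    have fin: "finite ((\<lambda>i. g i x) ` I)" using \<open>finite I\<close> by simp
    show ?thesis
    proof (cases "\<exists>a\<in>(\<lambda>i. g i x) ` I. \<exists>b\<in>(\<lambda>i. g i x) ` I. a \<noteq> b")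
      case True
      let ?D = "(\<lambda>(a,b). dist a b) ` {(a,b)\<in>(\<lambda>i. g i x) ` I \<times> (\<lambda>i. g i x) ` I. a \<noteq> b}"
      have f: "finite ?D"
        using fin by (intro finite_imageI finite_subset[OF _ finite_cartesian_product[OF fin fin]]) auto
      have ne: "?D \<noteq> {}" using True by auto
      show ?thesis
      proof (rule that[of "Min ?D"])
        show "Min ?D > 0" using f ne by (subst Min_gr_iff) auto
        show "Min ?D \<le> dist a b" if "a \<in> (\<lambda>i. g i x) ` I" "b \<in> (\<lambda>i. g i x) ` I" "a \<noteq> b" for a b
          using f that by (intro Min_le) auto
      qed
    next
      case False
      show ?thesis
      \<comment> \<open>The orbit is a single point, so any positive separation serves.\<close>
      proof (rule that[of 1])
        show "1 \<le> dist a b" if "a \<in> (\<lambda>i. g i x) ` I" "b \<in> (\<lambda>i. g i x) ` I" "a \<noteq> b" for a b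
          using False that by blast
      qed simp
    qed
  qed
  define B where "B i = ball (g i x) (r/2)" for i
  have disj: "i = j" if "i \<in> I" "j \<in> I" "z \<in> B i" "z \<in> B j" for i j z
  proof (rule ccontr)
    assume "i \<noteq> j"
    then have "g i x \<noteq> g j x" using free x that by blast
    then have "r \<le> dist (g i x) (g j x)" using r that by blast
    moreover have "dist (g i x) (g j x) < r/2 + r/2"
      using that dist_triangle[of "g i x" "g j x" z] unfolding B_def mem_ball
      by (simp add: dist_commute)
    ultimately show False by simp
  qed
  define N where "N = S \<inter> (\<Inter>i\<in>I. S \<inter> g i -` B i)"
  have opN: "openin (top_of_set S) N"
  proof -
    have "openin (top_of_set S) (\<Inter>i\<in>I. S \<inter> g i -` B i)"
      using \<open>finite I\<close> e(1) contg unfolding B_def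
      by (intro openin_INT2) (auto intro!: continuous_openin_preimage_gen)
    then show ?thesis unfolding N_def by (metis openin_Int openin_subtopology_self)
  qed
  have NS: "N \<subseteq> S" and NB: "\<And>u i. u \<in> N \<Longrightarrow> i \<in> I \<Longrightarrow> g i u \<in> B i"
    unfolding N_def by (auto split: if_splits)
  have xN: "x \<in> N" using x r(1) unfolding N_def B_def by auto
  have omap: "openin (top_of_set (p ` S)) (p ` W)" if "openin (top_of_set S) W" for W
    by (rule open_map_finite_action[OF assms(1-3) hom fib that])
  show "\<exists>T. y \<in> T \<and> openin (top_of_set (p ` S)) T \<and>
            (\<exists>v. \<Union> v = S \<inter> p -` T \<and> (\<forall>u\<in>v. openin (top_of_set S) u) \<and>
                 pairwise disjnt v \<and> (\<forall>u\<in>v. \<exists>q. homeomorphism u T p q))"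
  proof (intro exI[of _ "p ` N"] exI[of _ "(\<lambda>i. g i ` N) ` I"] conjI ballI)
    show "y \<in> p ` N" using x xN by auto
    show "openin (top_of_set (p ` S)) (p ` N)" by (rule omap[OF opN])
    show "\<Union> ((\<lambda>i. g i ` N) ` I) = S \<inter> p -` p ` N"
    proof (intro equalityI subsetI)
      fix z assume "z \<in> \<Union> ((\<lambda>i. g i ` N) ` I)"
      then obtain i u where "i \<in> I" "u \<in> N" "z = g i u" by auto
      then show "z \<in> S \<inter> p -` p ` N" using img pg NS by auto
    next
      fix z assume "z \<in> S \<inter> p -` p ` N"
      then obtain u where "z \<in> S" "u \<in> N" "p u = p z" by auto
      then show "z \<in> \<Union> ((\<lambda>i. g i ` N) ` I)" using fib[of u z] NS by auto
    qed
    show "pairwise disjnt ((\<lambda>i. g i ` N) ` I)"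
    proof (clarsimp simp: pairwise_def)
      fix i j assume ij: "i \<in> I" "j \<in> I" "g i ` N \<noteq> g j ` N"
      have False if "u \<in> N" "u' \<in> N" "g i u = g j u'" for u u'
        using disj[of i j "g i u"] NB that ij by metis
      then show "disjnt (g i ` N) (g j ` N)" by (auto simp: disjnt_def)
    qed
    fix V assume "V \<in> (\<lambda>i. g i ` N) ` I"
    then obtain i where i: "i \<in> I" "V = g i ` N" by auto
    show opV: "openin (top_of_set S) V"
      using hom[OF i(1)] opN i(2) homeomorphism_imp_open_map by blast
    have VS: "V \<subseteq> S" using opV openin_imp_subset by blast
    have eq: "p ` V = p ` N"
      unfolding i(2) image_image using pg[OF i(1)] NS by (auto intro!: image_cong)
    show "\<exists>q. homeomorphism V (p ` N) p q"
    proof (rule homeomorphism_injective_open_map)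
      show "continuous_on V p" using contp VS continuous_on_subset by blast
      show "p ` V = p ` N" by (rule eq)
      show "inj_on p V"
      proof
        fix a b assume "a \<in> V" "b \<in> V" "p a = p b"
        then obtain u u' where u: "u \<in> N" "u' \<in> N" "a = g i u" "b = g i u'" using i by auto
        then have "p u = p u'" using \<open>p a = p b\<close> pg i NS by (metis subsetD)
        \<comment> \<open>The point \<open>u'\<close> lies in the ball of index \<open>e\<close>,
          being in \<open>N\<close>, and in the ball of index \<open>k\<close>, being a translate of
          \<open>u\<close>. Disjointness of the balls forces \<open>k = e\<close>.\<close>
        then obtain k where k: "k \<in> I" "u' = g k u" using fib u NS by blast
        have "u' \<in> B e" using NB[of u' e] e u NS by auto
        moreover have "u' \<in> B k" using NB[of u k] u k by auto
        ultimately have "k = e" using disj k e by blast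
        then show "a = b" using u k e NS by auto
      qed
      show "openin (top_of_set (p ` N)) (p ` U)" if "openin (top_of_set V) U" for U
        using omap[of U] that opV eq
        by (metis openin_imp_subset openin_subset_trans openin_trans image_mono NS)
    qed (rule exI)
  qed
qed

subsection \<open>Lens spaces and the projective plane as Euclidean quotients\<close>

text \<open>A continuous bijection from a compact space to a Hausdorff space is a homeomorphism. The
  map \<open>q\<close> may take values in a type without a topology, such as orbits; a map
  \<open>P\<close> with the same fibres and values in a metric space replaces it.\<close>

lemma quotient_homeomorphic_image:
  fixes S :: "'a::topological_space set" and P :: "'a \<Rightarrow> 'b::metric_space"
  assumes "compact S" "continuous_on S P"
    and fib: "\<And>x y. x \<in> S \<Longrightarrow> y \<in> S \<Longrightarrow> q x = q y \<longleftrightarrow> P x = P y"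
  obtains k where "homeomorphic_map (quotient_topology (top_of_set S) q) (top_of_set (P ` S)) k"
    "\<And>x. x \<in> S \<Longrightarrow> k (q x) = P x"
proof -
  define k where "k b = P (SOME x. x \<in> S \<and> q x = b)" for b
  have k: "k (q x) = P x" if "x \<in> S" for x
  proof -
    have "(SOME y. y \<in> S \<and> q y = q x) \<in> S \<and> q (SOME y. y \<in> S \<and> q y = q x) = q x"
      by (rule someI[of _ x]) (use that in auto)
    then show ?thesis using fib that unfolding k_def by blast
  qed
  let ?Q = "quotient_topology (top_of_set S) q"
  have qm: "quotient_map (top_of_set S) ?Q q"
    by (rule quotient_map_quotient_topology)
  have "continuous_map (top_of_set S) (top_of_set (P ` S)) (k \<circ> q)"
    by (rule continuous_map_eq[of _ _ P]) (use assms k in auto)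
  then have c: "continuous_map ?Q (top_of_set (P ` S)) k"
    by (rule continuous_compose_quotient_map[OF qm])
  have "homeomorphic_map ?Q (top_of_set (P ` S)) k"
  proof (rule continuous_imp_homeomorphic_map[OF c])
    have "compactin (top_of_set S) (topspace (top_of_set S))"
      using \<open>compact S\<close> by (simp add: compactin_subtopology)
    then have "compactin ?Q (q ` S)"
      using image_compactin[OF _ quotient_imp_continuous_map[OF qm]] by fastforce
    then show "compact_space ?Q"
      by (simp add: compact_space_def topspace_quotient_topology)
    show "Hausdorff_space (top_of_set (P ` S))"
      by (intro Hausdorff_space_subtopology) (rule Hausdorff_space_euclidean)
    show "k ` topspace ?Q = topspace (top_of_set (P ` S))"
      using k by (auto simp: topspace_quotient_topology image_image)
    show "inj_on k (topspace ?Q)"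
      using k fib by (auto simp: inj_on_def topspace_quotient_topology)
  qed
  then show ?thesis using that k by blast
qed

section \<open>The Veronese embedding of the projective plane\<close>

lemma neq_uminus_self: "u \<noteq> 0 \<Longrightarrow> u \<noteq> - (u :: 'a::real_vector)"
  by (metis eq_neg_iff_add_eq_0 scaleR_2 scaleR_eq_0_iff zero_neq_numeral)

text \<open>For a unit vector this is the orthogonal projection onto its line. It determines the
  vector up to sign, so it embeds the projective plane in a Euclidean space.\<close>

definition veronese :: "real^3 \<Rightarrow> real^3^3" where
  "veronese u = (\<chi> i j. u $ i * u $ j)"

lemma veronese_mult: "veronese u *v w = (u \<bullet> w) *\<^sub>R u"
  by (simp add: vec_eq_iff veronese_def matrix_vector_mult_def inner_vec_def sum_distrib_left mult_ac)

lemma veronese_uminus [simp]: "veronese (- u) = veronese u"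
  by (simp add: veronese_def)

text \<open>The common projection fixes \<open>v\<close>, so \<open>v\<close> is a multiple of
  \<open>u\<close>, and the norms leave only the factors 1 and -1.\<close>

lemma veronese_eq_iff:
  assumes "norm u = 1" "norm v = 1"
  shows "veronese u = veronese v \<longleftrightarrow> v = u \<or> v = - u"
proof
  assume eq: "veronese u = veronese v"
  have "u \<bullet> u = 1" "v \<bullet> v = 1"
    using assms by (simp_all add: norm_eq_1)
  then have "v = (u \<bullet> v) *\<^sub>R u"
    using veronese_mult[of u v] veronese_mult[of v v] eq by simp
  moreover from this have "\<bar>u \<bullet> v\<bar> = 1"
    using assms by (metis norm_scaleR mult.right_neutral)
  then have "u \<bullet> v = 1 \<or> u \<bullet> v = -1" by linarith
  ultimately show "v = u \<or> v = - u"
    by (metis scaleR_one scaleR_minus1_left)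
qed auto

lemma continuous_on_veronese: "continuous_on S veronese"
  unfolding veronese_def by (intro continuous_intros)

lemma antipodal_class_eq_iff:
  fixes u v :: "real^3"
  shows "{u, - u} = {v, - v} \<longleftrightarrow> v = u \<or> v = - u"
  by (auto simp: doubleton_eq_iff)

lemma projective_plane_embedding:
  obtains \<kappa> where "homeomorphic_map projective_plane (top_of_set (veronese ` sphere 0 1)) \<kappa>"
    "\<And>u. norm u = 1 \<Longrightarrow> \<kappa> {u, - u} = veronese u"
proof -
  obtain k where "homeomorphic_map (quotient_topology (top_of_set (sphere 0 1)) (\<lambda>u. {u, - u}))
         (top_of_set (veronese ` sphere 0 1)) k"
      and "\<And>u. u \<in> sphere 0 1 \<Longrightarrow> k {u, - u} = veronese u"
  proof (rule quotient_homeomorphic_image[of "sphere 0 1" veronese "\<lambda>u. {u, - u}"])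
  show "({u, - u} = {v, - v}) = (veronese u = veronese v)" if "u \<in> sphere 0 1" "v \<in> sphere 0 1" for u v
    using that by (simp add: veronese_eq_iff antipodal_class_eq_iff)
  qed (auto simp: continuous_on_veronese)
  then show thesis
    by (intro that[of k]) (auto simp: projective_plane_def)
qed

section \<open>Roots of unity and the lens action\<close>

definition unity_exp :: "nat \<Rightarrow> int \<Rightarrow> complex" where
  "unity_exp p m = exp (2 * of_real pi * \<i> * of_int m / of_nat p)"

lemma unity_exp_add: "unity_exp p (m + n) = unity_exp p m * unity_exp p n"
  by (simp add: unity_exp_def exp_add[symmetric] add_divide_distrib distrib_left)

lemma unity_exp_0 [simp]: "unity_exp p 0 = 1"
  by (simp add: unity_exp_def)

lemma unity_exp_power: "unity_exp p m ^ k = unity_exp p (int k * m)"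
  by (induction k) (auto simp: unity_exp_add distrib_right)

lemma norm_unity_exp [simp]: "norm (unity_exp p m) = 1"
  by (simp add: unity_exp_def)

lemma unity_exp_eq_1_iff:
  assumes "p > 0" shows "unity_exp p m = 1 \<longleftrightarrow> int p dvd m"
proof -
  have *: "(real_of_int m / real p = real_of_int k) \<longleftrightarrow> m = k * int p" for k
  proof -
    have "(real_of_int m / real p = real_of_int k) \<longleftrightarrow> real_of_int m = real_of_int (k * int p)"
      using assms by (simp add: field_simps)
    then show ?thesis by (simp only: of_int_eq_iff)
  qed
  have "(2 * pi * real_of_int m / real p = 2 * real_of_int k * pi) \<longleftrightarrow> m = k * int p" for k
  proof -
    have "(2 * pi * real_of_int m / real p = 2 * real_of_int k * pi)
        \<longleftrightarrow> (2 * pi) * (real_of_int m / real p) = (2 * pi) * real_of_int k"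
      by (simp add: mult_ac)
    also have "\<dots> \<longleftrightarrow> real_of_int m / real p = real_of_int k"
      by (subst mult_cancel_left) simp
    finally show ?thesis using * by simp
  qed
  then show ?thesis
    unfolding unity_exp_def exp_eq_1 by (auto simp: dvd_def mult.commute)
qed

lemma unity_exp_eq_iff:
  assumes "p > 0" shows "unity_exp p m = unity_exp p n \<longleftrightarrow> int p dvd m - n"
proof -
  have "unity_exp p m = unity_exp p (m - n) * unity_exp p n"
    by (simp flip: unity_exp_add)
  moreover have "unity_exp p n \<noteq> 0"
    by (simp add: unity_exp_def)
  ultimately show ?thesis
    using unity_exp_eq_1_iff[OF assms, of "m - n"] by auto
qed

lemma unity_exp_exists:
  assumes "p > 0" "z ^ p = w ^ p"
  obtains m where "z = unity_exp p m * w"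
proof (cases "w = 0")
  case True
  then show ?thesis using assms that by (auto simp: power_0_left)
next
  case False
  then have "(z / w) ^ p = 1" using assms by (simp add: power_divide)
  then obtain j where "z / w = cis (2 * pi * real j / real p)"
    using Complex.bij_betw_roots_unity[OF assms(1)] unfolding bij_betw_def by blast
  also have "\<dots> = unity_exp p (int j)"
    by (simp add: unity_exp_def cis_conv_exp mult_ac)
  finally have "z = unity_exp p (int j) * w"
    using False by (simp add: field_simps)
  then show ?thesis using that by blast
qed

lemma lens_rotation_eq: "lens_rotation p q z = (unity_exp p 1 * fst z, unity_exp p q * snd z)"
  by (simp add: lens_rotation_def unity_exp_def case_prod_beta)

lemma lens_rotation_funpow:
  "(lens_rotation p q ^^ k) z = (unity_exp p (int k) * fst z, unity_exp p (int k * q) * snd z)"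
proof (induction k)
  case (Suc k)
  have "(lens_rotation p q ^^ Suc k) z
      = lens_rotation p q (unity_exp p (int k) * fst z, unity_exp p (int k * q) * snd z)"
    by (simp only: funpow.simps comp_apply Suc)
  also have "\<dots> = (unity_exp p (int (Suc k)) * fst z, unity_exp p (int (Suc k) * q) * snd z)"
    by (simp add: lens_rotation_eq distrib_right unity_exp_add)
  finally show ?case .
qed simp

lemma lens_rotation_funpow_mod:
  assumes "p > 0"
  shows "(lens_rotation p q ^^ (k mod p)) z = (lens_rotation p q ^^ k) z"
proof -
  have d: "int p dvd int (k mod p) - int k"
    by (metis dvd_minus_mod dvd_diff_commute of_nat_dvd_iff of_nat_diff mod_less_eq_dividend)
  then have "int p dvd int (k mod p) * q - int k * q"
    by (metis dvd_mult2 left_diff_distrib)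
  then show ?thesis
    using d assms by (simp add: lens_rotation_funpow unity_exp_eq_iff)
qed

lemma norm_lens_rotation_funpow [simp]: "norm ((lens_rotation p q ^^ k) z) = norm z"
  by (simp add: lens_rotation_funpow norm_prod_def norm_mult)

lemma linear_lens_rotation_funpow: "linear (lens_rotation p q ^^ k)"
  by (rule linearI) (auto simp: lens_rotation_funpow algebra_simps)

lemma lens_rotation_funpow_inverse:
  assumes "p > 0" "k \<le> p"
  shows "(lens_rotation p q ^^ (p - k)) ((lens_rotation p q ^^ k) z) = z"
proof -
  have "(lens_rotation p q ^^ (p - k)) ((lens_rotation p q ^^ k) z) = (lens_rotation p q ^^ p) z"
    using assms by (metis funpow_add comp_apply le_add_diff_inverse2)
  also have "\<dots> = z"
    using lens_rotation_funpow_mod[OF assms(1), of p q z] by simp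
  finally show ?thesis .
qed

lemma homeomorphism_lens_rotation_funpow:
  assumes "p > 0" "k < p"
  shows "homeomorphism (sphere 0 1) (sphere 0 1) (lens_rotation p q ^^ k) (lens_rotation p q ^^ (p - k))"
proof -
  have c: "continuous_on S (lens_rotation p q ^^ j)" for S j
    using linear_lens_rotation_funpow linear_continuous_on linear_conv_bounded_linear by blast
  have 1: "(lens_rotation p q ^^ (p - k)) ((lens_rotation p q ^^ k) z) = z" for z
    using lens_rotation_funpow_inverse[of p k] assms by simp
  have 2: "(lens_rotation p q ^^ k) ((lens_rotation p q ^^ (p - k)) z) = z" for z
    using lens_rotation_funpow_inverse[of p "p - k" q z] assms by simp
  show ?thesis
    by (rule homeomorphismI[OF c c]) (use 1 2 in auto)
qed

text \<open>A nonzero first coordinate determines the exponent modulo \<open>p\<close>. If it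
  vanishes, the second coordinate determines \<open>q\<close> times the exponent, and
  \<open>q\<close> cancels by coprimality.\<close>

lemma lens_rotation_free:
  assumes "p > 0" "coprime (int p) q" "norm z = 1" "i < p" "j < p"
    "(lens_rotation p q ^^ i) z = (lens_rotation p q ^^ j) z"
  shows "i = j"
proof -
  have "fst z \<noteq> 0 \<or> snd z \<noteq> 0"
    using assms(3) by (metis norm_zero prod.collapse zero_neq_one zero_prod_def)
  then have "int p dvd int i - int j"
  proof
    assume "fst z \<noteq> 0"
    then show ?thesis using assms by (simp add: lens_rotation_funpow unity_exp_eq_iff)
  next
    assume "snd z \<noteq> 0"
    then have "int p dvd (int i - int j) * q"
      using assms by (simp add: lens_rotation_funpow unity_exp_eq_iff left_diff_distrib)
    then show ?thesis using assms(2) by (simp add: coprime_dvd_mult_left_iff)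
  qed
  then show "i = j"
    using assms by (metis mod_eq_dvd_iff of_nat_mod mod_less of_nat_eq_iff)
qed

text \<open>The exponent of the last invariant is the representative of \<open>- q\<close> modulo \<open>p\<close>. It separates the
  orbits with equal \<open>p\<close>-th powers when \<open>z1 \<noteq> 0\<close>; when \<open>z1 = 0\<close> the power of \<open>z2\<close> alone does, as \<open>q\<close> is a
  unit modulo \<open>p\<close>.\<close>

definition lens_invariants :: "nat \<Rightarrow> int \<Rightarrow> complex \<times> complex \<Rightarrow> complex \<times> complex \<times> complex" where
  "lens_invariants p q = (\<lambda>(z1, z2). (z1 ^ p, z2 ^ p, z1 ^ nat (- q mod int p) * z2))"

lemma continuous_on_lens_invariants: "continuous_on S (lens_invariants p q)"
  unfolding lens_invariants_def case_prod_beta by (intro continuous_intros)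

lemma lens_invariants_eq_iff:
  assumes p: "p > 0" and cop: "coprime (int p) q" and nz: "norm z = 1" and nw: "norm w = 1"
  shows "lens_invariants p q z = lens_invariants p q w \<longleftrightarrow> (\<exists>k\<in>{..<p}. w = (lens_rotation p q ^^ k) z)"
proof -
  define a where "a = nat (- q mod int p)"
  have a: "int p dvd int a + q"
    using p unfolding a_def by (simp add: mod_0_imp_dvd mod_add_left_eq)
  \<comment> \<open>The factor by which \<open>m\<close> rotations multiply the mixed monomial: its
    exponent \<open>m (a + q)\<close> is divisible by \<open>p\<close>.\<close>
  have ap: "unity_exp p m ^ a * unity_exp p (m * q) = 1" for m
  proof -
    have "unity_exp p m ^ a * unity_exp p (m * q) = unity_exp p (m * (int a + q))"
      by (simp add: unity_exp_power unity_exp_add distrib_left mult.commute)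
    then show ?thesis using a p by (simp add: unity_exp_eq_1_iff)
  qed
  have pp: "unity_exp p m ^ p = 1" for m
    using p by (simp add: unity_exp_power unity_exp_eq_1_iff)
  obtain z1 z2 w1 w2 where zw: "z = (z1, z2)" "w = (w1, w2)" by fastforce
  have inv: "lens_invariants p q (x, y) = (x ^ p, y ^ p, x ^ a * y)" for x y
    by (simp add: lens_invariants_def a_def)
  show ?thesis
  proof
    assume "\<exists>k\<in>{..<p}. w = (lens_rotation p q ^^ k) z"
    then obtain k where "w1 = unity_exp p (int k) * z1" "w2 = unity_exp p (int k * q) * z2"
      using zw by (auto simp: lens_rotation_funpow)
    moreover have "(unity_exp p (int k) * z1) ^ a * (unity_exp p (int k * q) * z2)
        = (unity_exp p (int k) ^ a * unity_exp p (int k * q)) * (z1 ^ a * z2)"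
      by (simp add: power_mult_distrib mult_ac)
    ultimately show "lens_invariants p q z = lens_invariants p q w"
      unfolding zw inv using ap[of "int k"] pp by (simp add: power_mult_distrib)
  next
    assume "lens_invariants p q z = lens_invariants p q w"
    then have e: "w1 ^ p = z1 ^ p" "w2 ^ p = z2 ^ p" "w1 ^ a * w2 = z1 ^ a * z2"
      unfolding zw inv by auto
    have "\<exists>m::int. w1 = unity_exp p m * z1 \<and> w2 = unity_exp p (m * q) * z2"
    proof (cases "z1 = 0")
      case True
      then have "w1 = 0" using e p by (simp add: power_0_left)
      obtain m where m: "w2 = unity_exp p m * z2"
        using unity_exp_exists[OF p e(2)] by blast
      \<comment> \<open>\<open>r\<close> inverts \<open>q\<close> modulo \<open>p\<close>, so
        \<open>m r\<close> rotations turn the second coordinate by the required root of unity. The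
        first coordinate is 0 and imposes nothing.\<close>
      obtain r s where r: "r * q + s * int p = 1"
        using bezout_int[of q "int p"] cop by (auto simp: coprime_iff_gcd_eq_1 gcd.commute)
      have "(m * r) * q - m = int p * (- (m * s))"
      proof -
        have "m * (r * q + s * int p) = m" using r by simp
        then show ?thesis by (simp add: algebra_simps)
      qed
      then have "int p dvd (m * r) * q - m" by (metis dvd_triv_left)
      then have "unity_exp p ((m * r) * q) = unity_exp p m"
        using p by (simp add: unity_exp_eq_iff)
      then show ?thesis using True \<open>w1 = 0\<close> m by (metis mult_zero_right)
    next
      case False
      obtain m where m: "w1 = unity_exp p m * z1"
        using unity_exp_exists[OF p e(1)] by blast
      have "z1 ^ a * (unity_exp p m ^ a * w2) = z1 ^ a * z2"
        using e(3) m by (simp add: power_mult_distrib mult_ac)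
      then have "unity_exp p m ^ a * w2 = z2" using False by simp
      then have "unity_exp p (m * q) * z2 = w2"
        using ap[of m] by (metis mult.commute mult.left_commute mult.right_neutral)
      then show ?thesis using m by auto
    qed
    then obtain m where m: "w1 = unity_exp p m * z1" "w2 = unity_exp p (m * q) * z2" by auto
    define k where "k = nat (m mod int p)"
    have k: "k < p" "int k = m mod int p"
      using p unfolding k_def by (auto simp: nat_less_iff)
    have "int p dvd int k - m"
      using k by (metis dvd_diff_commute dvd_minus_mod)
    then have "unity_exp p (int k) = unity_exp p m" "unity_exp p (int k * q) = unity_exp p (m * q)"
      using p by (auto simp: unity_exp_eq_iff simp flip: left_diff_distrib)
    then show "\<exists>k\<in>{..<p}. w = (lens_rotation p q ^^ k) z"
      using k(1) m zw by (intro bexI[of _ k]) (auto simp: lens_rotation_funpow)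
  qed
qed

lemma lens_orbit_eq_iff:
  assumes p: "p > 0"
  shows "lens_orbit p q z = lens_orbit p q w \<longleftrightarrow> (\<exists>k\<in>{..<p}. w = (lens_rotation p q ^^ k) z)"
proof
  assume "lens_orbit p q z = lens_orbit p q w"
  moreover have "w \<in> lens_orbit p q w"
    unfolding lens_orbit_def by (rule range_eqI[of _ _ 0]) simp
  ultimately obtain k where "w = (lens_rotation p q ^^ k) z"
    unfolding lens_orbit_def by auto
  then show "\<exists>k\<in>{..<p}. w = (lens_rotation p q ^^ k) z"
    using lens_rotation_funpow_mod[OF p, of k q z] p by (intro bexI[of _ "k mod p"]) auto
next
  assume "\<exists>k\<in>{..<p}. w = (lens_rotation p q ^^ k) z"
  then obtain k where k: "k < p" "w = (lens_rotation p q ^^ k) z" by auto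
  have z: "z = (lens_rotation p q ^^ (p - k)) w"
    using k lens_rotation_funpow_inverse[of p k q z] p by simp
  have sub: "lens_orbit p q ((lens_rotation p q ^^ j) x) \<subseteq> lens_orbit p q x" for j x
  proof
    fix y assume "y \<in> lens_orbit p q ((lens_rotation p q ^^ j) x)"
    then obtain i where "y = (lens_rotation p q ^^ i) ((lens_rotation p q ^^ j) x)"
      unfolding lens_orbit_def by blast
    then have "y = (lens_rotation p q ^^ (i + j)) x"
      by (simp only: funpow_add comp_apply)
    then show "y \<in> lens_orbit p q x"
      unfolding lens_orbit_def by blast
  qed
  show "lens_orbit p q z = lens_orbit p q w"
    using sub[of k z] sub[of "p - k" w] unfolding k(2)[symmetric] z[symmetric] by blast
qed

lemma lens_space_embedding:
  assumes "p > 0" "coprime (int p) q"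
  obtains \<iota> where "homeomorphic_map (lens_space p q) (top_of_set (lens_invariants p q ` sphere 0 1)) \<iota>"
    "\<And>z. norm z = 1 \<Longrightarrow> \<iota> (lens_orbit p q z) = lens_invariants p q z"
proof -
  obtain k where "homeomorphic_map (quotient_topology (top_of_set (sphere 0 1)) (lens_orbit p q))
         (top_of_set (lens_invariants p q ` sphere 0 1)) k"
      and "\<And>u. u \<in> sphere 0 1 \<Longrightarrow> k (lens_orbit p q u) = lens_invariants p q u"
  proof (rule quotient_homeomorphic_image[of "sphere 0 1" "lens_invariants p q" "lens_orbit p q"])
  show "(lens_orbit p q z = lens_orbit p q w) = (lens_invariants p q z = lens_invariants p q w)"
    if "z \<in> sphere 0 1" "w \<in> sphere 0 1" for z w
    using that assms by (simp add: lens_invariants_eq_iff lens_orbit_eq_iff)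
  qed (auto simp: continuous_on_lens_invariants)
  then show thesis
    by (intro that[of k]) (auto simp: lens_space_def)
qed

subsection \<open>A reflection of the three-sphere is not homotopic to the identity\<close>

lemma homotopic_with_canonI:
  fixes h :: "real \<Rightarrow> 'a::topological_space \<Rightarrow> 'b::topological_space"
  assumes "continuous_on ({0..1} \<times> S) (\<lambda>p. h (fst p) (snd p))"
    and "\<And>t x. t \<in> {0..1} \<Longrightarrow> x \<in> S \<Longrightarrow> h t x \<in> T"
    and "\<And>x. x \<in> S \<Longrightarrow> h 0 x = f x" "\<And>x. x \<in> S \<Longrightarrow> h 1 x = g x"
  shows "homotopic_with_canon (\<lambda>x. True) S T f g"
proof (subst homotopic_with)
  show "\<exists>k. continuous_map (prod_topology (top_of_set {0..1::real}) (top_of_set S)) (top_of_set T) k \<and>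
        (\<forall>x\<in>topspace (top_of_set S). k (0, x) = f x) \<and>
        (\<forall>x\<in>topspace (top_of_set S). k (1, x) = g x) \<and> (\<forall>t\<in>{0..1::real}. True)"
    by (rule exI[of _ "\<lambda>p. h (fst p) (snd p)"]) (use assms in \<open>force simp: Pi_iff\<close>)
qed simp

lemma nsphere_eq_top_of_set:
  "nsphere n = top_of_set {x. (\<Sum>i\<le>n. (x i)\<^sup>2) = 1 \<and> (\<forall>i>n. x i = 0)}"
  unfolding nsphere euclidean_product_topology ..

lemma norm_real3_prod:
  "(norm (x :: (real^3) \<times> real))\<^sup>2 = (fst x $ 1)\<^sup>2 + (fst x $ 2)\<^sup>2 + (fst x $ 3)\<^sup>2 + (snd x)\<^sup>2"
  unfolding norm_prod_def norm_vec_def L2_set_def by (simp add: sum_3)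

text \<open>In real dimension 4 minus the identity is a rotation: the coordinate pairs (1, last) and
  (2, 3) are rotated simultaneously, with the angle running from \<pi> to 0.\<close>

lemma homotopic_uminus_id_real3_prod:
  "homotopic_with_canon (\<lambda>x. True) (sphere 0 1) (sphere 0 1) uminus (id :: (real^3) \<times> real \<Rightarrow> _)"
proof -
  define h :: "real \<Rightarrow> (real^3) \<times> real \<Rightarrow> (real^3) \<times> real" where
    "h t x = (\<chi> i. if i = 1 then cos t * fst x $ 1 - sin t * snd x
                   else if i = 2 then cos t * fst x $ 2 - sin t * fst x $ 3
                   else sin t * fst x $ 2 + cos t * fst x $ 3,
              sin t * fst x $ 1 + cos t * snd x)" for t x
  have nh: "norm (h t x) = 1" if "norm x = 1" for t x
  proof -
    have alg: "(c*a - s*d)\<^sup>2 + (c*b - s*e)\<^sup>2 + (s*b + c*e)\<^sup>2 + (s*a + c*d)\<^sup>2 = (c\<^sup>2 + s\<^sup>2) * (a\<^sup>2 + b\<^sup>2 + e\<^sup>2 + d\<^sup>2)"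
      for a b c d e s :: real
      by (simp add: power2_eq_square algebra_simps)
    have "(norm (h t x))\<^sup>2 = ((cos t)\<^sup>2 + (sin t)\<^sup>2) * (norm x)\<^sup>2"
      unfolding norm_real3_prod alg[symmetric] by (simp add: h_def)
    then have "(norm (h t x))\<^sup>2 = 1" using that by simp
    then show ?thesis by (simp add: norm_eq_sqrt_inner)
  qed
  have ch: "continuous_on S (\<lambda>p. h (pi * (1 - fst p)) (snd p))" for S
    unfolding h_def
  proof (intro continuous_intros)
    fix i :: 3
    show "continuous_on S (\<lambda>x. if i = 1 then cos (pi * (1 - fst x)) * fst (snd x) $ 1 - sin (pi * (1 - fst x)) * snd (snd x)
                   else if i = 2 then cos (pi * (1 - fst x)) * fst (snd x) $ 2 - sin (pi * (1 - fst x)) * fst (snd x) $ 3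
                   else sin (pi * (1 - fst x)) * fst (snd x) $ 2 + cos (pi * (1 - fst x)) * fst (snd x) $ 3)"
      by (cases "i = 1"; cases "i = 2"; simp; intro continuous_intros)
  qed
  show ?thesis
    by (rule homotopic_with_canonI[OF ch])
       (use nh in \<open>auto simp: h_def vec_eq_iff forall_3 prod_eq_iff\<close>)
qed

lemma reflection_not_homotopic_id_real3_prod:
  "\<not> homotopic_with_canon (\<lambda>x. True) (sphere 0 1) (sphere 0 1)
       (\<lambda>x :: (real^3) \<times> real. (fst x, - snd x)) id"
proof
  assume hom: "homotopic_with_canon (\<lambda>x. True) (sphere 0 1) (sphere 0 1)
       (\<lambda>x :: (real^3) \<times> real. (fst x, - snd x)) id"
  \<comment> \<open>\<open>\<phi>\<close> and \<open>\<psi>\<close> pass to the model of the sphere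
    by sequences, on which the Brouwer degree is defined. The real factor becomes index 0, the
    coordinate whose change of sign has degree -1.\<close>
  define \<phi> :: "(nat \<Rightarrow> real) \<Rightarrow> (real^3) \<times> real" where
    "\<phi> x = (\<chi> i. if i = 1 then x 1 else if i = 2 then x 2 else x 3, x 0)" for x
  define \<psi> :: "(real^3) \<times> real \<Rightarrow> nat \<Rightarrow> real" where
    "\<psi> y i = (if i = 0 then snd y else if i = 1 then fst y $ 1 else if i = 2 then fst y $ 2
              else if i = 3 then fst y $ 3 else 0)" for y i
  let ?S = "{x :: nat \<Rightarrow> real. (\<Sum>i\<le>3. (x i)\<^sup>2) = 1 \<and> (\<forall>i>3. x i = 0)}"
  have sum3: "(\<Sum>i\<le>3. f i) = f 0 + f 1 + f 2 + f (3::nat)" for f :: "nat \<Rightarrow> real"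
    by (simp add: numeral_3_eq_3 numeral_2_eq_2)
  have cc: "continuous_on A (\<lambda>x. x j)" for A :: "(nat \<Rightarrow> real) set" and j :: nat
    by (rule continuous_on_subset[OF continuous_on_product_coordinates]) auto
  have c\<phi>: "continuous_on ?S \<phi>"
    unfolding \<phi>_def
  proof (intro continuous_intros cc)
    fix i :: 3
    show "continuous_on ?S (\<lambda>x. if i = 1 then x 1 else if i = 2 then x 2 else x 3)"
      by (cases "i = 1"; cases "i = 2"; simp; intro cc)
  qed
  have \<phi>S: "\<phi> x \<in> sphere 0 1" if "x \<in> ?S" for x
  proof -
    have "(norm (\<phi> x))\<^sup>2 = 1"
      using that unfolding norm_real3_prod by (simp add: \<phi>_def sum3)
    then show ?thesis by (simp add: norm_eq_sqrt_inner)
  qed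
  have c\<psi>: "continuous_on (sphere 0 1) \<psi>"
  proof (rule continuous_on_coordinatewise_then_product)
    fix i
    show "continuous_on (sphere 0 1) (\<lambda>x. \<psi> x i)"
      unfolding \<psi>_def
      by (cases "i = 0"; cases "i = 1"; cases "i = 2"; cases "i = 3"; simp; intro continuous_intros)
  qed
  have \<psi>S: "\<psi> y \<in> ?S" if "y \<in> sphere 0 1" for y
  proof -
    have "(norm y)\<^sup>2 = 1" using that by simp
    then show ?thesis unfolding norm_real3_prod by (simp add: \<psi>_def sum3)
  qed
  have "homotopic_with_canon (\<lambda>x. True) ?S (sphere 0 1) ((\<lambda>x. (fst x, - snd x)) \<circ> \<phi>) (id \<circ> \<phi>)"
    by (rule homotopic_with_compose_continuous_right[OF _ c\<phi>]) (use hom \<phi>S in auto)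
  then have "homotopic_with_canon (\<lambda>x. True) ?S ?S (\<psi> \<circ> ((\<lambda>x. (fst x, - snd x)) \<circ> \<phi>)) (\<psi> \<circ> (id \<circ> \<phi>))"
    by (rule homotopic_with_compose_continuous_left[OF _ c\<psi>]) (use \<psi>S in auto)
  then have "homotopic_with_canon (\<lambda>x. True) ?S ?S (\<lambda>x i. if i = 0 then - x i else x i) id"
  proof (rule homotopic_with_eq)
    show "(\<lambda>i. if i = 0 then - x i else x i) = (\<psi> \<circ> ((\<lambda>x. (fst x, - snd x)) \<circ> \<phi>)) x"
      if "x \<in> topspace (top_of_set ?S)" for x
      using that by (auto simp: \<phi>_def \<psi>_def fun_eq_iff)
    show "id x = (\<psi> \<circ> (id \<circ> \<phi>)) x" if "x \<in> topspace (top_of_set ?S)" for x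
      using that by (auto simp: \<phi>_def \<psi>_def fun_eq_iff)
  qed simp
  then have "homotopic_with (\<lambda>x. True) (nsphere 3) (nsphere 3) (\<lambda>x i. if i = 0 then - x i else x i) id"
    by (simp add: nsphere_eq_top_of_set)
  from Brouwer_degree2_homotopic[OF this] show False
    by (simp add: Brouwer_degree2_reflection)
qed

text \<open>This map is the reflection of the last coordinate followed by minus the identity, and
  the latter is homotopic to the identity in dimension 4.\<close>

lemma partial_antipodal_not_homotopic_id:
  "\<not> homotopic_with_canon (\<lambda>x. True) (sphere 0 1) (sphere 0 1)
       (\<lambda>x :: (real^3) \<times> real. (- fst x, snd x)) id"
proof
  let ?S = "sphere 0 1 :: ((real^3) \<times> real) set"
  let ?R = "\<lambda>x :: (real^3) \<times> real. (- fst x, snd x)"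
  assume hom: "homotopic_with_canon (\<lambda>x. True) ?S ?S ?R id"
  have "continuous_on ?S ?R" by (intro continuous_intros)
  moreover have "?R \<in> ?S \<rightarrow> ?S" by (auto simp: norm_prod_def)
  ultimately
  have "homotopic_with_canon (\<lambda>x. True) ?S ?S (uminus \<circ> ?R) (id \<circ> ?R)"
    by (rule homotopic_with_compose_continuous_right[OF homotopic_uminus_id_real3_prod])
  then have "homotopic_with_canon (\<lambda>x. True) ?S ?S (\<lambda>x. (fst x, - snd x)) ?R"
    by (rule homotopic_with_eq) auto
  from homotopic_with_trans[OF this hom] show False
    using reflection_not_homotopic_id_real3_prod by simp
qed

subsection \<open>Germs of local homeomorphisms\<close>

lemma continuous_on_comp_fst: "continuous_on S f \<Longrightarrow> continuous_on (S \<times> T) (\<lambda>p. f (fst p))"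
  by (rule continuous_on_compose2[where f = fst]) (auto intro: continuous_on_fst continuous_on_id)

lemma continuous_on_comp_snd: "continuous_on T f \<Longrightarrow> continuous_on (S \<times> T) (\<lambda>p. f (snd p))"
  by (rule continuous_on_compose2[where f = snd]) (auto intro: continuous_on_snd continuous_on_id)

lemma homotopic_sgn_comp:
  fixes H :: "real \<Rightarrow> 'a::topological_space \<Rightarrow> 'b::real_normed_vector"
  assumes "continuous_on ({0..1} \<times> S) (\<lambda>p. H (fst p) (snd p))"
    and "\<And>t u. t \<in> {0..1} \<Longrightarrow> u \<in> S \<Longrightarrow> H t u \<noteq> 0"
  shows "homotopic_with_canon (\<lambda>x. True) S (sphere 0 1) (\<lambda>u. sgn (H 0 u)) (\<lambda>u. sgn (H 1 u))"
proof (rule homotopic_with_canonI[where h = "\<lambda>t u. sgn (H t u)"])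
  show "continuous_on ({0..1} \<times> S) (\<lambda>p. sgn (H (fst p) (snd p)))"
    by (rule continuous_on_sgn[OF assms(1)]) (use assms(2) in auto)
  show "sgn (H t u) \<in> sphere 0 1" if "t \<in> {0..1}" "u \<in> S" for t u
    using assms(2)[OF that] by (simp add: norm_sgn)
qed auto

lemma homotopic_sgn_linear:
  fixes f g :: "'a::topological_space \<Rightarrow> 'b::real_normed_vector"
  assumes f: "continuous_on S f" and g: "continuous_on S g"
    and "\<And>t u. t \<in> {0..1} \<Longrightarrow> u \<in> S \<Longrightarrow> (1 - t) *\<^sub>R f u + t *\<^sub>R g u \<noteq> 0"
  shows "homotopic_with_canon (\<lambda>x. True) S (sphere 0 1) (\<lambda>u. sgn (f u)) (\<lambda>u. sgn (g u))"
proof -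
  have "continuous_on ({0..1} \<times> S) (\<lambda>p. f (snd p))" "continuous_on ({0..1} \<times> S) (\<lambda>p. g (snd p))"
    by (simp_all add: continuous_on_comp_snd f g)
  then have "continuous_on ({0..1} \<times> S) (\<lambda>p. (1 - fst p) *\<^sub>R f (snd p) + fst p *\<^sub>R g (snd p))"
    by (intro continuous_intros)
  from homotopic_sgn_comp[OF this] assms(3) show ?thesis by simp
qed

text \<open>By invariance of domain the image of \<open>G\<close> contains a ball about 0, so the
  inverse of \<open>G\<close> carries a small sphere into the ball about \<open>x\<close>; the
  direction from \<open>x\<close> to its points is \<open>g\<close>. Precomposition with
  \<open>g\<close> cancels the direction map up to homotopy, which spares computing its
  degree.\<close>

lemma germ_direction_right_inverse:
  fixes G :: "'a::euclidean_space \<Rightarrow> 'b::euclidean_space"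
  assumes dim: "DIM('b) \<le> DIM('a)" and r: "r > 0"
    and contG: "continuous_on (cball x r) G" and inj: "inj_on G (cball x r)" and Gx: "G x = 0"
  obtains g where "continuous_on (sphere 0 1) g" "g \<in> sphere 0 1 \<rightarrow> sphere 0 1"
    "homotopic_with_canon (\<lambda>x. True) (sphere 0 1) (sphere 0 1) ((\<lambda>u. sgn (G (x + r *\<^sub>R u))) \<circ> g) id"
proof -
  have "open (G ` ball x r)"
    by (rule invariance_of_domain_gen[OF open_ball continuous_on_subset[OF contG ball_subset_cball]
          inj_on_subset[OF inj ball_subset_cball] dim])
  moreover have "0 \<in> G ` ball x r" using Gx r by (metis centre_in_ball image_eqI)
  ultimately obtain d where d: "d > 0" "cball 0 d \<subseteq> G ` ball x r"
    by (meson open_contains_cball)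
  obtain G' where G': "homeomorphism (cball x r) (G ` cball x r) G G'"
    using homeomorphism_compact[OF compact_cball contG refl inj] by blast
  have sub: "cball 0 d \<subseteq> G ` cball x r"
    using d(2) ball_subset_cball by blast
  have contG': "continuous_on (cball 0 d) G'"
    using G' sub by (auto simp: homeomorphism_def intro: continuous_on_subset)
  define w where "w v = G' (d *\<^sub>R v) - x" for v
  have dv: "d *\<^sub>R v \<in> cball 0 d" if "v \<in> sphere 0 1" for v :: 'b
    using that d by simp
  have contw: "continuous_on (sphere 0 1) w"
    unfolding w_def using dv
    by (intro continuous_intros continuous_on_compose2[OF contG']) auto
  have Gw: "G (x + w v) = d *\<^sub>R v" and wr: "norm (w v) \<le> r" if "v \<in> sphere 0 1" for v
  proof -
    have "d *\<^sub>R v \<in> G ` cball x r" using dv[OF that] sub by blast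
    then have "G' (d *\<^sub>R v) \<in> cball x r" "G (G' (d *\<^sub>R v)) = d *\<^sub>R v"
      using G' by (auto simp: homeomorphism_def)
    then show "G (x + w v) = d *\<^sub>R v" "norm (w v) \<le> r"
      by (simp_all add: w_def dist_norm norm_minus_commute)
  qed
  have w0: "w v \<noteq> 0" if "v \<in> sphere 0 1" for v
  proof
    assume "w v = 0"
    then have "d *\<^sub>R v = 0" using Gw[OF that] Gx by simp
    then show False using d that by auto
  qed
  \<comment> \<open>The argument slides along its ray from \<open>x\<close>, from distance
    \<open>r\<close> at time 0 to the preimage of \<open>d v\<close> at time 1. It never meets
    \<open>x\<close> and \<open>G\<close> is injective, so the value stays nonzero.\<close>
  define H where "H t v = G (x + ((1 - t) * r / norm (w v) + t) *\<^sub>R w v)" for t v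
  define g where "g v = sgn (w v)" for v
  have in_ball: "x + ((1 - t) * r / norm (w v) + t) *\<^sub>R w v \<in> cball x r"
    and nz: "((1 - t) * r / norm (w v) + t) *\<^sub>R w v \<noteq> 0"
    if "t \<in> {0..1}" "v \<in> sphere 0 1" for t v
  proof -
    have pos: "norm (w v) > 0" using w0 that by simp
    have "((1 - t) * r / norm (w v) + t) * norm (w v) = (1 - t) * r + t * norm (w v)"
      using pos by (simp add: field_simps)
    also have "\<dots> \<le> (1 - t) * r + t * r"
      using wr[OF that(2)] that(1) by (intro add_left_mono mult_left_mono) auto
    finally have le: "((1 - t) * r / norm (w v) + t) * norm (w v) \<le> r" by (simp add: algebra_simps)
    have c0: "(1 - t) * r / norm (w v) + t \<ge> 0" using pos r that by simp
    show "x + ((1 - t) * r / norm (w v) + t) *\<^sub>R w v \<in> cball x r"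
      using le c0 by (simp add: dist_norm)
    have "(1 - t) * r / norm (w v) + t > 0"
    proof (cases "t = 0")
      case True then show ?thesis using pos r by simp
    next
      case False then show ?thesis using pos r that by (simp add: add_nonneg_pos)
    qed
    then show "((1 - t) * r / norm (w v) + t) *\<^sub>R w v \<noteq> 0" using w0 that by simp
  qed
  have "homotopic_with_canon (\<lambda>x. True) (sphere 0 1) (sphere 0 1) (\<lambda>v. sgn (H 0 v)) (\<lambda>v. sgn (H 1 v))"
  proof (rule homotopic_sgn_comp)
    have "continuous_on ({0..1} \<times> sphere 0 1) (\<lambda>p. w (snd p))"
      by (rule continuous_on_comp_snd[OF contw])
    then have "continuous_on ({0..1} \<times> sphere 0 1)
        (\<lambda>p. x + ((1 - fst p) * r / norm (w (snd p)) + fst p) *\<^sub>R w (snd p))"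
      by (intro continuous_intros) (use w0 in auto)
    then show "continuous_on ({0..1} \<times> sphere 0 1) (\<lambda>p. H (fst p) (snd p))"
      unfolding H_def by (rule continuous_on_compose2[OF contG]) (use in_ball in auto)
    show "H t v \<noteq> 0" if "t \<in> {0..1}" "v \<in> sphere 0 1" for t v
    proof
      assume "H t v = 0"
      then have "x + ((1 - t) * r / norm (w v) + t) *\<^sub>R w v = x"
        unfolding H_def using Gx inj in_ball[OF that] r
        by (metis centre_in_cball inj_onD less_imp_le)
      then show False using nz[OF that] by simp
    qed
  qed
  then have "homotopic_with_canon (\<lambda>x. True) (sphere 0 1) (sphere 0 1)
      ((\<lambda>u. sgn (G (x + r *\<^sub>R u))) \<circ> g) id"
  proof (rule homotopic_with_eq)
    fix v :: 'b assume "v \<in> topspace (top_of_set (sphere 0 1))"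
    then have v: "v \<in> sphere 0 1" by simp
    show "((\<lambda>u. sgn (G (x + r *\<^sub>R u))) \<circ> g) v = sgn (H 0 v)"
      by (simp add: H_def g_def sgn_div_norm divide_inverse)
    show "id v = sgn (H 1 v)"
      using Gw[OF v] v d by (simp add: H_def sgn_div_norm)
  qed simp
  moreover have "continuous_on (sphere 0 1) g"
    unfolding g_def using contw w0 by (intro continuous_on_sgn) auto
  moreover have "g \<in> sphere 0 1 \<rightarrow> sphere 0 1"
    using w0 by (auto simp: g_def norm_sgn)
  ultimately show ?thesis using that by blast
qed

lemma sgn_close:
  fixes x y :: "'a::real_normed_vector"
  assumes "norm x = 1" "dist y x \<le> e" "e < 1"
  shows "y \<noteq> 0" "dist (sgn y) x \<le> 2 * e"
proof -
  show y: "y \<noteq> 0" using assms by (auto simp: dist_norm)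
  have "\<bar>norm y - 1\<bar> \<le> e"
    using assms norm_triangle_ineq3[of y x] by (simp add: dist_norm)
  moreover have "dist (sgn y) y = \<bar>norm y - 1\<bar>"
  proof -
    have "sgn y - y = (inverse (norm y) - 1) *\<^sub>R y"
      by (simp add: sgn_div_norm scaleR_left_diff_distrib)
    then have "dist (sgn y) y = \<bar>inverse (norm y) - 1\<bar> * norm y" by (simp add: dist_norm)
    also have "\<dots> = \<bar>(inverse (norm y) - 1) * norm y\<bar>" by (simp add: abs_mult)
    also have "(inverse (norm y) - 1) * norm y = 1 - norm y" using y by (simp add: left_diff_distrib)
    finally show ?thesis by simp
  qed
  ultimately show "dist (sgn y) x \<le> 2 * e"
    using dist_triangle[of "sgn y" x y] assms by linarith
qed

text \<open>Here \<open>a\<close> restricts to a fibre coordinate on the fibres of \<open>F\<close> met by \<open>x\<close>, with the same orientation along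
  the whole path; away from these fibres \<open>a\<close> is arbitrary. Near \<open>x 0\<close> it can be deformed to \<open>b\<close>, which is
  also injective together with \<open>F\<close> on a full neighbourhood.\<close>

lemma no_fibre_orientation_reversal:
  fixes F :: "complex \<times> complex \<Rightarrow> real^3" and a b :: "complex \<times> complex \<Rightarrow> real"
    and x :: "real \<Rightarrow> complex \<times> complex" and T :: "complex \<times> complex \<Rightarrow> complex \<times> complex"
  assumes F: "continuous_on (sphere 0 1) F" "\<And>z. norm z = 1 \<Longrightarrow> norm (F z) = 1"
    and a: "continuous_on (sphere 0 1) a"
    and x: "continuous_on {0..1} x" "\<And>t. t \<in> {0..1} \<Longrightarrow> norm (x t) = 1"
    and T: "linear T" "\<And>z. norm (T z) = norm z"
      "homotopic_with_canon (\<lambda>x. True) (sphere 0 1) (sphere 0 1) T id"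
    and x1: "x 1 = T (x 0)"
    and FT: "\<And>z. norm z = 1 \<Longrightarrow> F (T z) = - F z"
    and aT: "\<And>z. norm z = 1 \<Longrightarrow> F z = F (x 0) \<Longrightarrow> a (T z) = a z"
    and r: "r > 0"
    and iso: "\<And>t y. t \<in> {0..1} \<Longrightarrow> norm y = 1 \<Longrightarrow> dist y (x t) < r \<Longrightarrow> F y = F (x t) \<Longrightarrow> a y = 0 \<Longrightarrow> y = x t"
    and b: "continuous_on (sphere 0 1 \<inter> ball (x 0) r) b" "b (x 0) = 0"
      "inj_on (\<lambda>y. (F y, b y)) (sphere 0 1 \<inter> ball (x 0) r)"
    and sgn: "\<And>y. norm y = 1 \<Longrightarrow> dist y (x 0) < r \<Longrightarrow> F y = F (x 0) \<Longrightarrow> y \<noteq> x 0 \<Longrightarrow> a y * b y > 0"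
  shows False
proof -
  \<comment> \<open>Less than 1, so that the sphere of radius \<open>e\<close> about a unit vector
    avoids the origin and can be projected radially. The projection lands within
    \<open>2 * e\<close> of the centre, which is still less than \<open>r\<close>.\<close>
  define e where "e = min (1/2) (r/3)"
  have e: "e > 0" "e < 1" "2 * e < r" "e < r" using r by (auto simp: e_def)
  let ?S = "sphere 0 1 :: (complex \<times> complex) set"
  let ?S' = "sphere 0 1 :: ((real^3) \<times> real) set"
  \<comment> \<open>On the cone over \<open>F\<close>, the antipodal map of the sphere becomes linear of determinant -1.\<close>
  define A where "A y = norm y *\<^sub>R F (sgn y)" for y
  define \<alpha> where "\<alpha> y = a (sgn y)" for y
  define \<beta> where "\<beta> y = b (sgn y)" for y
  have n1: "norm (sgn y) = 1" if "y \<noteq> 0" for y :: "complex \<times> complex"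
    using that by (simp add: norm_sgn)
  have sgn1: "sgn y = y" if "norm y = 1" for y :: "complex \<times> complex"
    using that by (simp add: sgn_div_norm)
  have csgn: "continuous_on (- {0 :: complex \<times> complex}) sgn"
    by (rule continuous_on_sgn[OF continuous_on_id]) auto
  have sgnS: "sgn ` (- {0}) \<subseteq> ?S" using n1 by (simp add: image_subset_iff)
  have "continuous_on (- {0}) (\<lambda>y. F (sgn y))"
    by (rule continuous_on_compose2[OF F(1) csgn sgnS])
  then have contA: "continuous_on (- {0}) A"
    unfolding A_def by (intro continuous_intros)
  have cont\<alpha>: "continuous_on (- {0}) \<alpha>"
    unfolding \<alpha>_def by (rule continuous_on_compose2[OF a csgn sgnS])
  have normA: "norm (A y) = norm y" for y
    by (cases "y = 0") (auto simp: A_def F(2) n1)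
  have A1: "A y = F y" if "norm y = 1" for y
    using that by (simp add: A_def sgn1)
  have Aeq: "norm y = 1 \<and> F y = F z" if "norm z = 1" "A y = A z" for y z
    using that normA[of y] normA[of z] A1[of z] A1[of y] by simp
  define P where "P t u = x t + e *\<^sub>R u" for t u
  have P: "dist (P t u) (x t) = e" "P t u \<noteq> 0" "dist (sgn (P t u)) (x t) < r" "P t u \<noteq> x t"
    if "t \<in> {0..1}" "u \<in> ?S" for t u
  proof -
    show d: "dist (P t u) (x t) = e" using that e by (simp add: P_def dist_norm)
    show "P t u \<noteq> 0" "dist (sgn (P t u)) (x t) < r"
      using sgn_close[of "x t" "P t u" e] x(2) that d e by auto
    show "P t u \<noteq> x t" using d e by auto
  qed
  have 01: "0 \<in> {0..1::real}" "1 \<in> {0..1::real}" by auto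
  \<comment> \<open>The germ at \<open>x t\<close>, read on the sphere of radius \<open>e\<close>. A
    zero would be a unit vector near \<open>x t\<close>, on the same fibre of \<open>F\<close> and
    with vanishing \<open>a\<close>; by \<open>iso\<close> only \<open>x t\<close> itself is
    one.\<close>
  define H where "H t u = (A (P t u) - A (x t), \<alpha> (P t u))" for t u
  have contP0: "continuous_on ?S (P 0)" unfolding P_def by (intro continuous_intros)
  have hom01: "homotopic_with_canon (\<lambda>x. True) ?S ?S' (\<lambda>u. sgn (H 0 u)) (\<lambda>u. sgn (H 1 u))"
  proof (rule homotopic_sgn_comp)
    have cx: "continuous_on ({0..1} \<times> ?S) (\<lambda>p. x (fst p))"
      by (rule continuous_on_comp_fst[OF x(1)])
    have cP: "continuous_on ({0..1} \<times> ?S) (\<lambda>p. P (fst p) (snd p))"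
      unfolding P_def by (intro continuous_intros cx)
    have xne: "x t \<noteq> 0" if "t \<in> {0..1}" for t using x(2)[OF that] by auto
    show "continuous_on ({0..1} \<times> ?S) (\<lambda>p. H (fst p) (snd p))"
      unfolding H_def
      by (intro continuous_intros continuous_on_compose2[OF contA cP] continuous_on_compose2[OF contA cx]
          continuous_on_compose2[OF cont\<alpha> cP]) (use P(2) xne in auto)
    show "H t u \<noteq> 0" if "t \<in> {0..1}" "u \<in> ?S" for t u
    proof
      assume "H t u = 0"
      then have *: "A (P t u) = A (x t)" "\<alpha> (P t u) = 0" by (auto simp: H_def zero_prod_def)
      then have "norm (P t u) = 1" "F (P t u) = F (x t)" using Aeq[OF x(2)[OF that(1)] *(1)] by simp_all
      moreover have "a (P t u) = 0" using * \<open>norm (P t u) = 1\<close> by (simp add: \<alpha>_def sgn1)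
      ultimately have "P t u = x t" using iso[of t "P t u"] that P(1)[OF that] e by simp
      then show False using P(4)[OF that] by simp
    qed
  qed
  \<comment> \<open>As \<open>T\<close> is linear, it carries the small sphere at \<open>x 0\<close>
    to the one at \<open>x 1\<close>, so \<open>H 1\<close> after \<open>T\<close> can be compared
    with \<open>H 0\<close> point by point.\<close>
  have P1T: "P 1 (T u) = T (P 0 u)" for u
    using T(1) by (simp add: P_def x1 linear_add linear_scale)
  have sgnT: "sgn (T y) = T (sgn y)" for y
    using T by (simp add: sgn_div_norm linear_scale)
  have AT: "A (T y) = - A y" for y
    by (cases "y = 0") (use T in \<open>auto simp: A_def sgnT FT n1 linear_0\<close>)
  have contT: "continuous_on S T" for S
    using T(1) linear_continuous_on linear_conv_bounded_linear by blast
  let ?R = "\<lambda>x :: (real^3) \<times> real. (- fst x, snd x)"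
  have sgnR: "sgn (?R v) = ?R (sgn v)" for v
    by (simp add: sgn_div_norm norm_prod_def)
  have x0: "norm (x 0) = 1" using x(2) by simp
  have contA0: "continuous_on ?S (\<lambda>u. A (P 0 u) - A (x 0))"
    by (intro continuous_intros continuous_on_compose2[OF contA contP0]) (use P(2)[OF 01(1)] in auto)
  have cont\<alpha>0: "continuous_on ?S (\<lambda>u. \<alpha> (P 0 u))"
    by (rule continuous_on_compose2[OF cont\<alpha> contP0]) (use P(2)[OF 01(1)] in auto)
  have cont\<alpha>T: "continuous_on ?S (\<lambda>u. \<alpha> (T (P 0 u)))"
    by (rule continuous_on_compose2[OF cont\<alpha> continuous_on_compose2[OF contT contP0]])
       (use P(2)[OF 01(1)] T(2) in \<open>auto, metis norm_eq_zero\<close>)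
  have inP0: "norm (P 0 u) = 1 \<and> F (P 0 u) = F (x 0) \<and> dist (P 0 u) (x 0) < r \<and> P 0 u \<noteq> x 0"
    if "u \<in> ?S" "A (P 0 u) = A (x 0)" for u
    using Aeq[OF x0 that(2)] P(1,4)[OF 01(1) that(1)] e by auto
  have comb_ne: "p = 0 \<Longrightarrow> (1 - t) * c + t * d \<noteq> 0 \<Longrightarrow> (1 - t) *\<^sub>R (p, c) + t *\<^sub>R (p, d) \<noteq> 0"
    "p \<noteq> 0 \<Longrightarrow> (1 - t) *\<^sub>R (p, c) + t *\<^sub>R (p, d) \<noteq> 0" for t c d :: real and p :: "real^3"
  proof -
    have "(1 - t) *\<^sub>R (p, c) + t *\<^sub>R (p, d) = (p, (1 - t) * c + t * d)"
      by (simp add: scaleR_left_diff_distrib)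
    then show "p = 0 \<Longrightarrow> (1 - t) * c + t * d \<noteq> 0 \<Longrightarrow> (1 - t) *\<^sub>R (p, c) + t *\<^sub>R (p, d) \<noteq> 0"
      "p \<noteq> 0 \<Longrightarrow> (1 - t) *\<^sub>R (p, c) + t *\<^sub>R (p, d) \<noteq> 0"
      by (auto simp: zero_prod_def)
  qed
  \<comment> \<open>The first components agree. Where they vanish, the point lies on the fibre of
    \<open>F\<close> through \<open>x 0\<close>: there \<open>aT\<close> makes the second components
    equal, and \<open>iso\<close> makes them nonzero.\<close>
  have homT: "homotopic_with_canon (\<lambda>x. True) ?S ?S' (\<lambda>u. sgn (- (A (P 0 u) - A (x 0)), \<alpha> (T (P 0 u))))
      (\<lambda>u. sgn (- (A (P 0 u) - A (x 0)), \<alpha> (P 0 u)))"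
  proof (rule homotopic_sgn_linear)
    show "continuous_on ?S (\<lambda>u. (- (A (P 0 u) - A (x 0)), \<alpha> (T (P 0 u))))"
      "continuous_on ?S (\<lambda>u. (- (A (P 0 u) - A (x 0)), \<alpha> (P 0 u)))"
      by (intro continuous_on_Pair continuous_on_minus contA0 cont\<alpha>T cont\<alpha>0)+
    fix t :: real and u assume tu: "t \<in> {0..1}" "u \<in> ?S"
    show "(1 - t) *\<^sub>R (- (A (P 0 u) - A (x 0)), \<alpha> (T (P 0 u))) + t *\<^sub>R (- (A (P 0 u) - A (x 0)), \<alpha> (P 0 u)) \<noteq> 0"
    proof (cases "A (P 0 u) = A (x 0)")
      case True
      note in0 = inP0[OF tu(2) True]
      have "a (P 0 u) \<noteq> 0" using iso[OF 01(1)] in0 by blast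
      moreover have "a (T (P 0 u)) = a (P 0 u)" using aT in0 by blast
      moreover have "norm (T (P 0 u)) = 1" using T in0 by simp
      ultimately have "(1 - t) * \<alpha> (T (P 0 u)) + t * \<alpha> (P 0 u) \<noteq> 0"
        using in0 by (simp add: \<alpha>_def sgn1 left_diff_distrib)
      then show ?thesis using True by (intro comb_ne(1)) auto
    next
      case False
      then show ?thesis by (intro comb_ne(2)) auto
    qed
  qed
  \<comment> \<open>\<open>H 1\<close> is homotopic to \<open>H 0\<close> along the path, and also
    to \<open>H 1\<close> after \<open>T\<close>, because \<open>T\<close> is homotopic to the
    identity. Up to \<open>homT\<close>, the latter composite is \<open>?R\<close> after
    \<open>H 0\<close>.\<close>
  have R0: "homotopic_with_canon (\<lambda>x. True) ?S ?S' (?R \<circ> (\<lambda>u. sgn (H 0 u))) (\<lambda>u. sgn (H 0 u))"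
  proof -
    have c1: "continuous_on ?S (\<lambda>u. sgn (H 1 u))" "(\<lambda>u. sgn (H 1 u)) \<in> ?S \<rightarrow> ?S'"
      using homotopic_with_imp_continuous_maps[OF hom01] by auto
    have "homotopic_with_canon (\<lambda>x. True) ?S ?S' ((\<lambda>u. sgn (H 1 u)) \<circ> T) ((\<lambda>u. sgn (H 1 u)) \<circ> id)"
      by (rule homotopic_with_compose_continuous_left[OF _ c1]) (use T(3) in simp)
    moreover have "(\<lambda>u. sgn (H 1 u)) \<circ> T = (\<lambda>u. sgn (- (A (P 0 u) - A (x 0)), \<alpha> (T (P 0 u))))"
      by (auto simp: H_def P1T x1 AT fun_eq_iff)
    ultimately have "homotopic_with_canon (\<lambda>x. True) ?S ?S'
       (\<lambda>u. sgn (- (A (P 0 u) - A (x 0)), \<alpha> (T (P 0 u)))) (\<lambda>u. sgn (H 1 u))" by simp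
    then have "homotopic_with_canon (\<lambda>x. True) ?S ?S'
       (\<lambda>u. sgn (- (A (P 0 u) - A (x 0)), \<alpha> (P 0 u))) (\<lambda>u. sgn (H 0 u))"
      using homT hom01 homotopic_with_trans homotopic_with_symD by blast
    moreover have "?R \<circ> (\<lambda>u. sgn (H 0 u)) = (\<lambda>u. sgn (- (A (P 0 u) - A (x 0)), \<alpha> (P 0 u)))"
      unfolding comp_def sgnR[symmetric] by (simp add: H_def)
    ultimately show ?thesis by simp
  qed
  \<comment> \<open>With \<open>b\<close> in place of \<open>a\<close> the germ is injective on a
    full neighbourhood, which is what invariance of domain needs; \<open>a\<close> is controlled
    only on the fibres over the path.\<close>
  define G where "G y = (A y - A (x 0), \<beta> y)" for y
  have cb: "y \<noteq> 0" "sgn y \<in> sphere 0 1 \<inter> ball (x 0) r" if "y \<in> cball (x 0) e" for y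
  proof -
    show "y \<noteq> 0" using sgn_close(1)[OF x0 _ e(2), of y] that by (simp add: dist_commute)
    then show "sgn y \<in> sphere 0 1 \<inter> ball (x 0) r"
      using sgn_close(2)[OF x0 _ e(2), of y] that e n1[of y] by (simp add: dist_commute)
  qed
  have contG: "continuous_on (cball (x 0) e) G"
  proof -
    have "continuous_on (cball (x 0) e) A"
      by (rule continuous_on_subset[OF contA]) (use cb(1) in blast)
    moreover have "continuous_on (cball (x 0) e) \<beta>"
      unfolding \<beta>_def
      by (rule continuous_on_compose2[OF b(1) continuous_on_subset[OF csgn]]) (use cb in blast)+
    ultimately show ?thesis unfolding G_def by (intro continuous_intros)
  qed
  have injG: "inj_on G (cball (x 0) e)"
  proof
    fix y z assume y: "y \<in> cball (x 0) e" and z: "z \<in> cball (x 0) e" and "G y = G z"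
    then have eq: "A y = A z" "b (sgn y) = b (sgn z)" by (auto simp: G_def \<beta>_def)
    then have nn: "norm y = norm z" using normA by metis
    then have "F (sgn y) = F (sgn z)" using eq(1) cb(1)[OF y] cb(1)[OF z] by (simp add: A_def)
    then have "sgn y = sgn z" using b(3) eq(2) cb(2)[OF y] cb(2)[OF z] by (auto dest: inj_onD)
    then show "y = z" using nn cb(1)[OF y] by (auto simp: sgn_div_norm)
  qed
  have G0: "G (x 0) = 0" using b(2) by (simp add: G_def \<beta>_def sgn1 x0 zero_prod_def)
  obtain g where g: "continuous_on ?S' g" "g \<in> ?S' \<rightarrow> ?S"
    "homotopic_with_canon (\<lambda>x. True) ?S' ?S' ((\<lambda>u. sgn (G (x 0 + e *\<^sub>R u))) \<circ> g) id"
    by (rule germ_direction_right_inverse[OF _ e(1) contG injG G0]) auto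
  \<comment> \<open>Where the common first component vanishes, the second components have the same
    sign by the assumption on \<open>a y * b y\<close>, so no convex combination is zero.\<close>
  have hG: "homotopic_with_canon (\<lambda>x. True) ?S ?S' (\<lambda>u. sgn (H 0 u)) (\<lambda>u. sgn (G (x 0 + e *\<^sub>R u)))"
  proof (rule homotopic_sgn_linear)
    show "continuous_on ?S (H 0)" unfolding H_def by (intro continuous_on_Pair contA0 cont\<alpha>0)
    show "continuous_on ?S (\<lambda>u. G (x 0 + e *\<^sub>R u))"
      by (rule continuous_on_compose2[OF contG], intro continuous_intros)
         (use e in \<open>simp add: dist_norm image_subset_iff\<close>)
    fix t :: real and u assume tu: "t \<in> {0..1}" "u \<in> ?S"
    have eq: "H 0 u = (A (P 0 u) - A (x 0), \<alpha> (P 0 u))" "G (x 0 + e *\<^sub>R u) = (A (P 0 u) - A (x 0), \<beta> (P 0 u))"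
      by (auto simp: H_def G_def P_def)
    show "(1 - t) *\<^sub>R H 0 u + t *\<^sub>R G (x 0 + e *\<^sub>R u) \<noteq> 0"
      unfolding eq
    proof (cases "A (P 0 u) = A (x 0)")
      case True
      note in0 = inP0[OF tu(2) True]
      have ab: "\<alpha> (P 0 u) * \<beta> (P 0 u) > 0" using sgn in0 by (simp add: \<alpha>_def \<beta>_def sgn1)
      have "(1 - t) * \<alpha> (P 0 u) + t * \<beta> (P 0 u) \<noteq> 0"
      proof
        assume z: "(1 - t) * \<alpha> (P 0 u) + t * \<beta> (P 0 u) = 0"
        then have "((1 - t) * \<alpha> (P 0 u) + t * \<beta> (P 0 u)) * \<beta> (P 0 u) = 0" by simp
        then have "(1 - t) * (\<alpha> (P 0 u) * \<beta> (P 0 u)) + t * (\<beta> (P 0 u))\<^sup>2 = 0"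
          by (simp add: algebra_simps power2_eq_square)
        moreover have "(1 - t) * (\<alpha> (P 0 u) * \<beta> (P 0 u)) \<ge> 0" "t * (\<beta> (P 0 u))\<^sup>2 \<ge> 0"
          using ab tu by auto
        ultimately have "(1 - t) * (\<alpha> (P 0 u) * \<beta> (P 0 u)) = 0" "t * (\<beta> (P 0 u))\<^sup>2 = 0" by linarith+
        then show False using ab by auto
      qed
      then show "(1 - t) *\<^sub>R (A (P 0 u) - A (x 0), \<alpha> (P 0 u)) + t *\<^sub>R (A (P 0 u) - A (x 0), \<beta> (P 0 u)) \<noteq> 0"
        using True by (intro comb_ne(1)) auto
    next
      case False
      then show "(1 - t) *\<^sub>R (A (P 0 u) - A (x 0), \<alpha> (P 0 u)) + t *\<^sub>R (A (P 0 u) - A (x 0), \<beta> (P 0 u)) \<noteq> 0"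
        by (intro comb_ne(2)) auto
    qed
  qed
  define K where "K u = sgn (G (x 0 + e *\<^sub>R u))" for u
  have contR: "continuous_on ?S' ?R" "?R \<in> ?S' \<rightarrow> ?S'"
    by (intro continuous_intros) (auto simp: norm_prod_def)
  have hK: "homotopic_with_canon (\<lambda>x. True) ?S ?S' (\<lambda>u. sgn (H 0 u)) K"
    using hG by (simp add: K_def[abs_def])
  have "homotopic_with_canon (\<lambda>x. True) ?S ?S' (?R \<circ> (\<lambda>u. sgn (H 0 u))) (?R \<circ> K)"
    by (rule homotopic_with_compose_continuous_left[OF _ contR]) (use hK in simp)
  then have RK: "homotopic_with_canon (\<lambda>x. True) ?S ?S' (?R \<circ> K) K"
    using R0 hK homotopic_with_trans homotopic_with_symD by blast
  \<comment> \<open>\<open>K\<close> after \<open>g\<close> is homotopic to the identity, so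
    precomposition with \<open>g\<close> turns the invariance of \<open>K\<close> under
    \<open>?R\<close> into a homotopy from \<open>?R\<close> to the identity.\<close>
  have "homotopic_with_canon (\<lambda>x. True) ?S' ?S' ((?R \<circ> K) \<circ> g) (K \<circ> g)"
    by (rule homotopic_with_compose_continuous_right[OF _ g(1,2)]) (use RK in simp)
  moreover have Kg: "homotopic_with_canon (\<lambda>x. True) ?S' ?S' (K \<circ> g) id"
    using g(3) by (simp add: K_def[abs_def])
  moreover have "homotopic_with_canon (\<lambda>x. True) ?S' ?S' (?R \<circ> (K \<circ> g)) (?R \<circ> id)"
    by (rule homotopic_with_compose_continuous_left[OF _ contR]) (use Kg in simp)
  ultimately have "homotopic_with_canon (\<lambda>x. True) ?S' ?S' ?R id"
    unfolding comp_assoc comp_id using homotopic_with_trans homotopic_with_symD by blast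
  then show False using partial_antipodal_not_homotopic_id by simp
qed

subsection \<open>Orientation-reversing loops in the projective plane\<close>

lemma homology_group_sphere_real3:
  "homology_group 2 (top_of_set (sphere 0 1 :: (real^3) set)) \<cong> integer_group"
proof -
  obtain f :: "(nat \<Rightarrow> real) \<Rightarrow> real^3" and g
    where "homeomorphic_maps (nsphere(3 - 1)) (top_of_set (sphere 0 1 \<inter> span Basis)) f g"
    by (rule homeomorphic_maps_nsphere_euclidean_sphere[of "Basis :: (real^3) set" 3])
       (auto simp: independent_Basis pairwise_def orthogonal_def inner_Basis)
  then have "nsphere 2 homeomorphic_space top_of_set (sphere 0 1 :: (real^3) set)"
    by (auto simp: homeomorphic_space_def)
  then have "reduced_homology_group 2 (top_of_set (sphere 0 1 :: (real^3) set)) \<cong> integer_group"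
    using homeomorphic_space_imp_isomorphic_reduced_homology_groups reduced_homology_group_nsphere(1)[of 2]
    by (metis group.iso_sym group_reduced_homology_group iso_trans of_nat_numeral)
  then show ?thesis by (simp add: un_reduced_homology_group)
qed

section \<open>Contractible subsets of spheres\<close>

lemma eq_norm_scaleR_if_sgn_eq:
  fixes w :: "'a::real_normed_vector"
  shows "sgn w = v \<Longrightarrow> w = norm w *\<^sub>R v"
  by (cases "w = 0") (auto simp: sgn_div_norm)

lemma contractible_sphere_subset:
  fixes A :: "'a::real_normed_vector set"
  assumes A: "A \<subseteq> sphere 0 1" "v \<notin> A" and v: "norm v = 1"
    and star: "\<And>u t. u \<in> A \<Longrightarrow> t \<in> {0..1} \<Longrightarrow> sgn ((1 - t) *\<^sub>R u - t *\<^sub>R v) \<in> A"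
  shows "contractible A"
proof -
  \<comment> \<open>\<open>sgn\<close> of the zero vector is 0, which does not lie on the sphere; so
    \<open>star\<close> already keeps these segments away from the origin.\<close>
  have nz: "(1 - t) *\<^sub>R u - t *\<^sub>R v \<noteq> 0" if "u \<in> A" "t \<in> {0..1}" for u t
    using star[OF that] A(1) by (metis norm_zero sgn_zero subsetD mem_sphere_0 zero_neq_one)
  have "continuous_on ({0..1} \<times> A) (\<lambda>p. (1 - fst p) *\<^sub>R snd p - fst p *\<^sub>R v)"
    by (intro continuous_intros)
  then have "continuous_on ({0..1} \<times> A) (\<lambda>p. sgn ((1 - fst p) *\<^sub>R snd p - fst p *\<^sub>R v))"
    by (rule continuous_on_sgn) (use nz in auto)
  then have "homotopic_with_canon (\<lambda>x. True) A A id (\<lambda>x. - v)"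
    by (rule homotopic_with_canonI[where h = "\<lambda>t u. sgn ((1 - t) *\<^sub>R u - t *\<^sub>R v)"])
       (use star A v in \<open>auto simp: sgn_div_norm\<close>)
  then show ?thesis unfolding contractible_def by blast
qed

text \<open>If the segment from \<open>u\<close> to \<open>- v\<close> met the ray of
  \<open>v\<close>, a positive multiple of \<open>u\<close> would be a multiple of \<open>v\<close>
  of the same length, hence \<open>u = v\<close>.\<close>

lemma contractible_punctured_sphere:
  fixes v :: "'a::real_inner"
  assumes v: "norm v = 1"
  shows "contractible (sphere 0 1 - {v})"
proof (rule contractible_sphere_subset[OF _ _ v])
  fix u t assume u: "u \<in> sphere 0 1 - {v}" and t: "t \<in> {0..1::real}"
  define w where "w = (1 - t) *\<^sub>R u - t *\<^sub>R v"
  have key: "u = v" if c: "c \<ge> 0" "w = c *\<^sub>R v" for c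
  proof -
    have e: "(1 - t) *\<^sub>R u = (c + t) *\<^sub>R v"
      using c unfolding w_def by (simp add: algebra_simps)
    then have "norm ((1 - t) *\<^sub>R u) = norm ((c + t) *\<^sub>R v)" by simp
    then have "1 - t = c + t" using t u c v by simp
    moreover have "1 - t \<noteq> 0" using \<open>1 - t = c + t\<close> c t by auto
    ultimately show ?thesis using e by (metis scaleR_left_imp_eq)
  qed
  have "w \<noteq> 0" using key[of 0] u by auto
  moreover have "sgn w \<noteq> v"
  proof
    assume "sgn w = v"
    then have "w = norm w *\<^sub>R v" by (rule eq_norm_scaleR_if_sgn_eq)
    then show False using key[of "norm w"] u by auto
  qed
  ultimately show "sgn ((1 - t) *\<^sub>R u - t *\<^sub>R v) \<in> sphere 0 1 - {v}"
    unfolding w_def[symmetric] by (simp add: norm_sgn)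
qed auto

text \<open>Moving towards \<open>- v\<close> does not increase a positive cosine of the angle to
  \<open>v\<close>, and does not make a nonpositive one positive. As \<open>m\<close> is
  nonnegative, the cap is preserved.\<close>

lemma contractible_spherical_cap:
  fixes v :: "'a::real_inner"
  assumes v: "norm v = 1" and m: "0 \<le> m" "m < 1"
  shows "contractible {u \<in> sphere 0 1. u \<bullet> v \<le> m}"
proof (rule contractible_sphere_subset[OF _ _ v])
  have vv: "v \<bullet> v = 1" using v by (simp add: norm_eq_1)
  show "v \<notin> {u \<in> sphere 0 1. u \<bullet> v \<le> m}" using vv m by simp
  fix u t assume u: "u \<in> {u \<in> sphere 0 1. u \<bullet> v \<le> m}" and t: "t \<in> {0..1::real}"
  define w where "w = (1 - t) *\<^sub>R u - t *\<^sub>R v"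
  define a where "a = u \<bullet> v"
  define p where "p = 1 - t"
  have pt: "p \<ge> 0" "t \<ge> 0" "p + t = 1" using t by (auto simp: p_def)
  have "\<bar>a\<bar> \<le> 1"
    using u Cauchy_Schwarz_ineq2[of u v] v by (simp add: a_def)
  then have a: "a \<le> m" "a < 1" "a \<ge> -1" "u \<bullet> u = 1"
    using u m v by (auto simp: a_def norm_eq_1)
  have wv: "w \<bullet> v = p * a - t"
    by (simp add: w_def a_def p_def inner_diff_left vv)
  have ww: "(norm w)\<^sup>2 = p\<^sup>2 - 2 * p * t * a + t\<^sup>2"
    unfolding power2_norm_eq_inner w_def
    using a(4) vv by (simp add: p_def a_def inner_diff_left inner_diff_right inner_commute power2_eq_square algebra_simps)
  have "w \<noteq> 0"
  proof
    assume "w = 0"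
    then have "p\<^sup>2 - 2 * p * t * a + t\<^sup>2 = 0" using ww by simp
    then have z: "(p - t)\<^sup>2 + 2 * (p * t) * (1 - a) = 0"
      by (simp add: power2_eq_square algebra_simps)
    have "p * t * (1 - a) \<ge> 0" using pt a by simp
    moreover have "(p - t)\<^sup>2 \<ge> 0" by simp
    ultimately have "(p - t)\<^sup>2 = 0" "p * t * (1 - a) = 0"
      using z by linarith+
    then show False using pt a by auto
  qed
  have "p * a - t \<le> m * norm w"
  proof (cases "p * a \<le> t")
    case True
    then show ?thesis using m by (meson diff_le_0_iff_le mult_nonneg_nonneg norm_ge_zero order_trans)
  next
    case False
    then have "p * a > 0" using pt by linarith
    then have "a > 0" using pt by (metis zero_less_mult_pos order.order_iff_strict mult_zero_left less_irrefl)
    have "1 - a\<^sup>2 \<ge> 0" using a \<open>a > 0\<close> by (simp add: abs_square_le_1)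
    moreover have "2 * (p * a) - t \<ge> 0" using False \<open>p * a > 0\<close> by linarith
    ultimately have "(1 - a\<^sup>2) * (t * (2 * (p * a) - t)) \<ge> 0"
      using pt by (intro mult_nonneg_nonneg)
    moreover have "a\<^sup>2 * (norm w)\<^sup>2 - (p * a - t)\<^sup>2 = (1 - a\<^sup>2) * (t * (2 * (p * a) - t))"
      unfolding ww by (simp add: power2_eq_square algebra_simps)
    ultimately have "(p * a - t)\<^sup>2 \<le> (a * norm w)\<^sup>2"
      unfolding power_mult_distrib by linarith
    then have "p * a - t \<le> a * norm w"
      by (rule power2_le_imp_le) (use \<open>a > 0\<close> in simp)
    also have "\<dots> \<le> m * norm w" using a by (simp add: mult_right_mono)
    finally show ?thesis .
  qed
  then have "sgn w \<bullet> v \<le> m"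
    using wv \<open>w \<noteq> 0\<close> by (simp add: sgn_div_norm field_simps)
  then show "sgn ((1 - t) *\<^sub>R u - t *\<^sub>R v) \<in> {u \<in> sphere 0 1. u \<bullet> v \<le> m}"
    unfolding w_def[symmetric] using \<open>w \<noteq> 0\<close> by (simp add: norm_sgn)
qed auto

text \<open>On the sphere, \<open>u \<mapsto> 2 (u \<bullet> v) u - v\<close> doubles the angle to \<open>v\<close>. It is even in \<open>u\<close>, and only \<open>\<plusminus> v\<close> are
  sent to \<open>v\<close>; so it carries local orientations of the projective plane at the class of \<open>v\<close> to
  local orientations of the sphere at \<open>v\<close>, where the classes for different \<open>v\<close> can be compared.\<close>

definition fold_map :: "real^3 \<Rightarrow> (real^3) set \<Rightarrow> real^3" where
  "fold_map v b = (let u = SOME u. u \<in> b in (2 * (u \<bullet> v)) *\<^sub>R u - v)"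

lemma fold_map_class: "fold_map v {u, - u} = (2 * (u \<bullet> v)) *\<^sub>R u - v"
proof -
  have "(SOME w. w \<in> {u, - u}) \<in> {u, - u}" by (rule someI[of _ u]) simp
  then show ?thesis by (auto simp: fold_map_def Let_def)
qed

lemma topspace_projective_plane: "topspace projective_plane = (\<lambda>u. {u, - u}) ` sphere 0 1"
  by (simp add: projective_plane_def topspace_quotient_topology)

lemma norm_fold_map:
  assumes "norm v = 1" "b \<in> topspace projective_plane"
  shows "norm (fold_map v b) = 1"
proof -
  obtain u where u: "norm u = 1" "b = {u, - u}"
    using assms(2) by (auto simp: topspace_projective_plane)
  have "(norm (fold_map v b))\<^sup>2 = 1"
    unfolding u(2) fold_map_class power2_norm_eq_inner
    using u(1) assms(1)
    by (simp add: inner_diff_left inner_diff_right inner_commute norm_eq_1 power2_eq_square algebra_simps)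
  then show ?thesis by (simp add: norm_eq_sqrt_inner)
qed

text \<open>The fold is \<open>2 M v - v\<close> with \<open>M\<close> the Veronese matrix of the
  class, which is continuous in the class and the vector jointly. Joint continuity allows the base
  vector to move in a homotopy.\<close>

lemma continuous_map_fold_map:
  assumes c: "continuous_map X euclidean c" and \<beta>: "continuous_map X projective_plane \<beta>"
  shows "continuous_map X euclidean (\<lambda>x. fold_map (c x) (\<beta> x))"
proof -
  obtain \<kappa> where \<kappa>: "homeomorphic_map projective_plane (top_of_set (veronese ` sphere 0 1)) \<kappa>"
    "\<And>u. norm u = 1 \<Longrightarrow> \<kappa> {u, - u} = veronese u"
    using projective_plane_embedding by blast
  have eq: "fold_map v b = 2 *\<^sub>R (\<kappa> b *v v) - v" if "b \<in> topspace projective_plane" for v b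
    using that by (auto simp: topspace_projective_plane fold_map_class \<kappa>(2) veronese_mult)
  have "continuous_map projective_plane euclidean \<kappa>"
    using \<kappa>(1) by (metis continuous_map_in_subtopology homeomorphic_imp_continuous_map)
  then have "continuous_map X euclidean (\<kappa> \<circ> \<beta>)" by (rule continuous_map_compose[OF \<beta>])
  then have "continuous_map X (prod_topology euclidean euclidean) (\<lambda>x. (\<kappa> (\<beta> x), c x))"
    using c by (intro continuous_map_pairedI) (auto simp: o_def)
  moreover have "continuous_map (prod_topology euclidean euclidean) euclidean
     (\<lambda>p::(real^3^3) \<times> (real^3). 2 *\<^sub>R (fst p *v snd p) - snd p)"
    by (simp add: matrix_vector_mult_def) (intro continuous_intros)
  ultimately have "continuous_map X euclidean ((\<lambda>p. 2 *\<^sub>R (fst p *v snd p) - snd p) \<circ> (\<lambda>x. (\<kappa> (\<beta> x), c x)))"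
    by (rule continuous_map_compose)
  then show ?thesis
  proof (rule continuous_map_eq)
    fix x assume "x \<in> topspace X"
    then have "\<beta> x \<in> topspace projective_plane"
      using continuous_map_image_subset_topspace[OF \<beta>] by blast
    then show "((\<lambda>p. 2 *\<^sub>R (fst p *v snd p) - snd p) \<circ> (\<lambda>x. (\<kappa> (\<beta> x), c x))) x = fold_map (c x) (\<beta> x)"
      by (simp add: eq)
  qed
qed

text \<open>The punctured sphere is contractible, so the local homology at each point is the
  homology of the whole sphere. In this common group local orientations at different points become
  comparable.\<close>

lemma relative_homology_group_punctured_sphere:
  fixes v :: "real^3"
  assumes "norm v = 1"
  shows "hom_induced 2 (top_of_set (sphere 0 1)) {} (top_of_set (sphere 0 1)) (sphere 0 1 - {v}) id
      \<in> iso (homology_group 2 (top_of_set (sphere 0 1)))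
            (relative_homology_group 2 (top_of_set (sphere 0 1)) (sphere 0 1 - {v}))"
    "relative_homology_group 2 (top_of_set (sphere 0 1)) (sphere 0 1 - {v}) \<cong> integer_group"
proof -
  have "contractible_space (subtopology (top_of_set (sphere 0 1)) (sphere 0 1 - {v}))"
    using contractible_punctured_sphere[OF assms] by (simp add: subtopology_subtopology Int_absorb1)
  moreover have "topspace (top_of_set (sphere 0 1)) \<inter> (sphere 0 1 - {v}) \<noteq> {}"
  proof -
    have "v \<noteq> 0" using assms by auto
    then have "- v \<noteq> v" using neq_uminus_self by metis
    then have "- v \<in> topspace (top_of_set (sphere 0 1)) \<inter> (sphere 0 1 - {v})" using assms by simp
    then show ?thesis by blast
  qed
  ultimately show iso: "hom_induced 2 (top_of_set (sphere 0 1)) {} (top_of_set (sphere 0 1)) (sphere 0 1 - {v}) id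
      \<in> iso (homology_group 2 (top_of_set (sphere 0 1)))
            (relative_homology_group 2 (top_of_set (sphere 0 1)) (sphere 0 1 - {v}))"
    using iso_reduced_homology_by_contractible[of "top_of_set (sphere 0 1)" "sphere 0 1 - {v}" 2]
    by (simp add: un_reduced_homology_group)
  then show "relative_homology_group 2 (top_of_set (sphere 0 1)) (sphere 0 1 - {v}) \<cong> integer_group"
    using homology_group_sphere_real3 by (meson group.iso_sym group_relative_homology_group is_isoI iso_trans)
qed

lemma fold_map_eq_iff:
  assumes "norm v = 1" "b \<in> topspace projective_plane"
  shows "fold_map v b = v \<longleftrightarrow> b = {v, - v}"
proof -
  obtain u where u: "norm u = 1" "b = {u, - u}"
    using assms(2) by (auto simp: topspace_projective_plane)
  have vv: "v \<bullet> v = 1" "u \<bullet> u = 1" using assms u by (simp_all add: norm_eq_1)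
  have "u = v \<or> u = - v" if "fold_map v b = v"
  proof -
    have "2 *\<^sub>R ((u \<bullet> v) *\<^sub>R u) = 2 *\<^sub>R v"
      using that unfolding u(2) fold_map_class by (simp add: algebra_simps scaleR_2)
    then have e: "(u \<bullet> v) *\<^sub>R u = v" by (rule scaleR_left_imp_eq[rotated]) simp
    then have "\<bar>u \<bullet> v\<bar> = 1" using u(1) assms(1) by (metis norm_scaleR mult.right_neutral)
    then have "u \<bullet> v = 1 \<or> u \<bullet> v = -1" by linarith
    then show ?thesis using e by (metis scaleR_one scaleR_minus1_left minus_minus)
  qed
  moreover have "fold_map v {v, - v} = v"
    unfolding fold_map_class using vv by (simp add: algebra_simps flip: scaleR_2)
  ultimately show ?thesis using u by auto
qed

lemma continuous_map_fold_map_sphere: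
  assumes "norm v = 1"
  shows "continuous_map projective_plane (top_of_set (sphere 0 1)) (fold_map v)"
  using continuous_map_fold_map[of projective_plane "\<lambda>_. v" "\<lambda>b. b"] norm_fold_map[OF assms]
  by (auto simp: continuous_map_in_subtopology)

lemma iso_unique_preimage:
  assumes "h \<in> iso G H" "y \<in> carrier H"
  shows "\<exists>!x. x \<in> carrier G \<and> h x = y"
proof -
  have inj: "inj_on h (carrier G)" and im: "h ` carrier G = carrier H"
    using assms(1) by (simp_all add: iso_iff)
  have "y \<in> h ` carrier G" using assms(2) by (simp only: im)
  then obtain x where x: "x \<in> carrier G" "y = h x" by (rule imageE)
  show ?thesis
    by (rule ex1I[of _ x]) (use x inj in \<open>auto dest: inj_onD\<close>)
qed

text \<open>On the open hemisphere \<open>E\<close> about \<open>v\<close>, projection to the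
  projective plane followed by the fold is homotopic to the inclusion through maps that send no
  other point to \<open>v\<close>. The inclusion is an isomorphism on local homology by excision, so
  every local class of the sphere at \<open>v\<close> comes from the projective plane.\<close>

lemma fold_map_induced_nontrivial:
  fixes v :: "real^3"
  assumes v: "norm v = 1"
  obtains y where
    "y \<in> carrier (relative_homology_group 2 projective_plane (topspace projective_plane - {{v, - v}}))"
    "hom_induced 2 projective_plane (topspace projective_plane - {{v, - v}})
        (top_of_set (sphere 0 1)) (sphere 0 1 - {v}) (fold_map v) y
     \<noteq> \<one>\<^bsub>relative_homology_group 2 (top_of_set (sphere 0 1)) (sphere 0 1 - {v})\<^esub>"
proof -
  let ?S = "top_of_set (sphere 0 1 :: (real^3) set)"
  let ?P = "topspace projective_plane - {{v, - v}}"
  let ?N = "sphere 0 1 - {v}"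
  let ?G = "relative_homology_group 2 ?S ?N"
  define C where "C = {u \<in> sphere 0 1. u \<bullet> v \<le> 0}"
  define E where "E = {u \<in> sphere 0 1. u \<bullet> v > 0}"
  have ES: "E \<subseteq> sphere 0 1" by (auto simp: E_def)
  have vv: "v \<bullet> v = 1" using v by (simp add: norm_eq_1)
  have EC: "sphere 0 1 - C = E" "?N - C = E - {v}" by (auto simp: C_def E_def)
  have C: "closedin ?S C"
  proof -
    have "closed {u. u \<bullet> v \<le> 0}" by (simp add: closed_halfspace_le inner_commute[of _ v])
    moreover have "C = sphere 0 1 \<inter> {u. u \<bullet> v \<le> 0}" by (auto simp: C_def)
    ultimately show ?thesis by (simp add: closedin_closed_Int)
  qed
  moreover have "openin ?S ?N"
    by (simp add: openin_delete)
  ultimately have "(Abstract_Topology.closure_of ?S C) \<subseteq> ?S interior_of ?N"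
    using vv by (auto simp: closure_of_closedin interior_of_openin C_def)
  from homology_excision_axiom[OF this, of "sphere 0 1" 2]
  have iso: "hom_induced 2 (top_of_set E) (E - {v}) ?S ?N id \<in> iso (relative_homology_group 2 (top_of_set E) (E - {v})) ?G"
    by (simp add: EC subtopology_subtopology Int_absorb1[OF ES] del: mem_sphere_0)
  define c where "c u = {u, - u}" for u :: "real^3"
  have qc: "continuous_map ?S projective_plane c"
    using quotient_imp_continuous_map[OF quotient_map_quotient_topology]
    by (simp add: projective_plane_def c_def[abs_def])
  have cE: "continuous_map (top_of_set E) projective_plane c"
    using continuous_map_from_subtopology[OF qc, of E] ES by (simp add: subtopology_subtopology Int_absorb1)
  have cP: "c \<in> E - {v} \<rightarrow> ?P"
    using vv by (auto simp: c_def E_def topspace_projective_plane antipodal_class_eq_iff doubleton_eq_iff)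
  have fN: "fold_map v \<in> ?P \<rightarrow> ?N"
    using v by (auto simp: norm_fold_map fold_map_eq_iff)
  \<comment> \<open>The straight line from \<open>u\<close> to its fold. It is a positive multiple
    of \<open>u\<close> minus a multiple of \<open>v\<close>, and so it meets the ray of
    \<open>v\<close> or the origin only if \<open>u = v\<close>; and at \<open>u = v\<close> it is
    constantly \<open>v\<close>.\<close>
  define h where "h t u = (1 - t) *\<^sub>R u + t *\<^sub>R fold_map v (c u)" for t u
  have h_eq: "h t u = (1 - t + t * (2 * (u \<bullet> v))) *\<^sub>R u - t *\<^sub>R v" for t u
    unfolding h_def c_def fold_map_class by (simp add: algebra_simps)
  have coef: "1 - t + t * (2 * (u \<bullet> v)) > 0" if "t \<in> {0..1}" "u \<in> E" for t u
  proof (cases "t = 1")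
    case True then show ?thesis using that by (simp add: E_def)
  next
    case False
    moreover have "t * (2 * (u \<bullet> v)) \<ge> 0" using that by (simp add: E_def)
    ultimately show ?thesis using that by (simp add: add_pos_nonneg)
  qed
  have pos_mult: "u = v" if "k > 0" "l \<ge> 0" "k *\<^sub>R u = l *\<^sub>R v" "u \<in> E" for k l u
  proof -
    have "norm (k *\<^sub>R u) = k" "norm (l *\<^sub>R v) = l" using that(1,2,4) v by (auto simp: E_def)
    then have "k = l" using that(3) by simp
    then show ?thesis using that by simp
  qed
  have h_mult: "u = v" if "t \<in> {0..1}" "u \<in> E" "h t u = l *\<^sub>R v" "l \<ge> 0" for t u l
  proof (rule pos_mult[OF coef[OF that(1,2)] _ _ that(2)])
    show "0 \<le> l + t" using that by simp
    show "(1 - t + t * (2 * (u \<bullet> v))) *\<^sub>R u = (l + t) *\<^sub>R v"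
      using that(3) unfolding h_eq by (simp add: algebra_simps)
  qed
  have h_v: "h t v = v" for t
    unfolding h_eq using vv by (simp add: algebra_simps)
  have h_nz: "h t u \<noteq> 0" if "t \<in> {0..1}" "u \<in> E" for t u
    using h_mult[OF that, of 0] h_v[of t] v by auto
  have "homotopic_with (\<lambda>h. h \<in> (E - {v}) \<rightarrow> ?N) (top_of_set E) ?S id (fold_map v \<circ> c)"
  proof (subst homotopic_with)
    have "continuous_on ({0..1} \<times> E) (\<lambda>p. h (fst p) (snd p))"
      unfolding h_eq by (intro continuous_intros)
    then have "continuous_on ({0..1} \<times> E) (\<lambda>p. sgn (h (fst p) (snd p)))"
      by (rule continuous_on_sgn) (use h_nz in auto)
    then have "continuous_map (prod_topology (top_of_set {0..1::real}) (top_of_set E)) ?S (\<lambda>p. sgn (h (fst p) (snd p)))"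
      using h_nz by (auto simp: norm_sgn)
    moreover have "sgn (h 0 u) = u" "sgn (h 1 u) = fold_map v (c u)" if "u \<in> E" for u
    proof -
      show "sgn (h 0 u) = u" using that by (simp add: h_def sgn_div_norm E_def)
      have "c u \<in> topspace projective_plane" using that by (auto simp: c_def E_def topspace_projective_plane)
      then show "sgn (h 1 u) = fold_map v (c u)" using norm_fold_map[OF v] by (simp add: h_def sgn_div_norm)
    qed
    moreover have "(\<lambda>u. sgn (h t u)) \<in> (E - {v}) \<rightarrow> ?N" if t: "t \<in> {0..1}" for t
    proof
      fix u assume u: "u \<in> E - {v}"
      have "sgn (h t u) \<noteq> v"
      proof
        assume "sgn (h t u) = v"
        then have "h t u = norm (h t u) *\<^sub>R v" by (rule eq_norm_scaleR_if_sgn_eq)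
        then show False using h_mult[OF t] u by (metis DiffD1 DiffD2 norm_ge_zero singletonI)
      qed
      then show "sgn (h t u) \<in> ?N" using h_nz[OF t] u by (simp add: norm_sgn)
    qed
    ultimately show "\<exists>k. continuous_map (prod_topology (top_of_set {0..1::real}) (top_of_set E)) ?S k \<and>
        (\<forall>x\<in>topspace (top_of_set E). k (0::real, x) = id x) \<and>
        (\<forall>x\<in>topspace (top_of_set E). k (1, x) = (fold_map v \<circ> c) x) \<and>
        (\<forall>t\<in>{0..1}. (\<lambda>x. k (t, x)) \<in> E - {v} \<rightarrow> ?N)"
      by (intro exI[of _ "\<lambda>p. sgn (h (fst p) (snd p))"]) auto
  qed (auto simp: Pi_iff)
  then have eq: "hom_induced 2 (top_of_set E) (E - {v}) ?S ?N id
      = hom_induced 2 (top_of_set E) (E - {v}) ?S ?N (fold_map v \<circ> c)"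
    by (rule homology_homotopy_axiom)
  obtain z where z: "z \<in> carrier ?G" "z \<noteq> \<one>\<^bsub>?G\<^esub>"
  proof -
    have "\<not> trivial_group ?G"
      using relative_homology_group_punctured_sphere(2)[OF v]
      by (metis group_integer_group group_relative_homology_group isomorphic_group_triviality nontrivial_integer_group)
    then have "carrier ?G \<noteq> {\<one>\<^bsub>?G\<^esub>}" by (simp add: trivial_group_def)
    moreover have "\<one>\<^bsub>?G\<^esub> \<in> carrier ?G"
      using group_relative_homology_group group.is_monoid monoid.one_closed by blast
    ultimately show ?thesis using that by blast
  qed
  obtain y where y: "y \<in> carrier (relative_homology_group 2 (top_of_set E) (E - {v}))"
    "hom_induced 2 (top_of_set E) (E - {v}) ?S ?N id y = z"
    using iso_unique_preimage[OF iso z(1)] by blast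
  have yz: "hom_induced 2 projective_plane ?P ?S ?N (fold_map v)
     (hom_induced 2 (top_of_set E) (E - {v}) projective_plane ?P c y) = z"
    using hom_induced_compose'[OF cE cP continuous_map_fold_map_sphere[OF v] fN, of 2 y] eq y(2) by simp
  show ?thesis
  proof (rule that)
    show "hom_induced 2 (top_of_set E) (E - {v}) projective_plane ?P c y
        \<in> carrier (relative_homology_group 2 projective_plane ?P)"
      by (rule hom_induced_carrier)
  qed (use yz z in simp)
qed

text \<open>The integers have no element of order two.\<close>

lemma integer_group_inv_self:
  assumes "G \<cong> integer_group" "group G" "x \<in> carrier G" "inv\<^bsub>G\<^esub> x = x"
  shows "x = \<one>\<^bsub>G\<^esub>"
proof -
  obtain h where h: "h \<in> iso G integer_group" using assms(1) by (auto simp: is_iso_def)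
  interpret group_hom G integer_group h
    using h assms(2) by (simp add: group_hom_def group_hom_axioms_def iso_def)
  have "h (inv\<^bsub>G\<^esub> x) = - h x"
    using hom_inv[OF assms(3)] by simp
  then have "h x = h \<one>\<^bsub>G\<^esub>" using assms(4) by simp
  then show ?thesis using h assms(3) by (auto simp: iso_def bij_betw_def inj_on_def)
qed

text \<open>Suppose that the lift closes. The fold at \<open>g t\<close> sends the local orientation
  at \<open>\<gamma> t\<close> to the local homology of the sphere at \<open>g t\<close>, hence to a
  class \<open>e t\<close> of the whole sphere. These classes are locally constant, so the first and
  the last agree; reversal makes their images at \<open>g 0\<close> inverse to each other. The image
  is therefore trivial, although the fold sends not all local classes to the trivial one.\<close>

lemma orientation_reversing_loop_lift_not_closed:
  assumes rev: "orientation_reversing_loop 2 projective_plane \<gamma>"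
    and contg: "continuous_on {0..1} g" and g1: "\<And>t. t \<in> {0..1} \<Longrightarrow> norm (g t) = 1"
    and \<gamma>g: "\<And>t. t \<in> {0..1} \<Longrightarrow> \<gamma> t = {g t, - g t}"
  shows "g 1 \<noteq> g 0"
proof
  assume closed: "g 1 = g 0"
  let ?S = "top_of_set (sphere 0 1 :: (real^3) set)"
  let ?P = "projective_plane"
  define N where "N v = sphere 0 1 - {v}" for v :: "real^3"
  define Pc where "Pc t = topspace ?P - {\<gamma> t}" for t
  let ?H = "homology_group 2 ?S"
  obtain \<omega> where or: "orientation_along 2 ?P \<gamma> \<omega>" and \<gamma>01: "\<gamma> 0 = \<gamma> 1"
    and inv: "\<omega> 1 = inv\<^bsub>relative_homology_group 2 ?P (Pc 0)\<^esub> (\<omega> 0)"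
    using rev unfolding orientation_reversing_loop_def Pc_def by blast
  have gen: "generate (relative_homology_group 2 ?P (Pc t)) {\<omega> t}
        = carrier (relative_homology_group 2 ?P (Pc t))" if "t \<in> {0..1}" for t
    using or that unfolding orientation_along_def Pc_def by blast
  have loc: "\<exists>U c \<epsilon>. openin ?P U \<and> c \<in> carrier (relative_homology_group 2 ?P (topspace ?P - U)) \<and> \<epsilon> > 0 \<and>
        (\<forall>s \<in> {0..1}. \<bar>s - t\<bar> < \<epsilon> \<longrightarrow> \<gamma> s \<in> U \<and>
           \<omega> s = hom_induced 2 ?P (topspace ?P - U) ?P (Pc s) id c)" if "t \<in> {0..1}" for t
    using or that unfolding orientation_along_def Pc_def by (elim conjE) (rule bspec)
  have \<omega>: "\<omega> t \<in> carrier (relative_homology_group 2 ?P (Pc t))" if "t \<in> {0..1}" for t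
    using gen[OF that] generate.incl[of "\<omega> t" "{\<omega> t}"] by auto
  have gS: "g t \<in> sphere 0 1" if "t \<in> {0..1}" for t using g1[OF that] by simp
  have FN: "fold_map (g t) \<in> Pc t \<rightarrow> N (g t)" if "t \<in> {0..1}" for t
    using g1[OF that] \<gamma>g[OF that] unfolding Pc_def N_def by (auto simp: norm_fold_map fold_map_eq_iff)
  have Fc: "continuous_map ?P ?S (fold_map (g t))" if "t \<in> {0..1}" for t
    using continuous_map_fold_map_sphere g1[OF that] by blast
  define j where "j v = hom_induced 2 ?S {} ?S (N v) id" for v
  define D where "D t = hom_induced 2 ?P (Pc t) ?S (N (g t)) (fold_map (g t)) (\<omega> t)" for t
  have ex1: "\<exists>!e. e \<in> carrier ?H \<and> j (g t) e = D t" if "t \<in> {0..1}" for t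
    unfolding j_def D_def N_def
    by (rule iso_unique_preimage[OF relative_homology_group_punctured_sphere(1)[OF g1[OF that]] hom_induced_carrier])
  define e where "e t = (THE e. e \<in> carrier ?H \<and> j (g t) e = D t)" for t
  have e: "e t \<in> carrier ?H" "j (g t) (e t) = D t" if "t \<in> {0..1}" for t
    using theI'[OF ex1[OF that]] unfolding e_def by auto
  have e_uniq: "x = e t" if "t \<in> {0..1}" "x \<in> carrier ?H" "j (g t) x = D t" for t x
    using ex1[OF that(1)] e[OF that(1)] that by blast
  have const: "\<exists>\<delta>>0. \<forall>s\<in>{0..1}. \<bar>s - t\<bar> < \<delta> \<longrightarrow> e s = e t" if t: "t \<in> {0..1}" for t
  proof -
    obtain U c \<epsilon> where U: "openin ?P U" and c: "c \<in> carrier (relative_homology_group 2 ?P (topspace ?P - U))"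
      and \<epsilon>: "\<epsilon> > 0" and Us: "\<And>s. s \<in> {0..1} \<Longrightarrow> \<bar>s - t\<bar> < \<epsilon> \<Longrightarrow> \<gamma> s \<in> U"
      and \<omega>s: "\<And>s. s \<in> {0..1} \<Longrightarrow> \<bar>s - t\<bar> < \<epsilon> \<Longrightarrow> \<omega> s = hom_induced 2 ?P (topspace ?P - U) ?P (Pc s) id c"
      using loc[OF t] by blast
    let ?v = "g t"
    \<comment> \<open>The unit vectors over the complement of \<open>U\<close>. They form a compact
      set without \<open>g t\<close> and \<open>- g t\<close>, so the squared cosine of the angle to
      \<open>g t\<close> is bounded there by some \<open>m\<close> less than 1.\<close>
    define Q where "Q = {u \<in> sphere 0 1. {u, - u} \<notin> U}"
    have "compact Q"
    proof -
      have "openin ?S {u \<in> topspace ?S. {u, - u} \<in> U}"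
        using U by (simp add: projective_plane_def openin_quotient_topology)
      then have "closedin ?S (topspace ?S - {u \<in> topspace ?S. {u, - u} \<in> U})" by blast
      moreover have "topspace ?S - {u \<in> topspace ?S. {u, - u} \<in> U} = Q" by (auto simp: Q_def)
      ultimately have "closedin ?S Q" by simp
      then show ?thesis using closedin_compact compact_sphere by blast
    qed
    have lt1: "(u \<bullet> ?v)\<^sup>2 < 1" if "u \<in> Q" for u
    proof -
      have u: "norm u = 1" "{u, - u} \<notin> U" using that by (auto simp: Q_def)
      have "\<bar>u \<bullet> ?v\<bar> \<le> 1" using Cauchy_Schwarz_ineq2[of u ?v] u g1[OF t] by simp
      moreover have "\<bar>u \<bullet> ?v\<bar> \<noteq> 1"
      proof
        assume "\<bar>u \<bullet> ?v\<bar> = 1"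
        then have "u \<bullet> ?v = norm u * norm ?v \<or> u \<bullet> - ?v = norm u * norm (- ?v)" using u g1[OF t] by auto
        then have "norm u *\<^sub>R ?v = norm ?v *\<^sub>R u \<or> norm u *\<^sub>R - ?v = norm (- ?v) *\<^sub>R u"
          by (simp only: norm_cauchy_schwarz_eq)
        then have "u = ?v \<or> u = - ?v"
          by (simp only: u(1) g1[OF t] norm_minus_cancel scaleR_one) blast
        then have "{u, - u} = \<gamma> t"
          unfolding \<gamma>g[OF t] by (elim disjE) (simp_all add: insert_commute)
        then show False using u Us[OF t] \<epsilon> by simp
      qed
      ultimately show ?thesis by (simp add: abs_square_less_1)
    qed
    obtain m where m: "0 \<le> m" "m < 1" "\<And>u. u \<in> Q \<Longrightarrow> (u \<bullet> ?v)\<^sup>2 \<le> m"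
    proof (cases "Q = {}")
      case True
      then show ?thesis using that[of 0] by auto
    next
      case False
      have "continuous_on Q (\<lambda>u. (u \<bullet> ?v)\<^sup>2)" by (intro continuous_intros)
      then obtain w where w: "w \<in> Q" "\<And>u. u \<in> Q \<Longrightarrow> (u \<bullet> ?v)\<^sup>2 \<le> (w \<bullet> ?v)\<^sup>2"
        using continuous_attains_sup[OF \<open>compact Q\<close> False] by blast
      show ?thesis by (rule that[of "(w \<bullet> ?v)\<^sup>2"]) (use w lt1 in auto)
    qed
    define K where "K = {u \<in> sphere 0 1. u \<bullet> ?v \<le> m}"
    have KS: "K \<subseteq> sphere 0 1" by (auto simp: K_def)
    \<comment> \<open>The fold at \<open>g t\<close> of a class outside \<open>U\<close> has cosine
      at most \<open>2 * m - 1 = m - (1 - m)\<close> to \<open>g t\<close>. Folding at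
      \<open>g s\<close> instead changes this by at most three times \<open>(1 - m) / 4\<close>. So
      the fold stays in the cap of cosine at most \<open>m\<close>, while \<open>g s\<close> stays
      outside the cap.\<close>
    have "(1 - m) / 4 > 0" using m by simp
    then obtain d where d: "d > 0" "\<And>s. s \<in> {0..1} \<Longrightarrow> dist s t < d \<Longrightarrow> dist (g s) (g t) < (1 - m) / 4"
      using contg t unfolding continuous_on_iff by metis
    define \<delta> where "\<delta> = min d \<epsilon>"
    have near: "norm (g s - ?v) < (1 - m) / 4" if "s \<in> {0..1}" "\<bar>s - t\<bar> < \<delta>" for s
      using d(2)[OF that(1)] that(2) by (simp add: \<delta>_def dist_norm)
    have FK: "fold_map (g s) b \<in> K" if s: "s \<in> {0..1}" "\<bar>s - t\<bar> < \<delta>" and b: "b \<in> topspace ?P - U" for s b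
    proof -
      obtain u where u: "norm u = 1" "b = {u, - u}" "u \<in> Q"
        using b by (auto simp: topspace_projective_plane Q_def)
      have a1: "\<bar>u \<bullet> ?v\<bar> \<le> 1" using Cauchy_Schwarz_ineq2[of u ?v] u g1[OF t] by simp
      have a2: "\<bar>u \<bullet> (g s - ?v)\<bar> \<le> (1 - m) / 4"
        using Cauchy_Schwarz_ineq2[of u "g s - ?v"] u near[OF s] by simp
      have a3: "\<bar>?v \<bullet> (g s - ?v)\<bar> \<le> (1 - m) / 4"
        using Cauchy_Schwarz_ineq2[of ?v "g s - ?v"] g1[OF t] near[OF s] by simp
      have a4: "\<bar>(u \<bullet> (g s - ?v)) * (u \<bullet> ?v)\<bar> \<le> (1 - m) / 4"
        using mult_mono[OF a2 a1] m by (simp add: abs_mult)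
      have arith: "2 * Y - 1 + 2 * X - Z \<le> m"
        if "X \<le> (1 - m) / 4" "Y \<le> m" "- Z \<le> (1 - m) / 4" for X Y Z :: real
        using that m(2) by (simp add: field_simps)
      have "fold_map (g s) b \<bullet> ?v
          = 2 * (u \<bullet> ?v)\<^sup>2 - 1 + 2 * ((u \<bullet> (g s - ?v)) * (u \<bullet> ?v)) - ?v \<bullet> (g s - ?v)"
        unfolding u(2) fold_map_class using g1[OF t]
        by (simp add: norm_eq_1 inner_diff_left inner_diff_right inner_commute power2_eq_square algebra_simps)
      also have "\<dots> \<le> m"
        by (rule arith[OF abs_le_D1[OF a4] m(3)[OF u(3)] abs_le_D2[OF a3]])
      finally have "fold_map (g s) b \<bullet> ?v \<le> m" .
      then show ?thesis using norm_fold_map[OF g1[OF s(1)]] b by (simp add: K_def)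
    qed
    have KN: "K \<subseteq> N (g s)" if s: "s \<in> {0..1}" "\<bar>s - t\<bar> < \<delta>" for s
    proof -
      have a: "\<bar>?v \<bullet> (g s - ?v)\<bar> \<le> (1 - m) / 4"
        using Cauchy_Schwarz_ineq2[of ?v "g s - ?v"] g1[OF t] near[OF s] by simp
      have "m < 1 + X" if "- X \<le> (1 - m) / 4" for X
        using that m(2) by (simp add: field_simps)
      from this[OF abs_le_D2[OF a]] have "m < 1 + ?v \<bullet> (g s - ?v)" .
      also have "\<dots> = g s \<bullet> ?v"
        using g1[OF t] by (simp add: norm_eq_1 inner_diff_right inner_commute)
      finally have "m < g s \<bullet> ?v" .
      then show ?thesis by (auto simp: K_def N_def)
    qed
    have isoK: "hom_induced 2 ?S {} ?S K id \<in> iso ?H (relative_homology_group 2 ?S K)"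
    proof -
      have "contractible_space (subtopology ?S K)"
        using contractible_spherical_cap[OF g1[OF t] m(1,2), folded K_def]
        by (simp add: subtopology_subtopology Int_absorb1[OF KS])
      moreover have "- ?v \<in> topspace ?S \<inter> K" using g1[OF t] m by (simp add: K_def norm_eq_1)
      then have "topspace ?S \<inter> K \<noteq> {}" by blast
      ultimately show ?thesis
        using iso_reduced_homology_by_contractible[of ?S K 2] by (simp add: un_reduced_homology_group)
    qed
    have "e s = e t" if s: "s \<in> {0..1}" "\<bar>s - t\<bar> < \<delta>" for s
    proof -
      \<comment> \<open>The segment from \<open>s\<close> to \<open>t\<close> stays in the
        neighbourhood, so the folds along it form a homotopy of pairs into the sphere and the fixed
        cap \<open>K\<close>.\<close>
      define l where "l r = (1 - r) * s + r * t" for r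
      have l: "l r \<in> {0..1}" "\<bar>l r - t\<bar> < \<delta>" if "r \<in> {0..1}" for r
      proof -
        show "l r \<in> {0..1}"
          using convexD_alt[of "{0..1}" s t r] s t that by (simp add: l_def)
        have "\<bar>l r - t\<bar> = (1 - r) * \<bar>s - t\<bar>"
        proof -
          have "l r - t = (1 - r) * (s - t)" by (simp add: l_def algebra_simps)
          then show ?thesis using that by (simp add: abs_mult)
        qed
        also have "\<dots> \<le> \<bar>s - t\<bar>" using that by (simp add: mult_left_le_one_le)
        finally show "\<bar>l r - t\<bar> < \<delta>" using s by simp
      qed
      have "homotopic_with (\<lambda>h. h \<in> (topspace ?P - U) \<rightarrow> K) ?P ?S (fold_map (g s)) (fold_map (g t))"
      proof (subst homotopic_with)
        have "continuous_on {0..1} l" unfolding l_def by (intro continuous_intros)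
        then have "continuous_on {0..1} (\<lambda>r. g (l r))"
          by (rule continuous_on_compose2[OF contg]) (use l(1) in blast)
        then have "continuous_map (prod_topology (top_of_set {0..1::real}) ?P) euclidean ((\<lambda>r. g (l r)) \<circ> fst)"
          by (intro continuous_map_compose[OF continuous_map_fst]) simp
        note continuous_map_fold_map[OF this continuous_map_snd]
        then have "continuous_map (prod_topology (top_of_set {0..1::real}) ?P) euclidean (\<lambda>p. fold_map (g (l (fst p))) (snd p))"
          by (simp add: o_def)
        moreover have "fold_map (g (l (fst p))) (snd p) \<in> sphere 0 1"
          if "p \<in> topspace (prod_topology (top_of_set {0..1::real}) ?P)" for p
          using norm_fold_map[OF g1[OF l(1)]] that by auto
        ultimately have "continuous_map (prod_topology (top_of_set {0..1::real}) ?P) ?S (\<lambda>p. fold_map (g (l (fst p))) (snd p))"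
          unfolding continuous_map_in_subtopology by blast
        then show "\<exists>h. continuous_map (prod_topology (top_of_set {0..1::real}) ?P) ?S h \<and>
          (\<forall>x\<in>topspace ?P. h (0, x) = fold_map (g s) x) \<and>
          (\<forall>x\<in>topspace ?P. h (1, x) = fold_map (g t) x) \<and>
          (\<forall>t\<in>{0..1}. (\<lambda>x. h (t, x)) \<in> topspace ?P - U \<rightarrow> K)"
          using FK l by (intro exI[of _ "\<lambda>p. fold_map (g (l (fst p))) (snd p)"]) (auto simp: l_def)
      qed (auto simp: Pi_iff)
      then have eqK: "hom_induced 2 ?P (topspace ?P - U) ?S K (fold_map (g s))
          = hom_induced 2 ?P (topspace ?P - U) ?S K (fold_map (g t))"
        by (rule homology_homotopy_axiom)
      define y where "y = hom_induced 2 ?P (topspace ?P - U) ?S K (fold_map (g t)) c"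
      \<comment> \<open>As \<open>K\<close> is contractible, the folded class comes from a class
        \<open>x\<close> of the whole sphere. This one class restricts to the folded orientations at
        \<open>s\<close> and at \<open>t\<close>, which gives \<open>e s = e t\<close>.\<close>
      obtain x where x: "x \<in> carrier ?H" "hom_induced 2 ?S {} ?S K id x = y"
        using iso_unique_preimage[OF isoK, of y] hom_induced_carrier unfolding y_def by blast
      have jx: "j (g r) x = D r" if r: "r \<in> {0..1}" "\<bar>r - t\<bar> < \<delta>"
        and yr: "y = hom_induced 2 ?P (topspace ?P - U) ?S K (fold_map (g r)) c" for r
      proof -
        have Ur: "topspace ?P - U \<subseteq> Pc r" using Us[OF r(1)] r(2) by (auto simp: Pc_def \<delta>_def)
        have "j (g r) x = hom_induced 2 ?S K ?S (N (g r)) id (hom_induced 2 ?S {} ?S K id x)"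
          unfolding j_def using KN[OF r] by (subst hom_induced_compose') auto
        also have "\<dots> = hom_induced 2 ?S K ?S (N (g r)) id (hom_induced 2 ?P (topspace ?P - U) ?S K (fold_map (g r)) c)"
          using x yr by simp
        also have "\<dots> = hom_induced 2 ?P (topspace ?P - U) ?S (N (g r)) (id \<circ> fold_map (g r)) c"
          using KN[OF r] FK[OF r] Fc[OF r(1)] by (intro hom_induced_compose') auto
        also have "\<dots> = hom_induced 2 ?P (Pc r) ?S (N (g r)) (fold_map (g r))
             (hom_induced 2 ?P (topspace ?P - U) ?P (Pc r) id c)"
          using Ur FN[OF r(1)] Fc[OF r(1)] by (subst hom_induced_compose') auto
        also have "\<dots> = D r" using \<omega>s[OF r(1)] r(2) by (simp add: D_def \<delta>_def)
        finally show ?thesis .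
      qed
      have "x = e s" by (rule e_uniq[OF s(1) x(1) jx[OF s]]) (use eqK y_def in simp)
      moreover have "x = e t"
        by (rule e_uniq[OF t x(1) jx[OF t]]) (use y_def d \<epsilon> in \<open>auto simp: \<delta>_def\<close>)
      ultimately show ?thesis by simp
    qed
    moreover have "\<delta> > 0" using d \<epsilon> by (simp add: \<delta>_def)
    ultimately show ?thesis by blast
  qed
  have "e constant_on {0..1}"
  proof (rule locally_constant_imp_constant)
    fix t :: real assume t: "t \<in> {0..1}"
    obtain \<delta> where \<delta>: "\<delta> > 0" "\<forall>s\<in>{0..1}. \<bar>s - t\<bar> < \<delta> \<longrightarrow> e s = e t" using const[OF t] by blast
    show "\<exists>T. openin (top_of_set {0..1}) T \<and> t \<in> T \<and> (\<forall>x\<in>T. e x = e t)"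
    proof (intro exI[of _ "{0..1} \<inter> ball t \<delta>"] conjI ballI)
      show "openin (top_of_set {0..1}) ({0..1} \<inter> ball t \<delta>)" by (simp add: openin_open_Int)
      show "t \<in> {0..1} \<inter> ball t \<delta>" using t \<delta>(1) by simp
      fix s assume "s \<in> {0..1} \<inter> ball t \<delta>"
      then have "s \<in> {0..1}" "dist s t < \<delta>" by (simp_all add: dist_commute)
      then show "e s = e t" using \<delta>(2) by (metis dist_real_def)
    qed
  qed simp
  then have "e 1 = e 0" unfolding constant_on_def by (metis atLeastAtMost_iff order_refl zero_le_one)
  moreover have I: "0 \<in> {0..1::real}" "1 \<in> {0..1::real}" by auto
  ultimately have D10: "D 1 = D 0" using e(2)[OF I(1)] e(2)[OF I(2)] closed by simp
  let ?G = "relative_homology_group 2 ?P (Pc 0)"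
  let ?L = "relative_homology_group 2 ?S (N (g 0))"
  let ?h = "hom_induced 2 ?P (Pc 0) ?S (N (g 0)) (fold_map (g 0))"
  interpret h: group_hom ?G ?L ?h
    by (simp add: group_hom_def group_hom_axioms_def hom_induced_hom)
  have "Pc 1 = Pc 0" using \<gamma>01 by (simp add: Pc_def)
  then have "D 1 = ?h (inv\<^bsub>?G\<^esub> (\<omega> 0))" using closed inv by (simp add: D_def)
  also have "\<dots> = inv\<^bsub>?L\<^esub> (D 0)" using h.hom_inv[OF \<omega>[OF I(1)]] by (simp add: D_def)
  finally have "inv\<^bsub>?L\<^esub> (D 0) = D 0" using D10 by simp
  then have D0: "?h (\<omega> 0) = \<one>\<^bsub>?L\<^esub>"
    using integer_group_inv_self[of ?L "D 0"] relative_homology_group_punctured_sphere(2)[OF g1[OF I(1)]]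
    by (simp add: N_def D_def hom_induced_carrier)
  \<comment> \<open>\<open>\<omega> 0\<close> generates the local homology of the projective plane,
    so its trivial image makes the whole homomorphism trivial.\<close>
  have "?h ` carrier ?G = generate ?L (?h ` {\<omega> 0})"
    using h.generate_img[of "{\<omega> 0}"] gen[OF I(1)] \<omega>[OF I(1)] by simp
  also have "\<dots> = {\<one>\<^bsub>?L\<^esub>}" using D0 h.H.generate_one by simp
  finally have triv: "?h ` carrier ?G = {\<one>\<^bsub>?L\<^esub>}" .
  obtain y where "y \<in> carrier ?G" "?h y \<noteq> \<one>\<^bsub>?L\<^esub>"
    using fold_map_induced_nontrivial[OF g1[OF I(1)]] \<gamma>g[OF I(1)] unfolding Pc_def N_def by metis
  then show False using triv by blast
qed

subsection \<open>Isotopies of circle homeomorphisms\<close>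

lemma cis_eq_iff: "cis x = cis y \<longleftrightarrow> (\<exists>n::int. x = y + 2 * pi * n)"
  using sin_cos_eq_iff[of x y] by (auto simp: complex_eq_iff)

lemma cis_cover: "norm w = 1 \<Longrightarrow> \<exists>s. w = cis s"
  by (metis cis_Arg norm_zero sgn_div_norm inverse_1 scaleR_one zero_neq_one)

text \<open>It lets a continuous function of the angle that respects full turns descend to the
  circle.\<close>

lemma quotient_map_cis: "quotient_map (top_of_set {0..2*pi}) unit_circle cis"
proof (rule continuous_imp_quotient_map)
  show "continuous_map (top_of_set {0..2*pi}) unit_circle cis"
    by (auto intro!: continuous_on_cis continuous_on_id)
  show "compact_space (top_of_set {0..2*pi})"
    by (simp add: compact_space_subtopology)
  show "Hausdorff_space unit_circle"
    by (intro Hausdorff_space_subtopology) simp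
  show "cis ` topspace (top_of_set {0..2*pi}) = topspace unit_circle"
  proof
    show "topspace unit_circle \<subseteq> cis ` topspace (top_of_set {0..2*pi})"
    proof
      fix w assume "w \<in> topspace unit_circle"
      then have w: "norm w = 1" by simp
      then have "w = cis (Arg2pi w)"
        using Arg2pi_eq[of w] by (simp add: cis_conv_exp)
      then show "w \<in> cis ` topspace (top_of_set {0..2*pi})"
        using Arg2pi[of w] by (intro image_eqI[of _ _ "Arg2pi w"]) auto
    qed
  qed auto
qed

text \<open>If \<open>G t < G s\<close> for some \<open>s < t\<close>, then a late translate of
  \<open>s\<close> has a value at least \<open>G s\<close>, so \<open>G s\<close> is taken again
  beyond \<open>t\<close>.\<close>

lemma continuous_injective_strict_mono:
  fixes G :: "real \<Rightarrow> real"
  assumes cont: "continuous_on UNIV G" and inj: "inj G"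
    and per: "\<And>s. G (s + c) = G s + c" and c: "c > 0"
  shows "strict_mono G"
proof (rule strict_monoI)
  fix s t :: real assume st: "s < t"
  have per_n: "G (s + real n * c) = G s + real n * c" for n s
  proof (induction n)
    case (Suc n)
    have "G (s + real (Suc n) * c) = G ((s + real n * c) + c)" by (simp add: algebra_simps)
    also have "\<dots> = G s + real (Suc n) * c" unfolding per Suc by (simp add: algebra_simps)
    finally show ?case .
  qed simp
  show "G s < G t"
  proof (rule ccontr)
    assume "\<not> G s < G t"
    moreover have "G s \<noteq> G t" using inj st by (auto dest: injD)
    ultimately have gt: "G t < G s" by simp
    obtain n where n: "t - s < real n * c" using reals_Archimedean3[OF c] by blast
    have "n > 0" using n st c by (cases n) auto
    then have "G s \<le> G (s + real n * c)" using per_n c by simp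
    moreover have "continuous_on {t..s + real n * c} G" using cont continuous_on_subset by blast
    ultimately obtain x where x: "t \<le> x" "G x = G s"
      using IVT'[of G t "G s" "s + real n * c"] gt n by auto
    then have "x = s" using inj by (auto dest: injD)
    then show False using x st by simp
  qed
qed

lemma periodic_shift_int:
  fixes G :: "real \<Rightarrow> real"
  assumes per: "\<And>s. G (s + c) = G s + d"
  shows "G (s + c * of_int n) = G s + d * of_int n"
proof -
  have nat: "G (s + c * real k) = G s + d * real k" for k s
  proof (induction k)
    case (Suc k)
    have "G (s + c * real (Suc k)) = G ((s + c * real k) + c)" by (simp add: algebra_simps)
    also have "\<dots> = G s + d * real (Suc k)" unfolding per Suc by (simp add: algebra_simps)
    finally show ?case .
  qed simp
  show ?thesis
  proof (cases "n \<ge> 0")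
    case True
    then show ?thesis using nat[of s "nat n"] by simp
  next
    case False
    then show ?thesis using nat[of "s + c * of_int n" "nat (- n)"] by (simp add: algebra_simps)
  qed
qed

text \<open>A lift \<open>G\<close> of the angle gains a constant whole number of turns per period.
  With no turn it would come back to its initial value and take an intermediate value twice; with
  two or more it would complete one turn strictly inside the period. Both contradict
  injectivity.\<close>

lemma circle_injection_lift:
  fixes \<phi> :: "complex \<Rightarrow> complex"
  assumes cont: "continuous_on (sphere 0 1) \<phi>" and im: "\<phi> \<in> sphere 0 1 \<rightarrow> sphere 0 1"
    and inj: "inj_on \<phi> (sphere 0 1)"
  obtains G m where "continuous_on UNIV G" "\<And>s. \<phi> (cis s) = cis (G s)"
    "\<And>s. G (s + 2 * pi) = G s + 2 * pi * m" "m = 1 \<or> m = (-1::real)"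
proof -
  have "continuous_on UNIV (\<lambda>s. \<phi> (cis s))"
    by (rule continuous_on_compose2[OF cont]) (auto intro!: continuous_on_cis continuous_on_id)
  moreover have n1: "norm (\<phi> (cis s)) = 1" for s using im by (auto simp: Pi_iff)
  moreover have "contractible (UNIV :: real set)" by (simp add: convex_imp_contractible)
  ultimately obtain g where g: "continuous_on UNIV g" "\<And>s. \<phi> (cis s) = exp (g s)"
    using continuous_logarithm_on_contractible[of UNIV "\<lambda>s. \<phi> (cis s)"] by (metis UNIV_I norm_zero zero_neq_one)
  define G where "G s = Im (g s)" for s
  have contG: "continuous_on A G" for A
    unfolding G_def by (intro continuous_intros continuous_on_subset[OF g(1)]) auto
  have G: "\<phi> (cis s) = cis (G s)" for s
  proof -
    have "Re (g s) = 0" using n1[of s] by (simp add: g(2))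
    then have "g s = \<i> * of_real (G s)" by (simp add: complex_eq_iff G_def)
    then have "cis (G s) = exp (g s)" by (simp add: cis_conv_exp)
    then show ?thesis by (simp add: g(2))
  qed
  have inj2: "cis s = cis t" if "cis (G s) = cis (G t)" for s t
    using inj that unfolding G[symmetric] by (rule inj_onD) auto
  define d where "d s = (G (s + 2 * pi) - G s) / (2 * pi)" for s
  have dint: "\<exists>k::int. d s = of_int k" for s
  proof -
    have "cis (s + 2 * pi) = cis s" by (simp add: complex_eq_iff)
    then have "cis (G (s + 2 * pi)) = cis (G s)"
      by (simp flip: G)
    then obtain k :: int where "G (s + 2 * pi) = G s + 2 * pi * k" unfolding cis_eq_iff by blast
    then have "d s = of_int k" by (simp add: d_def)
    then show ?thesis ..
  qed
  have "d constant_on UNIV"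
  proof (rule continuous_discrete_range_constant)
    have "continuous_on UNIV (\<lambda>s. G (s + 2 * pi))"
      by (rule continuous_on_compose2[OF contG[of UNIV]]) (auto intro!: continuous_intros)
    then show "continuous_on UNIV d"
      unfolding d_def by (intro continuous_intros contG) auto
    fix s
    show "\<exists>e>0. \<forall>y. y \<in> UNIV \<and> d y \<noteq> d s \<longrightarrow> e \<le> norm (d y - d s)"
    proof (intro exI[of _ 1] conjI allI impI)
      fix y assume "y \<in> UNIV \<and> d y \<noteq> d s"
      then obtain k l :: int where "d y = of_int k" "d s = of_int l" "k \<noteq> l" using dint by metis
      then have "1 \<le> \<bar>k - l\<bar>" by linarith
      then show "1 \<le> norm (d y - d s)"
        using \<open>d y = of_int k\<close> \<open>d s = of_int l\<close>
        by (metis of_int_diff of_int_abs of_int_1_le_iff real_norm_def)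
    qed simp
  qed simp
  then obtain m where m: "\<And>s. d s = m" unfolding constant_on_def by auto
  obtain k :: int where k: "m = of_int k" using dint m by metis
  have per: "G (s + 2 * pi) = G s + 2 * pi * m" for s
    using m[of s] by (simp add: d_def field_simps)
  have G2: "G (2 * pi) = G 0 + 2 * pi * m" using per[of 0] by simp
  have inj0: "s = t" if "G s = G t" "0 \<le> s" "0 \<le> t" "\<bar>s - t\<bar> < 2 * pi" for s t
  proof -
    have "cis s = cis t" by (rule inj2) (simp add: that(1))
    then obtain n :: int where n: "s = t + 2 * pi * n" unfolding cis_eq_iff by blast
    have "2 * pi * \<bar>real_of_int n\<bar> < 2 * pi * 1" using that(4) unfolding n by (simp add: abs_mult)
    then have "\<bar>real_of_int n\<bar> < 1"
      by (rule mult_less_cancel_left_pos[THEN iffD1, rotated]) (simp add: pi_gt_zero)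
    then have "n = 0" by linarith
    then show ?thesis using n by simp
  qed
  have "k \<noteq> 0"
  proof
    assume "k = 0"
    then have e: "G (2 * pi) = G 0" using G2 k by simp
    have ne: "G pi \<noteq> G 0" using inj0[of pi 0] pi_gt_zero by auto
    \<comment> \<open>The mean of the values at 0 and \<pi> is attained in each half of the
      period.\<close>
    define y where "y = (G 0 + G pi) / 2"
    have "\<exists>s. 0 < s \<and> s < pi \<and> G s = y" "\<exists>s. pi < s \<and> s < 2 * pi \<and> G s = y"
    proof -
      consider "G 0 < G pi" | "G pi < G 0" using ne by linarith
      then have "(\<exists>s. 0 \<le> s \<and> s \<le> pi \<and> G s = y) \<and> (\<exists>s. pi \<le> s \<and> s \<le> 2 * pi \<and> G s = y)"
      proof cases
        case 1
        then show ?thesis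
          using IVT'[of G 0 y pi] IVT2'[of G "2 * pi" y pi] contG e by (auto simp: y_def)
      next
        case 2
        then show ?thesis
          using IVT2'[of G pi y 0] IVT'[of G pi y "2 * pi"] contG e by (auto simp: y_def)
      qed
      moreover have "G 0 \<noteq> y" "G pi \<noteq> y" "G (2 * pi) \<noteq> y" using ne e by (auto simp: y_def field_simps)
      ultimately show "\<exists>s. 0 < s \<and> s < pi \<and> G s = y" "\<exists>s. pi < s \<and> s < 2 * pi \<and> G s = y"
        by (metis order_le_less)+
    qed
    then obtain s t where "0 < s" "s < pi" "pi < t" "t < 2 * pi" "G s = G t" by metis
    then show False using inj0[of s t] by auto
  qed
  moreover have "\<not> \<bar>k\<bar> \<ge> 2"
  proof
    assume "\<bar>k\<bar> \<ge> 2"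
    \<comment> \<open>The sign of \<open>k\<close>: after multiplication by it the lift gains at
      least two turns, so one argument covers both directions.\<close>
    then obtain j :: int where j: "j = 1 \<or> j = - 1" "j * k \<ge> 2"
      using that by (cases "k \<ge> 0") force+
    define G' where "G' s = of_int j * G s" for s
    have jk: "of_int j * m \<ge> 2" using j(2) k by (metis of_int_le_iff of_int_mult of_int_numeral)
    have "G' (2 * pi) = G' 0 + 2 * pi * (of_int j * m)"
      unfolding G'_def G2 by (simp add: algebra_simps)
    moreover have "2 * pi * (of_int j * m) \<ge> 2 * pi * 2"
      by (rule mult_left_mono[OF jk]) simp
    ultimately have lt: "G' 0 + 2 * pi < G' (2 * pi)" using pi_gt_zero by linarith
    have "continuous_on {0..2 * pi} G'" unfolding G'_def by (intro continuous_intros contG)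
    then obtain s where s: "0 \<le> s" "s \<le> 2 * pi" "G' s = G' 0 + 2 * pi"
      using IVT'[of G' 0 "G' 0 + 2 * pi" "2 * pi"] lt pi_gt_zero by auto
    have "G s = G 0 + 2 * pi * of_int j"
      using s(3) j(1) by (auto simp: G'_def algebra_simps)
    then have "cis (G s) = cis (G 0)" unfolding cis_eq_iff by blast
    then obtain n :: int where n: "s = 0 + 2 * pi * n" using inj2 unfolding cis_eq_iff by metis
    have "s \<noteq> 0" "s \<noteq> 2 * pi" using s lt pi_gt_zero by auto
    then have "0 < s" "s < 2 * pi" using s by auto
    then have "0 < 2 * pi * real_of_int n" "2 * pi * real_of_int n < 2 * pi * 1" using n by auto
    then have "0 < real_of_int n" "real_of_int n < 1" by (auto simp: zero_less_mult_iff)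
    then have "0 < n" "n < 1" by simp_all
    then show False by simp
  qed
  ultimately have "k = 1 \<or> k = - 1" by linarith
  then show ?thesis using that[OF contG G per] k by auto
qed

text \<open>\<open>G s - s\<close> is periodic and descends to a function \<open>k\<close> on the
  circle, by which \<open>\<phi>\<close> rotates each point. Scaling \<open>k\<close> down to 0
  corresponds on the line to convex combinations of \<open>G\<close> and the identity. These are
  strictly increasing and commute with full turns, so they induce bijections of the circle.\<close>

lemma circle_injection_isotopic_id:
  fixes \<phi> :: "complex \<Rightarrow> complex"
  assumes inj: "inj_on \<phi> (sphere 0 1)"
    and cont: "continuous_on UNIV G" and G: "\<And>s. \<phi> (cis s) = cis (G s)"
    and per: "\<And>s. G (s + 2 * pi) = G s + 2 * pi"
  obtains \<Psi> where "continuous_on ({0..1} \<times> sphere 0 1) (\<lambda>p. \<Psi> (fst p) (snd p))"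
    "\<And>t. t \<in> {0..1::real} \<Longrightarrow> bij_betw (\<Psi> t) (sphere 0 1) (sphere 0 1)"
    "\<And>w. norm w = 1 \<Longrightarrow> \<Psi> 0 w = \<phi> w" "\<And>w. norm w = 1 \<Longrightarrow> \<Psi> 1 w = w"
proof -
  have contG: "continuous_on A G" for A using cont continuous_on_subset by blast
  have perZ: "G (s + 2 * pi * of_int n) = G s + 2 * pi * of_int n" for s n
    by (rule periodic_shift_int) (rule per)
  have injG: "inj G"
  proof (rule injI)
    fix s t assume eq: "G s = G t"
    then have "cis s = cis t" using inj_onD[OF inj, of "cis s" "cis t"] G by simp
    then obtain n :: int where n: "s = t + 2 * pi * n" unfolding cis_eq_iff by blast
    then have "2 * pi * real_of_int n = 0" using eq perZ by simp
    then show "s = t" using n by simp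
  qed
  have mono: "strict_mono G"
    by (rule continuous_injective_strict_mono[OF cont injG per]) (simp add: pi_gt_zero)
  obtain k where k: "continuous_map unit_circle euclideanreal k" "\<And>s. s \<in> {0..2*pi} \<Longrightarrow> k (cis s) = G s - s"
  proof (rule quotient_map_lift_exists[OF quotient_map_cis])
    show "continuous_map (top_of_set {0..2*pi}) euclideanreal (\<lambda>s. G s - s)"
      by (simp, intro continuous_intros contG)
    show "G x - x = G y - y" if xy: "cis x = cis y" for x y
    proof -
      obtain n :: int where "x = y + 2 * pi * n" using xy unfolding cis_eq_iff by blast
      then show ?thesis using perZ by simp
    qed
  qed (use that in auto)
  have k_cis: "k (cis s) = G s - s" for s
  proof -
    define r where "r = Arg2pi (cis s)"
    have r: "0 \<le> r" "r < 2 * pi" "cis r = cis s"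
      using Arg2pi[of "cis s"] Arg2pi_eq[of "cis s"] by (auto simp: r_def cis_conv_exp mult.commute)
    obtain n :: int where "s = r + 2 * pi * n" using r(3) cis_eq_iff by metis
    then show ?thesis using k(2)[of r] r perZ by simp
  qed
  define H where "H t s = t * s + (1 - t) * G s" for t s
  define \<Psi> where "\<Psi> t w = w * cis ((1 - t) * k w)" for t w
  have \<Psi>: "\<Psi> t (cis s) = cis (H t s)" for t s
    by (simp add: \<Psi>_def H_def k_cis cis_mult algebra_simps)
  have perH: "H t (s + 2 * pi * of_int n) = H t s + 2 * pi * of_int n" for t s n
    unfolding H_def perZ by (simp add: algebra_simps)
  have monoH: "H t s < H t s'" if "t \<in> {0..1}" "s < s'" for t s s'
  proof -
    have "G s < G s'" using mono that(2) by (simp add: strict_mono_less)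
    show ?thesis
    proof (cases "t = 0")
      case True then show ?thesis using \<open>G s < G s'\<close> by (simp add: H_def)
    next
      case False
      then have "t * s < t * s'" "(1 - t) * G s \<le> (1 - t) * G s'" using that \<open>G s < G s'\<close> by (auto intro: mult_left_mono)
      then show ?thesis by (simp add: H_def)
    qed
  qed
  have bij: "bij_betw (\<Psi> t) (sphere 0 1) (sphere 0 1)" if t: "t \<in> {0..1}" for t
    unfolding bij_betw_def
  proof (intro conjI inj_onI equalityI subsetI)
    fix v w assume "v \<in> sphere 0 1" "w \<in> sphere 0 1" and eq: "\<Psi> t v = \<Psi> t w"
    then obtain r s where rs: "v = cis r" "w = cis s" using cis_cover by (metis mem_sphere_0)
    then obtain n :: int where "H t r = H t s + 2 * pi * n" using eq unfolding rs \<Psi> cis_eq_iff by blast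
    then have "H t r = H t (s + 2 * pi * n)" by (simp add: perH)
    then have "r = s + 2 * pi * n" using monoH[OF t] by (metis less_irrefl linorder_neqE)
    then show "v = w" unfolding rs cis_eq_iff by blast
  next
    fix v assume "v \<in> \<Psi> t ` sphere 0 1"
    then show "v \<in> sphere 0 1" by (auto simp: \<Psi>_def norm_mult)
  next
    fix v :: complex assume "v \<in> sphere 0 1"
    then obtain r where r: "v = cis r" using cis_cover by (metis mem_sphere_0)
    \<comment> \<open>The number of full turns from \<open>H t 0\<close> up to \<open>r\<close>:
      then \<open>r\<close> lies between the values at the two ends of a period, as the intermediate
      value theorem requires.\<close>
    define n where "n = \<lfloor>(r - H t 0) / (2 * pi)\<rfloor>"
    have "of_int n \<le> (r - H t 0) / (2 * pi)" "(r - H t 0) / (2 * pi) \<le> of_int n + 1"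
      unfolding n_def by linarith+
    then have le: "H t (0 + 2 * pi * of_int n) \<le> r" "r \<le> H t (0 + 2 * pi * of_int (n + 1))"
      unfolding perH by (simp_all add: field_simps)
    have "continuous_on {2 * pi * of_int n..2 * pi * of_int (n + 1)} (H t)"
      unfolding H_def by (intro continuous_intros contG)
    then obtain s where "H t s = r"
      using IVT'[of "H t" "2 * pi * of_int n" r "2 * pi * of_int (n + 1)"] le by auto
    then have "v = \<Psi> t (cis s)" using r \<Psi> by simp
    then show "v \<in> \<Psi> t ` sphere 0 1" by auto
  qed
  have contk: "continuous_on (sphere 0 1) k" using k(1) by simp
  show ?thesis
  proof (rule that[of \<Psi>])
    have "continuous_on ({0..1::real} \<times> sphere 0 1) (\<lambda>p. k (snd p))"
      by (rule continuous_on_compose2[OF contk]) (auto intro: continuous_on_snd continuous_on_id)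
    then show "continuous_on ({0..1} \<times> sphere 0 1) (\<lambda>p. \<Psi> (fst p) (snd p))"
      unfolding \<Psi>_def by (intro continuous_intros continuous_on_cis)
    show "\<Psi> 0 w = \<phi> w" "\<Psi> 1 w = w" if w: "norm w = 1" for w
    proof -
      obtain s where s: "w = cis s" using cis_cover[OF w] by blast
      show "\<Psi> 0 w = \<phi> w" unfolding s \<Psi> G by (simp add: H_def)
      show "\<Psi> 1 w = w" by (simp add: \<Psi>_def)
    qed
  qed (use bij in auto)
qed

text \<open>For a lift that loses a turn per period, precomposition with conjugation reverses the
  direction and reduces to the previous case.\<close>

lemma circle_injection_isotopy:
  fixes \<phi> :: "complex \<Rightarrow> complex"
  assumes cont: "continuous_on (sphere 0 1) \<phi>" and im: "\<phi> \<in> sphere 0 1 \<rightarrow> sphere 0 1"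
    and inj: "inj_on \<phi> (sphere 0 1)"
  obtains \<Psi> where "continuous_on ({0..1} \<times> sphere 0 1) (\<lambda>p. \<Psi> (fst p) (snd p))"
    "\<And>t. t \<in> {0..1::real} \<Longrightarrow> bij_betw (\<Psi> t) (sphere 0 1) (sphere 0 1)"
    "(\<forall>w. norm w = 1 \<longrightarrow> \<Psi> 0 w = \<phi> w) \<or> (\<forall>w. norm w = 1 \<longrightarrow> \<Psi> 0 w = \<phi> (cnj w))"
    "\<And>w. norm w = 1 \<Longrightarrow> \<Psi> 1 w = w"
proof -
  obtain G m where G: "continuous_on UNIV G" "\<And>s. \<phi> (cis s) = cis (G s)"
    "\<And>s. G (s + 2 * pi) = G s + 2 * pi * m" "m = 1 \<or> m = (-1::real)"
    using circle_injection_lift[OF assms] by metis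
  show ?thesis
  proof (cases "m = 1")
    case True
    then have per: "G (s + 2 * pi) = G s + 2 * pi" for s using G(3) by simp
    show ?thesis
    proof (rule circle_injection_isotopic_id[OF inj G(1,2) per])
      fix \<Psi>
      assume "continuous_on ({0..1} \<times> sphere 0 1) (\<lambda>p. \<Psi> (fst p) (snd p))"
        "\<And>t. t \<in> {0..1::real} \<Longrightarrow> bij_betw (\<Psi> t) (sphere 0 1) (sphere 0 1)"
        "\<And>w. norm w = 1 \<Longrightarrow> \<Psi> 0 w = \<phi> w" "\<And>w. norm w = 1 \<Longrightarrow> \<Psi> 1 w = w"
      then show ?thesis by (intro that[of \<Psi>] disjI1) auto
    qed
  next
    case False
    then have m: "m = - 1" using G(4) by simp
    have per: "G (- (s + 2 * pi)) = G (- s) + 2 * pi" for s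
      using G(3)[of "- s - 2 * pi"] m by simp
    have c: "continuous_on UNIV (\<lambda>s. G (- s))"
      by (rule continuous_on_compose2[OF G(1)]) (auto intro!: continuous_intros)
    have i: "inj_on (\<lambda>w. \<phi> (cnj w)) (sphere 0 1)"
    proof (rule inj_onI)
      fix v w :: complex assume vw: "v \<in> sphere 0 1" "w \<in> sphere 0 1" and eq: "\<phi> (cnj v) = \<phi> (cnj w)"
      have "cnj v = cnj w" by (rule inj_onD[OF inj eq]) (use vw in simp_all)
      then show "v = w" by simp
    qed
    have e: "\<phi> (cnj (cis s)) = cis (G (- s))" for s using G(2)[of "- s"] by (simp add: cis_cnj)
    show ?thesis
    proof (rule circle_injection_isotopic_id[OF i c e per])
      fix \<Psi>
      assume "continuous_on ({0..1} \<times> sphere 0 1) (\<lambda>p. \<Psi> (fst p) (snd p))"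
        "\<And>t. t \<in> {0..1::real} \<Longrightarrow> bij_betw (\<Psi> t) (sphere 0 1) (sphere 0 1)"
        "\<And>w. norm w = 1 \<Longrightarrow> \<Psi> 0 w = \<phi> (cnj w)" "\<And>w. norm w = 1 \<Longrightarrow> \<Psi> 1 w = w"
      then show ?thesis by (intro that[of \<Psi>] disjI2) auto
    qed
  qed
qed

subsection \<open>Circle bundles over loops\<close>

lemma compact_space_unit_circle: "compact_space unit_circle"
  by (simp add: compact_space_subtopology)

lemma Hausdorff_unit_circle: "Hausdorff_space unit_circle"
  by (intro Hausdorff_space_subtopology) simp

text \<open>The circle is compact and \<open>E\<close> is Hausdorff, so \<open>\<beta>\<close> is a
  homeomorphism onto the fibre, and its inverse can be composed with
  \<open>\<alpha>\<close>.\<close>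

lemma circle_parametrizations_transition:
  assumes "Hausdorff_space E"
    and \<alpha>: "continuous_map unit_circle E \<alpha>" "bij_betw \<alpha> (sphere 0 1) F"
    and \<beta>: "continuous_map unit_circle E \<beta>" "bij_betw \<beta> (sphere 0 1) F"
  obtains \<phi> where "continuous_on (sphere 0 1) \<phi>" "bij_betw \<phi> (sphere 0 1) (sphere 0 1)"
    "\<And>w. w \<in> sphere 0 1 \<Longrightarrow> \<beta> (\<phi> w) = \<alpha> w"
proof -
  have im: "\<alpha> ` sphere 0 1 = F" "\<beta> ` sphere 0 1 = F"
    using \<alpha> \<beta> by (simp_all add: bij_betw_def)
  have FE: "F \<subseteq> topspace E"
    using continuous_map_image_subset_topspace[OF \<beta>(1)] im by simp
  have c: "continuous_map unit_circle (subtopology E F) \<alpha>" "continuous_map unit_circle (subtopology E F) \<beta>"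
    using \<alpha>(1) \<beta>(1) im by (auto simp: continuous_map_in_subtopology)
  have "homeomorphic_map unit_circle (subtopology E F) \<beta>"
    by (rule continuous_imp_homeomorphic_map[OF c(2) compact_space_unit_circle])
       (use assms FE im in \<open>auto simp: Hausdorff_space_subtopology bij_betw_def\<close>)
  then obtain k where k: "homeomorphic_maps unit_circle (subtopology E F) \<beta> k"
    using homeomorphic_map_maps by blast
  have kc: "continuous_map (subtopology E F) unit_circle k" and \<beta>k: "\<And>x. x \<in> F \<Longrightarrow> \<beta> (k x) = x"
    and k\<beta>: "\<And>w. w \<in> sphere 0 1 \<Longrightarrow> k (\<beta> w) = w"
    using k FE by (auto simp: homeomorphic_maps_def)
  show ?thesis
  proof (rule that[of "k \<circ> \<alpha>"])
    have "continuous_map unit_circle unit_circle (k \<circ> \<alpha>)" by (rule continuous_map_compose[OF c(1) kc])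
    then show "continuous_on (sphere 0 1) (k \<circ> \<alpha>)" by simp
    have "bij_betw k F (sphere 0 1)"
    proof (rule bij_betw_byWitness[where f' = \<beta>])
      show "k ` F \<subseteq> sphere 0 1" unfolding im(2)[symmetric] using k\<beta> by auto
    qed (use \<beta>k k\<beta> im in auto)
    then show "bij_betw (k \<circ> \<alpha>) (sphere 0 1) (sphere 0 1)"
      using \<alpha>(2) bij_betw_trans by blast
    show "\<beta> ((k \<circ> \<alpha>) w) = \<alpha> w" if "w \<in> sphere 0 1" for w
    proof -
      have "\<alpha> w \<in> F" using im that by blast
      then show ?thesis using \<beta>k by simp
    qed
  qed
qed

lemma continuous_map_slice:
  assumes "continuous_map (prod_topology (top_of_set A) unit_circle) E \<theta>" "a \<in> A"
  shows "continuous_map unit_circle E (\<lambda>w. \<theta> (a, w))"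
proof -
  have "continuous_map unit_circle (prod_topology (top_of_set A) unit_circle) (\<lambda>w. (a, w))"
    using assms(2) by (intro continuous_map_pairedI) auto
  from continuous_map_compose[OF this assms(1)] show ?thesis by (simp add: o_def)
qed

lemma circle_chart_inverse:
  assumes U: "U \<subseteq> topspace B"
    and h: "homeomorphic_map (preimage_space X f U) (prod_topology (subtopology B U) unit_circle) h"
    and fh: "\<And>x. x \<in> topspace X \<Longrightarrow> f x \<in> U \<Longrightarrow> fst (h x) = f x"
  obtains k where "continuous_map (prod_topology (subtopology B U) unit_circle) (preimage_space X f U) k"
    "continuous_map (preimage_space X f U) unit_circle (\<lambda>x. snd (h x))"
    "\<And>x. x \<in> topspace X \<Longrightarrow> f x \<in> U \<Longrightarrow> norm (snd (h x)) = 1"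
    "\<And>x. x \<in> topspace X \<Longrightarrow> f x \<in> U \<Longrightarrow> k (f x, snd (h x)) = x"
    "\<And>u w. u \<in> U \<Longrightarrow> norm w = 1 \<Longrightarrow> k (u, w) \<in> topspace X"
    "\<And>u w. u \<in> U \<Longrightarrow> norm w = 1 \<Longrightarrow> f (k (u, w)) = u"
    "\<And>u w. u \<in> U \<Longrightarrow> norm w = 1 \<Longrightarrow> snd (h (k (u, w))) = w"
proof -
  let ?P = "preimage_space X f U" and ?Q = "prod_topology (subtopology B U) unit_circle"
  obtain k where k: "homeomorphic_maps ?P ?Q h k" using h homeomorphic_map_maps by blast
  have hc: "continuous_map ?P ?Q h" and kc: "continuous_map ?Q ?P k"
    and kh: "\<And>x. x \<in> topspace ?P \<Longrightarrow> k (h x) = x" and hk: "\<And>p. p \<in> topspace ?Q \<Longrightarrow> h (k p) = p"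
    using k unfolding homeomorphic_maps_def by blast+
  have P: "x \<in> topspace ?P \<longleftrightarrow> x \<in> topspace X \<and> f x \<in> U" for x by auto
  have Q: "(u, w) \<in> topspace ?Q \<longleftrightarrow> u \<in> U \<and> norm w = 1" for u w using U by auto
  have hQ: "h x \<in> topspace ?Q" if "x \<in> topspace X" "f x \<in> U" for x
    using continuous_map_image_subset_topspace[OF hc] that P by (meson image_subset_iff)
  have kP: "k (u, w) \<in> topspace X \<and> f (k (u, w)) \<in> U" if "u \<in> U" "norm w = 1" for u w
    using continuous_map_image_subset_topspace[OF kc] that P Q by (meson image_subset_iff)
  show ?thesis
  proof (rule that[OF kc])
    show "continuous_map ?P unit_circle (\<lambda>x. snd (h x))"
      using continuous_map_compose[OF hc continuous_map_snd] by (simp add: o_def)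
    show "norm (snd (h x)) = 1" if "x \<in> topspace X" "f x \<in> U" for x
      using hQ[OF that] Q[of "fst (h x)" "snd (h x)"] by simp
    show "k (f x, snd (h x)) = x" if "x \<in> topspace X" "f x \<in> U" for x
      using kh[of x] P that fh[OF that] by (metis prod.collapse)
    show "k (u, w) \<in> topspace X" if "u \<in> U" "norm w = 1" for u w using kP[OF that] by simp
    have hk': "h (k (u, w)) = (u, w)" if "u \<in> U" "norm w = 1" for u w
      by (rule hk) (use Q that in blast)
    show "f (k (u, w)) = u" if "u \<in> U" "norm w = 1" for u w
      using fh[of "k (u, w)"] kP[OF that] hk'[OF that] by simp
    show "snd (h (k (u, w))) = w" if "u \<in> U" "norm w = 1" for u w
      using hk'[OF that] by simp
  qed
qed

text \<open>A trivialization, over \<open>A\<close>, of the pullback along \<open>\<gamma>\<close>,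
  written as a map into the total space. No continuous inverse is demanded, since compactness of the
  circle or of the cylinder supplies it.\<close>

definition fibre_param where
  "fibre_param E f \<gamma> A \<theta> \<longleftrightarrow> continuous_map (prod_topology (top_of_set A) unit_circle) E \<theta> \<and>
     (\<forall>t\<in>A. bij_betw (\<lambda>w. \<theta> (t, w)) (sphere 0 1) {x \<in> topspace E. f x = \<gamma> t})"

text \<open>The two parametrizations may disagree over \<open>b\<close>. The second is corrected
  over its whole interval by the transition map at \<open>b\<close>.\<close>

lemma fibre_param_concat:
  fixes a b c :: real
  assumes "Hausdorff_space E" "a \<le> b" "b \<le> c"
    and 1: "fibre_param E f \<gamma> {a..b} \<theta>1" and 2: "fibre_param E f \<gamma> {b..c} \<theta>2"
  shows "\<exists>\<theta>. fibre_param E f \<gamma> {a..c} \<theta>"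
proof -
  have bb: "b \<in> {a..b}" "b \<in> {b..c}" using assms by auto
  obtain \<phi> where \<phi>: "continuous_on (sphere 0 1) \<phi>" "bij_betw \<phi> (sphere 0 1) (sphere 0 1)"
    "\<And>w. w \<in> sphere 0 1 \<Longrightarrow> \<theta>2 (b, \<phi> w) = \<theta>1 (b, w)"
  proof (rule circle_parametrizations_transition[OF assms(1)])
    show "continuous_map unit_circle E (\<lambda>w. \<theta>1 (b, w))" "continuous_map unit_circle E (\<lambda>w. \<theta>2 (b, w))"
      using 1 2 bb continuous_map_slice unfolding fibre_param_def by blast+
    show "bij_betw (\<lambda>w. \<theta>1 (b, w)) (sphere 0 1) {x \<in> topspace E. f x = \<gamma> b}"
      "bij_betw (\<lambda>w. \<theta>2 (b, w)) (sphere 0 1) {x \<in> topspace E. f x = \<gamma> b}"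
      using 1 2 bb unfolding fibre_param_def by blast+
  qed (rule that)
  define \<theta> where "\<theta> p = (if fst p \<le> b then \<theta>1 p else \<theta>2 (fst p, \<phi> (snd p)))" for p
  let ?X = "prod_topology (top_of_set {a..c}) unit_circle"
  have X: "?X = top_of_set ({a..c} \<times> sphere 0 1)" by simp
  have \<phi>S: "\<phi> w \<in> sphere 0 1" if "w \<in> sphere 0 1" for w
    using \<phi>(2) that by (auto simp: bij_betw_def)
  have "continuous_map ?X E \<theta>"
    unfolding \<theta>_def
  proof (rule continuous_map_cases_le)
    show "continuous_map ?X euclideanreal fst" unfolding X by (simp add: continuous_on_fst)
    show "continuous_map ?X euclideanreal (\<lambda>x. b)" by simp
    have "subtopology ?X {x \<in> topspace ?X. fst x \<le> b} = prod_topology (top_of_set {a..b}) unit_circle"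
      unfolding X subtopology_subtopology using assms by (simp, intro arg_cong[where f = top_of_set]) auto
    then show "continuous_map (subtopology ?X {x \<in> topspace ?X. fst x \<le> b}) E \<theta>1"
      using 1 by (simp add: fibre_param_def)
    have eq: "subtopology ?X {x \<in> topspace ?X. b \<le> fst x} = top_of_set ({b..c} \<times> sphere 0 1)"
      unfolding X subtopology_subtopology using assms by (intro arg_cong[where f = top_of_set]) auto
    have "continuous_on ({b..c} \<times> sphere 0 1) (\<lambda>p. (fst p, \<phi> (snd p)))"
      by (intro continuous_intros continuous_on_compose2[OF \<phi>(1)]) auto
    then have "continuous_map (top_of_set ({b..c} \<times> sphere 0 1)) (prod_topology (top_of_set {b..c}) unit_circle)
        (\<lambda>p. (fst p, \<phi> (snd p)))"
      using \<phi>S by auto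
    from continuous_map_compose[OF this] 2
    show "continuous_map (subtopology ?X {x \<in> topspace ?X. b \<le> fst x}) E (\<lambda>p. \<theta>2 (fst p, \<phi> (snd p)))"
      unfolding eq fibre_param_def by (fastforce simp: o_def)
    show "\<theta>1 x = \<theta>2 (fst x, \<phi> (snd x))" if "x \<in> topspace ?X" "fst x = b" for x
      using \<phi>(3)[of "snd x"] that by (cases x) auto
  qed
  moreover have "bij_betw (\<lambda>w. \<theta> (t, w)) (sphere 0 1) {x \<in> topspace E. f x = \<gamma> t}" if t: "t \<in> {a..c}" for t
  proof (cases "t \<le> b")
    case True
    then show ?thesis using 1 t unfolding fibre_param_def by (simp add: \<theta>_def)
  next
    case False
    then have "bij_betw (\<lambda>w. \<theta>2 (t, w)) (sphere 0 1) {x \<in> topspace E. f x = \<gamma> t}"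
      using 2 t unfolding fibre_param_def by simp
    from bij_betw_trans[OF \<phi>(2) this] show ?thesis using False by (simp add: \<theta>_def o_def)
  qed
  ultimately show ?thesis unfolding fibre_param_def by blast
qed

lemma circle_bundle_fibre_param:
  fixes \<gamma> :: "real \<Rightarrow> 'b"
  assumes "Hausdorff_space E" and bun: "circle_bundle E B f"
    and \<gamma>: "continuous_map (top_of_set {0..1}) B \<gamma>"
  obtains \<theta> where "fibre_param E f \<gamma> {0..1} \<theta>"
proof -
  \<comment> \<open>Bisection quantifies over all small intervals about a point, so the predicate is
    vacuous for those that leave the unit interval.\<close>
  define P where "P a b \<longleftrightarrow> (0 \<le> a \<longrightarrow> b \<le> 1 \<longrightarrow> (\<exists>\<theta>. fibre_param E f \<gamma> {a..b} \<theta>))" for a b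
  have "P 0 1"
  proof (rule Bolzano)
    fix a b c :: real assume "P a b" "P b c" "a \<le> b" "b \<le> c"
    then show "P a c" unfolding P_def using fibre_param_concat[OF assms(1)] by (meson order_trans)
  next
    fix x :: real assume x: "0 \<le> x" "x \<le> 1"
    then have \<gamma>x: "\<gamma> x \<in> topspace B" using continuous_map_image_subset_topspace[OF \<gamma>] by auto
    from bun have "\<forall>b \<in> topspace B. \<exists>U h. openin B U \<and> b \<in> U \<and>
        homeomorphic_map (preimage_space E f U) (prod_topology (subtopology B U) unit_circle) h \<and>
        (\<forall>x \<in> topspace E. f x \<in> U \<longrightarrow> fst (h x) = f x)"
      unfolding circle_bundle_def by (rule conjunct2)
    from bspec[OF this \<gamma>x] obtain U h where Uh: "openin B U \<and> \<gamma> x \<in> U \<and>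
        homeomorphic_map (preimage_space E f U) (prod_topology (subtopology B U) unit_circle) h \<and>
        (\<forall>x \<in> topspace E. f x \<in> U \<longrightarrow> fst (h x) = f x)" by (elim exE)
    then have U: "openin B U" "\<gamma> x \<in> U"
      and h: "homeomorphic_map (preimage_space E f U) (prod_topology (subtopology B U) unit_circle) h"
      and fh: "\<And>x. x \<in> topspace E \<Longrightarrow> f x \<in> U \<Longrightarrow> fst (h x) = f x"
      by blast+
    have op: "openin (top_of_set {0..1}) {t \<in> topspace (top_of_set {0..1}). \<gamma> t \<in> U}"
      by (rule openin_continuous_map_preimage[OF \<gamma> U(1)])
    then obtain d where d: "d > 0" "\<And>t. t \<in> {0..1} \<Longrightarrow> dist t x < d \<Longrightarrow> \<gamma> t \<in> U"
    proof -
      have "x \<in> {t \<in> {0..1}. \<gamma> t \<in> U}" using x U(2) by simp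
      with op have "\<exists>e>0. \<forall>x'\<in>{0..1}. dist x' x < e \<longrightarrow> x' \<in> {t \<in> {0..1}. \<gamma> t \<in> U}"
        unfolding openin_euclidean_subtopology_iff topspace_euclidean_subtopology by (elim conjE) (erule bspec)
      then obtain d where "d > 0" "\<forall>x'\<in>{0..1}. dist x' x < d \<longrightarrow> x' \<in> {t \<in> {0..1}. \<gamma> t \<in> U}"
        by (elim exE conjE)
      then show ?thesis by (intro that[of d]) auto
    qed
    obtain k where kc: "continuous_map (prod_topology (subtopology B U) unit_circle) (preimage_space E f U) k"
      and "continuous_map (preimage_space E f U) unit_circle (\<lambda>x. snd (h x))"
      and h1: "\<And>x. x \<in> topspace E \<Longrightarrow> f x \<in> U \<Longrightarrow> norm (snd (h x)) = 1"
      and kh: "\<And>x. x \<in> topspace E \<Longrightarrow> f x \<in> U \<Longrightarrow> k (f x, snd (h x)) = x"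
      and kE: "\<And>u w. u \<in> U \<Longrightarrow> norm w = 1 \<Longrightarrow> k (u, w) \<in> topspace E"
      and fk: "\<And>u w. u \<in> U \<Longrightarrow> norm w = 1 \<Longrightarrow> f (k (u, w)) = u"
      and hk: "\<And>u w. u \<in> U \<Longrightarrow> norm w = 1 \<Longrightarrow> snd (h (k (u, w))) = w"
      by (rule circle_chart_inverse[OF openin_subset[OF U(1)] h fh]) (assumption, assumption, rule that)
    show "\<exists>d>0. \<forall>a b. a \<le> x \<and> x \<le> b \<and> b - a < d \<longrightarrow> P a b"
    proof (intro exI[of _ d] conjI allI impI d(1))
      fix a b assume ab: "a \<le> x \<and> x \<le> b \<and> b - a < d"
      show "P a b" unfolding P_def
      proof (intro impI)
        assume "0 \<le> a" "b \<le> 1"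
        then have tU: "t \<in> {0..1}" "\<gamma> t \<in> U" if "t \<in> {a..b}" for t
          using ab that d(2)[of t] by (auto simp: dist_real_def)
        have "continuous_map (top_of_set {a..b}) (subtopology B U) \<gamma>"
        proof -
          have "{0..1} \<inter> {a..b} = {a..b}" using tU(1) by blast
          then have "subtopology (top_of_set {0..1}) {a..b} = top_of_set {a..b}"
            by (simp only: subtopology_subtopology)
          then have "continuous_map (top_of_set {a..b}) B \<gamma>"
            using continuous_map_from_subtopology[OF \<gamma>, of "{a..b}"] by simp
          then show ?thesis using tU(2) by (auto simp: continuous_map_in_subtopology)
        qed
        then have "continuous_map (prod_topology (top_of_set {a..b}) unit_circle) (subtopology B U) (\<gamma> \<circ> fst)"
          by (rule continuous_map_compose[OF continuous_map_fst])
        then have "continuous_map (prod_topology (top_of_set {a..b}) unit_circle) (prod_topology (subtopology B U) unit_circle)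
            (\<lambda>p. ((\<gamma> \<circ> fst) p, snd p))"
          by (rule continuous_map_pairedI[OF _ continuous_map_snd])
        then have "continuous_map (prod_topology (top_of_set {a..b}) unit_circle) (preimage_space E f U)
           (k \<circ> (\<lambda>p. ((\<gamma> \<circ> fst) p, snd p)))"
          by (rule continuous_map_compose[OF _ kc])
        then have "continuous_map (prod_topology (top_of_set {a..b}) unit_circle) E (\<lambda>p. k (\<gamma> (fst p), snd p))"
          by (simp add: continuous_map_in_subtopology o_def)
        moreover have "bij_betw (\<lambda>w. k (\<gamma> t, w)) (sphere 0 1) {x \<in> topspace E. f x = \<gamma> t}" if t: "t \<in> {a..b}" for t
        proof (rule bij_betw_byWitness[where f' = "\<lambda>x. snd (h x)"])
          show "\<forall>w\<in>sphere 0 1. snd (h (k (\<gamma> t, w))) = w" using hk tU(2)[OF t] by simp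
          show "\<forall>x\<in>{x \<in> topspace E. f x = \<gamma> t}. k (\<gamma> t, snd (h x)) = x"
          proof
            fix x assume x: "x \<in> {x \<in> topspace E. f x = \<gamma> t}"
            then have "k (f x, snd (h x)) = x" using tU(2)[OF t] by (intro kh) auto
            then show "k (\<gamma> t, snd (h x)) = x" using x by simp
          qed
          show "(\<lambda>w. k (\<gamma> t, w)) ` sphere 0 1 \<subseteq> {x \<in> topspace E. f x = \<gamma> t}"
            using fk kE tU(2)[OF t] by auto
          show "(\<lambda>x. snd (h x)) ` {x \<in> topspace E. f x = \<gamma> t} \<subseteq> sphere 0 1"
            using h1 tU(2)[OF t] by auto
        qed
        ultimately show "\<exists>\<theta>. fibre_param E f \<gamma> {a..b} \<theta>"
          unfolding fibre_param_def by (intro exI[of _ "\<lambda>p. k (\<gamma> (fst p), snd p)"]) auto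
      qed
    qed
  qed simp
  then show ?thesis using that unfolding P_def by auto
qed

lemma compact_space_cylinder:
  "compact_space (prod_topology (top_of_set {0..1::real}) unit_circle)"
  by (simp add: compact_space_subtopology compact_Times)

lemma loop_eq_imp:
  fixes \<gamma> :: "real \<Rightarrow> 'b"
  assumes "inj_on \<gamma> {0..<1}" "\<gamma> 0 = \<gamma> 1" "s \<in> {0..1}" "t \<in> {0..1}" "\<gamma> s = \<gamma> t"
  shows "s = t \<or> (s = 0 \<and> t = 1) \<or> (s = 1 \<and> t = 0)"
proof -
  consider "s < 1" "t < 1" | "s < 1" "t = 1" | "s = 1" "t < 1" | "s = 1" "t = 1"
    using assms(3,4) by fastforce
  then show ?thesis
  proof cases
    case 1
    then show ?thesis using inj_onD[OF assms(1,5)] assms(3,4) by auto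
  next
    case 2
    then have "\<gamma> s = \<gamma> 0" using assms(2,5) by simp
    from inj_onD[OF assms(1) this] 2 assms(3) show ?thesis by auto
  next
    case 3
    then have "\<gamma> t = \<gamma> 0" using assms(2,5) by simp
    from inj_onD[OF assms(1) this] 3 assms(4) show ?thesis by auto
  qed auto
qed

lemma fibre_param_bundle_map:
  assumes "fibre_param E f \<gamma> A \<theta>" "t \<in> A" "w \<in> sphere 0 1"
  shows "\<theta> (t, w) \<in> topspace E" "f (\<theta> (t, w)) = \<gamma> t"
  using assms unfolding fibre_param_def bij_betw_def by blast+

lemma fibre_param_inj:
  assumes "fibre_param E f \<gamma> A \<theta>" "t \<in> A" "v \<in> sphere 0 1" "w \<in> sphere 0 1" "\<theta> (t, v) = \<theta> (t, w)"
  shows "v = w"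
  using assms unfolding fibre_param_def bij_betw_def inj_on_def by blast

lemma fibre_param_surj:
  assumes "fibre_param E f \<gamma> A \<theta>" "t \<in> A" "x \<in> topspace E" "f x = \<gamma> t"
  obtains w where "w \<in> sphere 0 1" "x = \<theta> (t, w)"
proof -
  have "x \<in> (\<lambda>w. \<theta> (t, w)) ` sphere 0 1"
    using assms unfolding fibre_param_def bij_betw_def by blast
  then show ?thesis using that by blast
qed

lemma fibre_param_onto:
  assumes "fibre_param E f \<gamma> {0..1} \<theta>" "continuous_map E B f" "\<gamma> ` {0..1} = topspace B"
  shows "\<theta> ` topspace (prod_topology (top_of_set {0..1}) unit_circle) = topspace E"
proof (intro equalityI subsetI)
  fix x assume "x \<in> \<theta> ` topspace (prod_topology (top_of_set {0..1}) unit_circle)"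
  then show "x \<in> topspace E" using fibre_param_bundle_map(1)[OF assms(1)] by auto
next
  fix x assume x: "x \<in> topspace E"
  then have "f x \<in> topspace B" using continuous_map_image_subset_topspace[OF assms(2)] by blast
  then obtain t where t: "t \<in> {0..1}" "f x = \<gamma> t" using assms(3) by blast
  obtain w where "w \<in> sphere 0 1" "x = \<theta> (t, w)" using fibre_param_surj[OF assms(1) t(1) x t(2)] .
  then show "x \<in> \<theta> ` topspace (prod_topology (top_of_set {0..1}) unit_circle)" using t by auto
qed

text \<open>As \<open>\<theta>\<close> closes up, it identifies the same points of the compact
  cylinder as the product of \<open>\<gamma>\<close> with the identity. Hence its target and the
  product bundle are the same quotient.\<close>

lemma trivial_circle_bundle_if_closed_param:
  fixes \<gamma> :: "real \<Rightarrow> 'b"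
  assumes "Hausdorff_space E" "Hausdorff_space B" and f: "continuous_map E B f"
    and \<gamma>: "continuous_map (top_of_set {0..1}) B \<gamma>" "\<gamma> 0 = \<gamma> 1" "inj_on \<gamma> {0..<1}" "\<gamma> ` {0..1} = topspace B"
    and \<theta>: "fibre_param E f \<gamma> {0..1} \<theta>" and closed: "\<And>w. w \<in> sphere 0 1 \<Longrightarrow> \<theta> (1, w) = \<theta> (0, w)"
  shows "trivial_circle_bundle E B f"
proof -
  let ?X = "prod_topology (top_of_set {0..1::real}) unit_circle"
  note onto = fibre_param_onto[OF \<theta> f \<gamma>(4)]
  have c\<theta>: "continuous_map ?X E \<theta>" using \<theta> by (simp add: fibre_param_def)
  have qm: "quotient_map ?X E \<theta>"
    by (rule continuous_imp_quotient_map[OF c\<theta> compact_space_cylinder assms(1) onto])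
  have I: "0 \<in> {0..1::real}" "1 \<in> {0..1::real}" by auto
  have key: "\<theta> (t, w) = \<theta> (s, v) \<longleftrightarrow> \<gamma> t = \<gamma> s \<and> w = v"
    if "t \<in> {0..1}" "s \<in> {0..1}" "w \<in> sphere 0 1" "v \<in> sphere 0 1" for t s w v
  proof -
    have "\<theta> (t, w) = \<theta> (s, w)" if "\<gamma> t = \<gamma> s"
    proof -
      from loop_eq_imp[OF \<gamma>(3,2) \<open>t \<in> _\<close> \<open>s \<in> _\<close> that] show ?thesis
        using closed[OF \<open>w \<in> _\<close>] by auto
    qed
    moreover have "\<gamma> t = \<gamma> s" if "\<theta> (t, w) = \<theta> (s, v)"
      using fibre_param_bundle_map(2)[OF \<theta> \<open>t \<in> _\<close> \<open>w \<in> _\<close>] fibre_param_bundle_map(2)[OF \<theta> \<open>s \<in> _\<close> \<open>v \<in> _\<close>] that by simp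
    ultimately show ?thesis
      using fibre_param_inj[OF \<theta> \<open>s \<in> _\<close> \<open>w \<in> _\<close> \<open>v \<in> _\<close>] by metis
  qed
  have cg: "continuous_map ?X (prod_topology B unit_circle) (\<lambda>p. ((\<gamma> \<circ> fst) p, snd p))"
    by (intro continuous_map_pairedI continuous_map_snd continuous_map_compose[OF continuous_map_fst \<gamma>(1)])
  obtain k where k: "continuous_map E (prod_topology B unit_circle) k"
    "\<And>p. p \<in> topspace ?X \<Longrightarrow> k (\<theta> p) = ((\<gamma> \<circ> fst) p, snd p)"
  proof (rule quotient_map_lift_exists[OF qm cg])
    fix p p' assume p: "p \<in> topspace ?X" "p' \<in> topspace ?X" "\<theta> p = \<theta> p'"
    obtain t w s v where *: "p = (t, w)" "p' = (s, v)" by fastforce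
    then have "t \<in> {0..1}" "s \<in> {0..1}" "w \<in> sphere 0 1" "v \<in> sphere 0 1" using p by auto
    from key[OF this] have "\<gamma> t = \<gamma> s \<and> w = v" using p(3) * by blast
    then show "((\<gamma> \<circ> fst) p, snd p) = ((\<gamma> \<circ> fst) p', snd p')" using * by simp
  qed (rule that)
  have k\<theta>: "k (\<theta> (t, w)) = (\<gamma> t, w)" if "t \<in> {0..1}" "w \<in> sphere 0 1" for t w
    using k(2)[of "(t, w)"] that by simp
  have ex: "\<exists>t w. t \<in> {0..1} \<and> w \<in> sphere 0 1 \<and> x = \<theta> (t, w)" if "x \<in> topspace E" for x
  proof -
    obtain p where p: "p \<in> topspace ?X" "x = \<theta> p" using \<open>x \<in> topspace E\<close> unfolding onto[symmetric] by blast
    obtain t w where "p = (t, w)" by fastforce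
    then have "t \<in> {0..1} \<and> w \<in> sphere 0 1 \<and> x = \<theta> (t, w)" using p by auto
    then show ?thesis by blast
  qed
  have "homeomorphic_map E (prod_topology B unit_circle) k"
  proof (rule continuous_imp_homeomorphic_map[OF k(1)])
    show "compact_space E"
      using image_compactin[OF compact_space_cylinder[unfolded compact_space_def] c\<theta>]
      by (simp only: onto compact_space_def)
    show "Hausdorff_space (prod_topology B unit_circle)"
      using assms(2) Hausdorff_unit_circle by (simp add: Hausdorff_space_prod_topology)
    show "k ` topspace E = topspace (prod_topology B unit_circle)"
    proof (intro equalityI subsetI)
      fix y assume "y \<in> topspace (prod_topology B unit_circle)"
      then obtain b w where y: "y = (b, w)" "b \<in> topspace B" "w \<in> sphere 0 1" by auto
      then obtain t where t: "t \<in> {0..1}" "b = \<gamma> t" using \<gamma>(4) by blast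
      then have "y = k (\<theta> (t, w))" using k\<theta> y by simp
      then show "y \<in> k ` topspace E" using fibre_param_bundle_map(1)[OF \<theta> t(1) y(3)] by blast
    qed (use continuous_map_image_subset_topspace[OF k(1)] in blast)
    show "inj_on k (topspace E)"
    proof (rule inj_onI)
      fix x y assume "x \<in> topspace E" "y \<in> topspace E" and eq: "k x = k y"
      then obtain t w s v where *: "t \<in> {0..1}" "w \<in> sphere 0 1" "x = \<theta> (t, w)"
          "s \<in> {0..1}" "v \<in> sphere 0 1" "y = \<theta> (s, v)" using ex by metis
      then show "x = y" using eq k\<theta> key by simp
    qed
  qed
  moreover have "fst (k x) = f x" if x: "x \<in> topspace E" for x
  proof -
    obtain t w where "t \<in> {0..1}" "w \<in> sphere 0 1" "x = \<theta> (t, w)" using ex[OF x] by blast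
    then show ?thesis using k\<theta> fibre_param_bundle_map(2)[OF \<theta>] by simp
  qed
  ultimately show ?thesis unfolding trivial_circle_bundle_def by blast
qed

section \<open>The Klein bottle from a twisted parametrization\<close>

definition cnj_pow :: "int \<Rightarrow> complex \<Rightarrow> complex" where
  "cnj_pow k w = (if even k then w else cnj w)"

lemma cnj_pow_add: "cnj_pow (j + k) w = cnj_pow j (cnj_pow k w)"
  by (auto simp: cnj_pow_def)

lemma cnj_pow_0 [simp]: "cnj_pow 0 w = w" by (simp add: cnj_pow_def)

lemma cnj_pow_twice [simp]: "cnj_pow k (cnj_pow k w) = w" by (simp add: cnj_pow_def)

lemma norm_cnj_pow [simp]: "norm (cnj_pow k w) = norm w" by (simp add: cnj_pow_def)

lemma continuous_on_cnj_pow: "continuous_on A (cnj_pow k)"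
  unfolding cnj_pow_def by (cases "even k") (auto intro!: continuous_intros)

lemma klein_orbit_eq: "klein_orbit (t, w) = range (\<lambda>k::int. (t + of_int k, cnj_pow k w))"
  by (simp add: klein_orbit_def cnj_pow_def)

lemma klein_orbit_shift: "klein_orbit (t + of_int k, cnj_pow k w) = klein_orbit (t, w)"
proof -
  have sub: "klein_orbit (t + of_int k, cnj_pow k w) \<subseteq> klein_orbit (t, w)" for t k w
  proof
    fix x assume "x \<in> klein_orbit (t + of_int k, cnj_pow k w)"
    then obtain j where "x = (t + of_int k + of_int j, cnj_pow j (cnj_pow k w))"
      unfolding klein_orbit_eq by blast
    then have "x = (t + of_int (j + k), cnj_pow (j + k) w)" by (simp add: cnj_pow_add)
    then show "x \<in> klein_orbit (t, w)" unfolding klein_orbit_eq by blast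
  qed
  have "klein_orbit (t, w) \<subseteq> klein_orbit (t + of_int k, cnj_pow k w)"
    using sub[of "t + of_int k" "- k" "cnj_pow k w"] by (simp flip: cnj_pow_add)
  then show ?thesis using sub by blast
qed

lemma klein_orbit_eqD:
  assumes "klein_orbit (t, w) = klein_orbit (s, v)"
  obtains k :: int where "s = t + of_int k" "v = cnj_pow k w"
proof -
  have "(s, v) \<in> klein_orbit (s, v)" unfolding klein_orbit_eq by (rule range_eqI[of _ _ 0]) simp
  then have "(s, v) \<in> klein_orbit (t, w)" using assms by simp
  then show ?thesis using that unfolding klein_orbit_eq by auto
qed

lemma topspace_klein_bottle: "topspace klein_bottle = klein_orbit ` (UNIV \<times> sphere 0 1)"
  by (simp add: klein_bottle_def topspace_quotient_topology)

lemma compact_space_klein_bottle: "compact_space klein_bottle"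
proof -
  have c: "continuous_map (prod_topology euclideanreal unit_circle) klein_bottle klein_orbit"
    unfolding klein_bottle_def by (rule quotient_imp_continuous_map[OF quotient_map_quotient_topology])
  have "compactin (prod_topology euclideanreal unit_circle) ({0..1} \<times> sphere 0 1)"
    by (simp add: compactin_Times compactin_subtopology)
  from image_compactin[OF this c] have "compactin klein_bottle (klein_orbit ` ({0..1} \<times> sphere 0 1))" .
  moreover have "klein_orbit ` ({0..1} \<times> sphere 0 1) = topspace klein_bottle"
    unfolding topspace_klein_bottle
  proof (intro equalityI subsetI)
    fix z assume "z \<in> klein_orbit ` (UNIV \<times> sphere 0 1)"
    then obtain t w where z: "z = klein_orbit (t, w)" "norm w = 1" by auto
    have "z = klein_orbit (frac t, cnj_pow (- \<lfloor>t\<rfloor>) w)"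
      using klein_orbit_shift[of t "- \<lfloor>t\<rfloor>" w] z by (simp add: frac_def)
    moreover have "frac t \<in> {0..1}" using frac_lt_1[of t] by (simp add: less_imp_le)
    ultimately show "z \<in> klein_orbit ` ({0..1} \<times> sphere 0 1)"
      using z(2) by (intro image_eqI[of _ _ "(frac t, cnj_pow (- \<lfloor>t\<rfloor>) w)"]) simp_all
  qed auto
  ultimately show ?thesis by (simp add: compact_space_def)
qed

text \<open>\<open>\<theta>\<close> extends from the unit interval to the line so that it is
  constant on Klein bottle orbits, and \<open>twist\<close> is the matching condition at the
  integers. The extension separates orbits, and compactness makes the induced injection an
  embedding.\<close>

lemma klein_bottle_embedding_if_twisted_param:
  fixes \<gamma> :: "real \<Rightarrow> 'b"
  assumes "Hausdorff_space E" and f: "continuous_map E B f"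
    and \<gamma>: "inj_on \<gamma> {0..<1}" "\<gamma> 0 = \<gamma> 1" "\<gamma> ` {0..1} = topspace B"
    and \<theta>: "fibre_param E f \<gamma> {0..1} \<theta>" and twist: "\<And>w. w \<in> sphere 0 1 \<Longrightarrow> \<theta> (1, w) = \<theta> (0, cnj w)"
  shows "\<exists>e. embedding_map klein_bottle E e \<and> e ` topspace klein_bottle = topspace E"
proof -
  let ?X = "prod_topology (top_of_set {0..1::real}) unit_circle"
  let ?R = "prod_topology euclideanreal unit_circle"
  have c\<theta>: "continuous_map ?X E \<theta>" using \<theta> by (simp add: fibre_param_def)
  define e0 where "e0 p = \<theta> (frac (fst p), cnj_pow \<lfloor>fst p\<rfloor> (snd p))" for p
  define T where "T m = {real_of_int m..real_of_int m + 1} \<times> (sphere 0 1 :: complex set)" for m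
  define g where "g m p = \<theta> (fst p - real_of_int m, cnj_pow m (snd p))" for m p
  have ge: "g m p = e0 p" if "p \<in> T m" for m p
  \<comment> \<open>At the right end of the strip the integer part is already \<open>m + 1\<close>:
    \<open>e0\<close> evaluates \<open>\<theta>\<close> at 0 and \<open>g m\<close> evaluates it at
    1, and \<open>twist\<close> reconciles the two.\<close>
  proof (cases "fst p = of_int m + 1")
    case True
    then have "\<lfloor>fst p\<rfloor> = m + 1" by linarith
    moreover have "frac (fst p) = 0" using True by (simp add: frac_def)
    ultimately have "e0 p = \<theta> (0, cnj_pow (m + 1) (snd p))" by (simp only: e0_def)
    moreover have "cnj_pow (m + 1) (snd p) = cnj (cnj_pow m (snd p))"
      by (simp add: cnj_pow_def)
    ultimately show ?thesis using twist[of "cnj_pow m (snd p)"] that True by (auto simp: g_def T_def)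
  next
    case False
    then have "\<lfloor>fst p\<rfloor> = m" using that by (auto simp: T_def floor_eq_iff)
    then show ?thesis by (simp add: g_def e0_def frac_def)
  qed
  have c0: "continuous_map ?R E e0"
  proof (rule pasting_lemma_locally_finite[where I = UNIV and T = T and f = g])
    fix p assume p: "p \<in> topspace ?R"
    let ?V = "{fst p - 1<..<fst p + 1} \<times> (sphere 0 1 :: complex set)"
    have "openin ?R ?V" by (simp add: openin_prod_Times_iff openin_subtopology_self)
    moreover have "p \<in> ?V" using p by (cases p) auto
    moreover have "{m \<in> UNIV. T m \<inter> ?V \<noteq> {}} \<subseteq> {\<lfloor>fst p\<rfloor> - 3..\<lfloor>fst p\<rfloor> + 3}"
    proof
      fix m assume "m \<in> {m \<in> UNIV. T m \<inter> ?V \<noteq> {}}"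
      then obtain t where "real_of_int m \<le> t" "t \<le> real_of_int m + 1" "fst p - 1 < t" "t < fst p + 1"
        by (auto simp: T_def)
      then have "real_of_int m < fst p + 1" "fst p < real_of_int m + 2" by linarith+
      then show "m \<in> {\<lfloor>fst p\<rfloor> - 3..\<lfloor>fst p\<rfloor> + 3}" by (simp, linarith)
    qed
    ultimately show "\<exists>V. openin ?R V \<and> p \<in> V \<and> finite {m \<in> UNIV. T m \<inter> V \<noteq> {}}"
      using finite_subset by blast
  next
    fix m :: int
    show "closedin ?R (T m)"
      unfolding T_def by (simp add: closedin_prod_Times_iff)
    have eq: "subtopology ?R (T m) = top_of_set (T m)"
      unfolding T_def subtopology_Times by (simp add: subtopology_subtopology)
    have "continuous_map (top_of_set (T m)) ?X (\<lambda>p. (fst p - real_of_int m, cnj_pow m (snd p)))"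
    proof -
      have "continuous_on (T m) (\<lambda>p. (fst p - real_of_int m, cnj_pow m (snd p)))"
        by (intro continuous_intros continuous_on_compose2[OF continuous_on_cnj_pow[of UNIV m]]) auto
      then show ?thesis by (auto simp: T_def)
    qed
    from continuous_map_compose[OF this c\<theta>] show "continuous_map (subtopology ?R (T m)) E (g m)"
      unfolding eq by (simp add: g_def[abs_def] o_def)
  next
    fix i j p assume "p \<in> topspace ?R \<inter> T i \<inter> T j"
    then show "g i p = g j p" using ge[of p i] ge[of p j] by simp
  next
    fix p assume p: "p \<in> topspace ?R"
    have "real_of_int \<lfloor>fst p\<rfloor> \<le> fst p" "fst p \<le> real_of_int \<lfloor>fst p\<rfloor> + 1" by linarith+
    then have "p \<in> T \<lfloor>fst p\<rfloor>" using p by (cases p) (simp add: T_def)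
    then show "\<exists>j. j \<in> UNIV \<and> p \<in> T j \<and> e0 p = g j p" using ge by fastforce
  qed
  have e0_orbit: "e0 p = e0 p'" if eq: "klein_orbit p = klein_orbit p'" for p p'
  proof -
    obtain t w s v where p: "p = (t, w)" "p' = (s, v)" by fastforce
    obtain k where "s = t + of_int k" "v = cnj_pow k w"
      using klein_orbit_eqD[OF eq[unfolded p]] .
    then show ?thesis by (simp add: p e0_def frac_def cnj_pow_add)
  qed
  have qk: "quotient_map ?R klein_bottle klein_orbit"
    unfolding klein_bottle_def by (rule quotient_map_quotient_topology)
  obtain e where e: "continuous_map klein_bottle E e" "e ` topspace klein_bottle = e0 ` topspace ?R"
      "\<And>p. p \<in> topspace ?R \<Longrightarrow> e (klein_orbit p) = e0 p"
    by (rule quotient_map_lift_exists[OF qk c0 e0_orbit]) (assumption, rule that)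
  have fr: "frac t \<in> {0..1}" "frac t \<in> {0..<1}" for t :: real
    using frac_lt_1[of t] by (auto simp: less_imp_le)
  have e0_im: "e0 ` topspace ?R = topspace E"
  proof (intro equalityI subsetI)
    fix x assume "x \<in> e0 ` topspace ?R"
    then show "x \<in> topspace E" using fibre_param_bundle_map(1)[OF \<theta> fr(1)] by (auto simp: e0_def)
  next
    fix x assume x: "x \<in> topspace E"
    then obtain t w where t: "t \<in> {0..1}" "w \<in> sphere 0 1" "x = \<theta> (t, w)"
      using fibre_param_onto[OF \<theta> f \<gamma>(3)] by fastforce
    have "(t, w) \<in> T 0" using t by (simp add: T_def)
    then have "x = e0 (t, w)" using ge[of "(t, w)" 0] t(3) by (simp add: g_def)
    then show "x \<in> e0 ` topspace ?R" using t(2) by auto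
  qed
  have "embedding_map klein_bottle E e"
  proof (rule continuous_imp_embedding_map[OF e(1) compact_space_klein_bottle assms(1)])
    show "inj_on e (topspace klein_bottle)"
    proof (rule inj_onI)
      fix y z assume "y \<in> topspace klein_bottle" "z \<in> topspace klein_bottle" and eq: "e y = e z"
      then obtain t w s v where y: "y = klein_orbit (t, w)" "w \<in> sphere 0 1"
        and z: "z = klein_orbit (s, v)" "v \<in> sphere 0 1"
        unfolding topspace_klein_bottle by auto
      have eq0: "e0 (t, w) = e0 (s, v)" using eq e(3)[of "(t, w)"] e(3)[of "(s, v)"] y z by simp
      have wS: "cnj_pow k w \<in> sphere 0 1" and vS: "cnj_pow k v \<in> sphere 0 1" for k
        using y z by auto
      have "\<gamma> (frac t) = \<gamma> (frac s)"
      proof -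
        have "f (e0 (t, w)) = \<gamma> (frac t)"
          unfolding e0_def fst_conv snd_conv by (rule fibre_param_bundle_map(2)[OF \<theta> fr(1) wS])
        moreover have "f (e0 (s, v)) = \<gamma> (frac s)"
          unfolding e0_def fst_conv snd_conv by (rule fibre_param_bundle_map(2)[OF \<theta> fr(1) vS])
        ultimately show ?thesis using eq0 by simp
      qed
      then have fts: "frac t = frac s" by (rule inj_onD[OF \<gamma>(1) _ fr(2) fr(2)])
      have "cnj_pow \<lfloor>t\<rfloor> w = cnj_pow \<lfloor>s\<rfloor> v"
      proof (rule fibre_param_inj[OF \<theta> fr(1)[of t] wS vS])
        show "\<theta> (frac t, cnj_pow \<lfloor>t\<rfloor> w) = \<theta> (frac t, cnj_pow \<lfloor>s\<rfloor> v)"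
          using eq0 unfolding e0_def fst_conv snd_conv fts .
      qed
      then have "v = cnj_pow \<lfloor>s\<rfloor> (cnj_pow \<lfloor>t\<rfloor> w)" by simp
      moreover define k where "k = \<lfloor>s\<rfloor> - \<lfloor>t\<rfloor>"
      ultimately have v: "v = cnj_pow k w"
        by (simp add: cnj_pow_def split: if_splits)
      have "s = t + of_int k" using fts by (simp add: frac_def k_def)
      then show "y = z" unfolding y(1) z(1) v by (simp only: klein_orbit_shift)
    qed
  qed
  then show ?thesis using e(2) unfolding e0_im by (intro exI[of _ e] conjI)
qed

theorem circle_bundle_over_loop:
  fixes \<gamma> :: "real \<Rightarrow> 'b"
  assumes "Hausdorff_space E" "Hausdorff_space B" and bun: "circle_bundle E B f"
    and \<gamma>: "continuous_map (top_of_set {0..1}) B \<gamma>" "\<gamma> 0 = \<gamma> 1" "inj_on \<gamma> {0..<1}" "\<gamma> ` {0..1} = topspace B"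
  shows "trivial_circle_bundle E B f \<or>
     (\<exists>e. embedding_map klein_bottle E e \<and> e ` topspace klein_bottle = topspace E)"
proof -
  let ?X = "prod_topology (top_of_set {0..1::real}) unit_circle"
  have f: "continuous_map E B f" using bun by (simp add: circle_bundle_def)
  obtain \<theta> where \<theta>: "fibre_param E f \<gamma> {0..1} \<theta>"
    using circle_bundle_fibre_param[OF assms(1) bun \<gamma>(1)] .
  have I: "0 \<in> {0..1::real}" "1 \<in> {0..1::real}" by auto
  have c\<theta>: "continuous_map ?X E \<theta>" using \<theta> by (simp add: fibre_param_def)
  obtain \<phi> where \<phi>: "continuous_on (sphere 0 1) \<phi>" "bij_betw \<phi> (sphere 0 1) (sphere 0 1)"
    "\<And>w. w \<in> sphere 0 1 \<Longrightarrow> \<theta> (0, \<phi> w) = \<theta> (1, w)"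
  proof (rule circle_parametrizations_transition[OF assms(1)])
    show "continuous_map unit_circle E (\<lambda>w. \<theta> (1, w))" "continuous_map unit_circle E (\<lambda>w. \<theta> (0, w))"
      using c\<theta> continuous_map_slice I by blast+
    have "bij_betw (\<lambda>w. \<theta> (t, w)) (sphere 0 1) {x \<in> topspace E. f x = \<gamma> t}" if "t \<in> {0..1}" for t
      using \<theta> that unfolding fibre_param_def by blast
    from this[OF I(1)] this[OF I(2)]
    show "bij_betw (\<lambda>w. \<theta> (1, w)) (sphere 0 1) {x \<in> topspace E. f x = \<gamma> 0}"
      "bij_betw (\<lambda>w. \<theta> (0, w)) (sphere 0 1) {x \<in> topspace E. f x = \<gamma> 0}"
      unfolding \<gamma>(2) by simp_all
  qed (rule that)
  have im\<phi>: "\<phi> \<in> sphere 0 1 \<rightarrow> sphere 0 1" and inj\<phi>: "inj_on \<phi> (sphere 0 1)"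
    using \<phi>(2) by (auto simp: bij_betw_def)
  obtain \<Psi> where \<Psi>: "continuous_on ({0..1} \<times> sphere 0 1) (\<lambda>p. \<Psi> (fst p) (snd p))"
    "\<And>t. t \<in> {0..1::real} \<Longrightarrow> bij_betw (\<Psi> t) (sphere 0 1) (sphere 0 1)"
    "(\<forall>w. norm w = 1 \<longrightarrow> \<Psi> 0 w = \<phi> w) \<or> (\<forall>w. norm w = 1 \<longrightarrow> \<Psi> 0 w = \<phi> (cnj w))"
    "\<And>w. norm w = 1 \<Longrightarrow> \<Psi> 1 w = w"
    by (rule circle_injection_isotopy[OF \<phi>(1) im\<phi> inj\<phi>]) (rule that)
  \<comment> \<open>The isotopy is spread over the loop. At time 1 nothing changes; at time 0 the
    gluing map \<open>\<phi>\<close>, possibly after conjugation, is absorbed, so that the remaining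
    gluing is the identity or conjugation.\<close>
  define \<theta>' where "\<theta>' p = \<theta> (fst p, \<Psi> (fst p) (snd p))" for p
  have \<theta>': "fibre_param E f \<gamma> {0..1} \<theta>'"
    unfolding fibre_param_def
  proof (intro conjI ballI)
    have "continuous_on ({0..1} \<times> sphere 0 1) (\<lambda>p. (fst p, \<Psi> (fst p) (snd p)))"
      by (intro continuous_intros \<Psi>(1))
    moreover have "\<Psi> t w \<in> sphere 0 1" if "t \<in> {0..1}" "w \<in> sphere 0 1" for t w
      using bij_betw_imp_surj_on[OF \<Psi>(2)[OF that(1)]] that(2) by blast
    ultimately have "continuous_map ?X ?X (\<lambda>p. (fst p, \<Psi> (fst p) (snd p)))" by auto
    from continuous_map_compose[OF this c\<theta>] show "continuous_map ?X E \<theta>'"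
      by (simp add: \<theta>'_def[abs_def] o_def)
    fix t :: real assume t: "t \<in> {0..1}"
    have "bij_betw (\<lambda>w. \<theta> (t, w)) (sphere 0 1) {x \<in> topspace E. f x = \<gamma> t}"
      using \<theta> t by (simp add: fibre_param_def)
    from bij_betw_trans[OF \<Psi>(2)[OF t] this]
    show "bij_betw (\<lambda>w. \<theta>' (t, w)) (sphere 0 1) {x \<in> topspace E. f x = \<gamma> t}"
      by (simp add: \<theta>'_def o_def)
  qed
  from \<Psi>(3) show ?thesis
  proof
    assume 0: "\<forall>w. norm w = 1 \<longrightarrow> \<Psi> 0 w = \<phi> w"
    have "\<theta>' (1, w) = \<theta>' (0, w)" if "w \<in> sphere 0 1" for w
      using \<phi>(3)[OF that] \<Psi>(4)[of w] 0 that by (simp add: \<theta>'_def)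
    then show ?thesis
      using trivial_circle_bundle_if_closed_param[OF assms(1,2) f \<gamma> \<theta>'] by blast
  next
    assume 0: "\<forall>w. norm w = 1 \<longrightarrow> \<Psi> 0 w = \<phi> (cnj w)"
    have "\<theta>' (1, w) = \<theta>' (0, cnj w)" if "w \<in> sphere 0 1" for w
      using \<phi>(3)[OF that] \<Psi>(4)[of w] 0 that by (simp add: \<theta>'_def)
    then show ?thesis
      using klein_bottle_embedding_if_twisted_param[OF assms(1) f \<gamma>(3,2,4) \<theta>'] by blast
  qed
qed

subsection \<open>Seifert fibrations over the projective plane\<close>

text \<open>For multiplicity 1 the model projection is \<open>z\<close> times a power of
  \<open>w\<close>. As \<open>w\<close> has modulus 1, multiplying the disc coordinate by the
  opposite power stays in the disc and undoes the twist, so the fibred solid torus is a product with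
  circle coordinate \<open>w\<close>.\<close>

lemma seifert_regular_chart:
  assumes seif: "seifert_fibration X B \<mu> f" and b: "b \<in> topspace B" "\<mu> b = 1"
  obtains U h where "openin B U" "b \<in> U"
    "homeomorphic_map (preimage_space X f U) (prod_topology (subtopology B U) unit_circle) h"
    "\<And>x. x \<in> topspace X \<Longrightarrow> f x \<in> U \<Longrightarrow> fst (h x) = f x"
proof -
  have f: "continuous_map X B f" using seif by (simp add: seifert_fibration_def)
  from seif have "\<forall>b \<in> topspace B. \<exists>\<beta> U g h.
        coprime (int (\<mu> b)) \<beta> \<and> openin B U \<and> b \<in> U \<and>
        homeomorphic_map (subtopology B U) unit_disc g \<and> g b = 0 \<and>
        homeomorphic_map (preimage_space X f U) (prod_topology unit_disc unit_circle) h \<and>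
        (\<forall>x \<in> topspace X. f x \<in> U \<longrightarrow> g (f x) = fibred_torus_proj (\<mu> b) \<beta> (h x))"
    unfolding seifert_fibration_def by (rule conjunct2)
  from bspec[OF this b(1)] obtain \<beta> U g h where
      all: "coprime (int (\<mu> b)) \<beta> \<and> openin B U \<and> b \<in> U \<and>
        homeomorphic_map (subtopology B U) unit_disc g \<and> g b = 0 \<and>
        homeomorphic_map (preimage_space X f U) (prod_topology unit_disc unit_circle) h \<and>
        (\<forall>x \<in> topspace X. f x \<in> U \<longrightarrow> g (f x) = fibred_torus_proj (\<mu> b) \<beta> (h x))"
    by (elim exE)
  then have U: "openin B U" "b \<in> U" and g: "homeomorphic_map (subtopology B U) unit_disc g"
    and h: "homeomorphic_map (preimage_space X f U) (prod_topology unit_disc unit_circle) h"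
    and gf: "\<And>x. x \<in> topspace X \<Longrightarrow> f x \<in> U \<Longrightarrow> g (f x) = fibred_torus_proj 1 \<beta> (h x)"
    using b(2) by simp_all
  have UB: "U \<subseteq> topspace B" using U openin_subset by blast
  obtain k where k: "homeomorphic_maps (preimage_space X f U) (prod_topology unit_disc unit_circle) h k"
    using h homeomorphic_map_maps by blast
  have hc: "continuous_map (preimage_space X f U) (prod_topology unit_disc unit_circle) h"
    and kc: "continuous_map (prod_topology unit_disc unit_circle) (preimage_space X f U) k"
    and kh: "\<And>x. x \<in> topspace X \<Longrightarrow> f x \<in> U \<Longrightarrow> k (h x) = x"
    and hk: "\<And>z w. z \<in> ball 0 1 \<Longrightarrow> w \<in> sphere 0 1 \<Longrightarrow> h (k (z, w)) = (z, w)"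
    using k by (auto simp: homeomorphic_maps_def)
  have gc: "continuous_map (subtopology B U) unit_disc g"
    by (rule homeomorphic_imp_continuous_map[OF g])
  have ginj: "inj_on g U"
    using homeomorphic_imp_injective_map[OF g] UB by (simp add: Int_absorb1)
  define h' where "h' x = (f x, snd (h x))" for x
  define k' where "k' p = k (g (fst p) * snd p powi (- \<beta>), snd p)" for p
  have powi1: "w powi (- \<beta>) * w powi \<beta> = 1" if "w \<in> sphere 0 1" for w :: complex
  proof -
    have "w \<noteq> 0" using that by auto
    then show ?thesis by (simp add: power_int_minus)
  qed
  have npow: "norm (w powi j) = 1" if "w \<in> sphere 0 1" for w :: complex and j
    using that by (simp add: norm_power_int)
  let ?P = "preimage_space X f U" and ?Q = "prod_topology (subtopology B U) unit_circle"
  have "continuous_map ?P (subtopology B U) f"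
    using continuous_map_from_subtopology[OF f] by (auto simp: continuous_map_in_subtopology)
  moreover have "continuous_map ?P unit_circle (snd \<circ> h)"
    by (rule continuous_map_compose[OF hc continuous_map_snd])
  ultimately have h'c: "continuous_map ?P ?Q h'"
    unfolding h'_def[abs_def] by (intro continuous_map_pairedI) (simp_all add: o_def)
  have gd: "g u \<in> ball 0 1" if "u \<in> U" for u
  proof -
    have "u \<in> topspace (subtopology B U)" using that UB by auto
    then have "g u \<in> topspace unit_disc"
      using continuous_map_image_subset_topspace[OF gc] by (meson image_subset_iff)
    then show ?thesis by simp
  qed
  have "continuous_map ?Q euclidean (\<lambda>p. g (fst p) * snd p powi (- \<beta>))"
  proof -
    have "continuous_map ?Q (prod_topology unit_disc unit_circle) (\<lambda>p. ((g \<circ> fst) p, snd p))"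
      by (rule continuous_map_pairedI[OF continuous_map_compose[OF continuous_map_fst gc] continuous_map_snd])
    moreover have "continuous_map (prod_topology unit_disc unit_circle) euclidean (\<lambda>p. fst p * snd p powi (- \<beta>))"
    proof -
      have "continuous_on (ball 0 1 \<times> sphere 0 1) (\<lambda>p::complex \<times> complex. fst p * snd p powi (- \<beta>))"
        by (intro continuous_intros) auto
      then show ?thesis by simp
    qed
    ultimately have "continuous_map ?Q euclidean ((\<lambda>p. fst p * snd p powi (- \<beta>)) \<circ> (\<lambda>p. ((g \<circ> fst) p, snd p)))"
      by (rule continuous_map_compose)
    then show ?thesis by (simp add: o_def)
  qed
  moreover have "g (fst p) * snd p powi (- \<beta>) \<in> ball 0 1" if "p \<in> topspace ?Q" for p
  proof -
    have "fst p \<in> U" "snd p \<in> sphere 0 1" using that by (auto simp: mem_Times_iff)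
    then show ?thesis using gd[of "fst p"] npow by (simp add: norm_mult)
  qed
  ultimately have "continuous_map ?Q unit_disc (\<lambda>p. g (fst p) * snd p powi (- \<beta>))"
    by (auto simp: continuous_map_in_subtopology)
  from continuous_map_compose[OF continuous_map_pairedI[OF this continuous_map_snd] kc]
  have k'c: "continuous_map ?Q ?P k'" by (simp add: k'_def[abs_def] o_def)
  have "homeomorphic_maps ?P ?Q h' k'"
    unfolding homeomorphic_maps_def
  proof (intro conjI ballI h'c k'c)
    fix x assume "x \<in> topspace ?P"
    then have x: "x \<in> topspace X" "f x \<in> U" by auto
    obtain z w where zw: "h x = (z, w)" by fastforce
    have "h x \<in> topspace (prod_topology unit_disc unit_circle)"
      using continuous_map_image_subset_topspace[OF hc] x by (simp add: image_subset_iff)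
    then have w: "w \<in> sphere 0 1" by (simp add: zw)
    have "g (f x) = z * w powi \<beta>" using gf[OF x] zw by (simp add: fibred_torus_proj_def)
    then have "k' (h' x) = k (z * (w powi (- \<beta>) * w powi \<beta>), w)"
      by (simp add: k'_def h'_def zw mult_ac)
    then show "k' (h' x) = x" using powi1[OF w] kh[OF x] zw by simp
  next
    fix p assume p: "p \<in> topspace ?Q"
    obtain u w where uw: "p = (u, w)" by fastforce
    have u: "u \<in> U" and w: "w \<in> sphere 0 1" using p uw by auto
    have "norm (g u * w powi (- \<beta>)) < 1" using gd[OF u] npow[OF w] by (simp add: norm_mult)
    then have hkp: "h (k' p) = (g u * w powi (- \<beta>), w)" using hk[of "g u * w powi (- \<beta>)" w] w by (simp add: k'_def uw)
    have "k' p \<in> topspace ?P"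
      using continuous_map_image_subset_topspace[OF k'c] p by (meson image_subset_iff)
    then have k'p: "k' p \<in> topspace X" "f (k' p) \<in> U" by auto
    have "g (f (k' p)) = g u * (w powi (- \<beta>) * w powi \<beta>)"
      using gf[OF k'p] hkp by (simp add: fibred_torus_proj_def mult.assoc)
    then have "f (k' p) = u" using powi1[OF w] inj_onD[OF ginj _ k'p(2) u] by simp
    then show "h' (k' p) = p" using hkp by (simp add: h'_def uw)
  qed
  then have "homeomorphic_map ?P ?Q h'" using homeomorphic_map_maps by blast
  then show ?thesis by (rule that[OF U]) (simp add: h'_def)
qed

lemma seifert_fibration_restrict_circle_bundle:
  assumes seif: "seifert_fibration X B \<mu> f" and C: "C \<subseteq> topspace B" "\<And>b. b \<in> C \<Longrightarrow> \<mu> b = 1"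
  shows "circle_bundle (preimage_space X f C) (subtopology B C) f"
  unfolding circle_bundle_def
proof (intro conjI ballI)
  have f: "continuous_map X B f" using seif by (simp add: seifert_fibration_def)
  then show "continuous_map (preimage_space X f C) (subtopology B C) f"
    using continuous_map_from_subtopology[OF f] by (auto simp: continuous_map_in_subtopology)
  fix b assume "b \<in> topspace (subtopology B C)"
  then have b: "b \<in> topspace B" "b \<in> C" by auto
  obtain U h where U: "openin B U" "b \<in> U"
    and h: "homeomorphic_map (preimage_space X f U) (prod_topology (subtopology B U) unit_circle) h"
    and fh: "\<And>x. x \<in> topspace X \<Longrightarrow> f x \<in> U \<Longrightarrow> fst (h x) = f x"
    using seifert_regular_chart[OF seif b(1) C(2)[OF b(2)]] by blast
  let ?S = "{x \<in> topspace X. f x \<in> C}"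
  let ?P = "preimage_space X f U" and ?Q = "prod_topology (subtopology B U) unit_circle"
  have him: "h ` (topspace ?P \<inter> ?S) = topspace ?Q \<inter> (C \<times> UNIV)"
  proof -
    have surj: "h ` topspace ?P = topspace ?Q" by (rule homeomorphic_imp_surjective_map[OF h])
    have iff: "x \<in> ?S \<longleftrightarrow> h x \<in> C \<times> UNIV" if "x \<in> topspace ?P" for x
    proof -
      have "x \<in> topspace X" "fst (h x) = f x" using fh[of x] that by auto
      then show ?thesis by (simp add: mem_Times_iff)
    qed
    show ?thesis
    proof (intro equalityI subsetI)
      fix y assume "y \<in> h ` (topspace ?P \<inter> ?S)"
      then obtain x where x: "y = h x" "x \<in> topspace ?P" "x \<in> ?S" by (elim imageE IntE)
      have "h x \<in> topspace ?Q" unfolding surj[symmetric] using x(2) by (rule imageI)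
      moreover have "h x \<in> C \<times> UNIV" using iff[OF x(2)] x(3) by (rule iffD1)
      ultimately show "y \<in> topspace ?Q \<inter> (C \<times> UNIV)" unfolding x(1) by (rule IntI)
    next
      fix y assume y: "y \<in> topspace ?Q \<inter> (C \<times> UNIV)"
      then have "y \<in> h ` topspace ?P" unfolding surj by (rule IntD1)
      then obtain x where x: "y = h x" "x \<in> topspace ?P" by (elim imageE)
      have "h x \<in> C \<times> UNIV" using y unfolding x(1) by (rule IntD2)
      then have "x \<in> ?S" using iff[OF x(2)] by (rule rev_iffD2)
      then show "y \<in> h ` (topspace ?P \<inter> ?S)" unfolding x(1) using x(2) by (intro imageI IntI)
    qed
  qed
  have hs: "homeomorphic_map (subtopology ?P ?S) (subtopology ?Q (C \<times> UNIV)) h"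
    by (rule homeomorphic_map_subtopologies[OF h him])
  have e1: "subtopology ?P ?S = preimage_space (preimage_space X f C) f (C \<inter> U)"
  proof -
    have "{x \<in> topspace X. f x \<in> U} \<inter> ?S = ?S \<inter> {x \<in> topspace (preimage_space X f C). f x \<in> C \<inter> U}"
      by (intro equalityI subsetI; simp)
    then show ?thesis by (simp only: subtopology_subtopology)
  qed
  have e2: "subtopology ?Q (C \<times> UNIV) = prod_topology (subtopology (subtopology B C) (C \<inter> U)) unit_circle"
    unfolding subtopology_Times by (simp add: subtopology_subtopology Int_ac)
  show "\<exists>U h. openin (subtopology B C) U \<and> b \<in> U \<and>
        homeomorphic_map (preimage_space (preimage_space X f C) f U) (prod_topology (subtopology (subtopology B C) U) unit_circle) h \<and>
        (\<forall>x \<in> topspace (preimage_space X f C). f x \<in> U \<longrightarrow> fst (h x) = f x)"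
  proof (intro exI conjI ballI impI)
    show "openin (subtopology B C) (C \<inter> U)" using U(1) by (rule openin_subtopology_Int2)
    show "b \<in> C \<inter> U" using U b by blast
    show "homeomorphic_map (preimage_space (preimage_space X f C) f (C \<inter> U))
       (prod_topology (subtopology (subtopology B C) (C \<inter> U)) unit_circle) h"
      using hs unfolding e1 e2 .
    show "fst (h x) = f x" if "x \<in> topspace (preimage_space X f C)" "f x \<in> C \<inter> U" for x
      using fh[of x] that by auto
  qed
qed

text \<open>A continuous injection of an interval is monotone, and \<open>d\<close> records its
  direction. It serves to compare the orientations that two coordinates give to a fibre.\<close>

lemma injective_sign:
  fixes A :: "real \<Rightarrow> real"
  assumes "\<delta> > 0" and cont: "continuous_on {- \<delta>..\<delta>} A" and inj: "inj_on A {- \<delta>..\<delta>}" and A0: "A 0 = 0"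
  obtains d where "d = 1 \<or> d = (-1::real)" "\<And>v. v \<in> {- \<delta>..\<delta>} \<Longrightarrow> v \<noteq> 0 \<Longrightarrow> A v * (d * v) > 0"
proof -
  have "(A (- \<delta>) < A 0 \<and> A 0 < A \<delta>) \<or> (A \<delta> < A 0 \<and> A 0 < A (- \<delta>))"
    by (rule continuous_inj_imp_mono[OF _ _ cont inj]) (use assms(1) in auto)
  then obtain d :: real where d: "d = 1 \<or> d = -1" "d * A (- \<delta>) < 0" "0 < d * A \<delta>"
    using that[of 1] by (metis A0 mult_1 mult_minus1 neg_0_less_iff_less neg_less_0_iff_less)
  define A' where "A' v = d * A v" for v
  have mono: "(A' a < A' x \<and> A' x < A' b) \<or> (A' b < A' x \<and> A' x < A' a)"
    if "a < x" "x < b" "- \<delta> \<le> a" "b \<le> \<delta>" for a x b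
  proof (rule continuous_inj_imp_mono[OF that(1,2)])
    have sub: "{a..b} \<subseteq> {- \<delta>..\<delta>}" using that by auto
    show "continuous_on {a..b} A'"
      unfolding A'_def by (intro continuous_intros continuous_on_subset[OF cont sub])
    show "inj_on A' {a..b}"
      using inj_on_subset[OF inj sub] d(1) by (auto simp: A'_def inj_on_def)
  qed
  have "A' v * v > 0" if v: "v \<in> {- \<delta>..\<delta>}" "v \<noteq> 0" for v
  proof (cases "v > 0")
    case True
    have "A' v > 0"
    proof (cases "v = \<delta>")
      case False
      then show ?thesis using mono[of 0 v \<delta>] True v A0 d(3) assms(1) by (auto simp: A'_def)
    qed (use d in \<open>simp add: A'_def\<close>)
    then show ?thesis using True by simp
  next
    case False
    have "A' v < 0"
    proof (cases "v = - \<delta>")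
      case False
      then show ?thesis using mono[of "- \<delta>" v 0] \<open>\<not> v > 0\<close> v A0 d(2) assms(1) by (auto simp: A'_def)
    qed (use d in \<open>simp add: A'_def\<close>)
    then show ?thesis using False v by (simp add: mult_neg_neg)
  qed
  then show ?thesis using that[OF d(1)] by (simp add: A'_def mult_ac)
qed

section \<open>The coverings of the projective plane and of the lens space\<close>

lemma covering_space_veronese:
  "covering_space (sphere 0 1) veronese (veronese ` sphere 0 1)"
proof (rule covering_space_finite_free_action[where I = UNIV and e = True
      and g = "\<lambda>b::bool. if b then id else uminus"])
  fix b :: bool
  show "\<exists>h. homeomorphism (sphere 0 1) (sphere 0 1) (if b then id else uminus) (h :: real^3 \<Rightarrow> real^3)"
    by (rule exI[of _ "if b then id else uminus"])
       (auto simp: homeomorphism_def intro!: continuous_intros image_eqI[of _ _ "- _"])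
next
  fix u v :: "real^3" assume "u \<in> sphere 0 1" "v \<in> sphere 0 1"
  then show "veronese u = veronese v \<longleftrightarrow> (\<exists>b\<in>UNIV. v = (if b then id else uminus) u)"
    by (auto simp: veronese_eq_iff ex_bool_eq)
next
  fix u :: "real^3" and b c :: bool
  assume u: "u \<in> sphere 0 1" and eq: "(if b then id else uminus) u = (if c then id else uminus) u"
  have "u \<noteq> - u" using u by (intro neq_uminus_self) auto
  then show "b = c" using eq by (auto split: if_splits)
qed (auto simp: continuous_on_veronese)

lemma covering_space_lens_invariants:
  assumes "p > 0" "coprime (int p) q"
  shows "covering_space (sphere 0 1) (lens_invariants p q) (lens_invariants p q ` sphere 0 1)"
proof (rule covering_space_finite_free_action[where I = "{..<p}" and e = 0 and g = "\<lambda>k. lens_rotation p q ^^ k"])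
  fix k assume "k \<in> {..<p}"
  then show "\<exists>h. homeomorphism (sphere 0 1) (sphere 0 1) (lens_rotation p q ^^ k) h"
    using homeomorphism_lens_rotation_funpow[OF assms(1)] by blast
next
  fix x y :: "complex \<times> complex" assume "x \<in> sphere 0 1" "y \<in> sphere 0 1"
  then show "lens_invariants p q x = lens_invariants p q y \<longleftrightarrow> (\<exists>k\<in>{..<p}. y = (lens_rotation p q ^^ k) x)"
    using lens_invariants_eq_iff[OF assms] by simp
next
  fix x and i j assume "x \<in> sphere 0 1" "i \<in> {..<p}" "j \<in> {..<p}"
    "(lens_rotation p q ^^ i) x = (lens_rotation p q ^^ j) x"
  then show "i = j" using lens_rotation_free[OF assms] by simp
qed (use assms in \<open>auto simp: continuous_on_lens_invariants\<close>)

lemma lens_rotation_funpow_homotopic_id: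
  "homotopic_with_canon (\<lambda>x. True) (sphere 0 1) (sphere 0 1) (lens_rotation p q ^^ k) id"
proof -
  define a where "a = 2 * pi * real k / real p"
  define b where "b = 2 * pi * (real k * real_of_int q) / real p"
  have ab: "unity_exp p (int k) = cis a" "unity_exp p (int k * q) = cis b"
    by (simp_all add: unity_exp_def a_def b_def cis_conv_exp mult_ac)
  show ?thesis
  proof (rule homotopic_with_canonI[where h = "\<lambda>t z. (cis ((1 - t) * a) * fst z, cis ((1 - t) * b) * snd z)"])
    show "continuous_on ({0..1} \<times> sphere 0 1)
      (\<lambda>p. (cis ((1 - fst p) * a) * fst (snd p), cis ((1 - fst p) * b) * snd (snd p)))"
      by (intro continuous_intros continuous_on_cis)
  qed (auto simp: norm_prod_def norm_mult lens_rotation_funpow ab)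
qed

text \<open>By freeness the displacement of each nontrivial power has a positive minimum on the
  compact sphere. Points of one orbit that are closer than \<open>r\<close> therefore
  coincide.\<close>

lemma lens_rotation_displacement:
  assumes "p > 0" "coprime (int p) q"
  obtains r where "r > 0"
    "\<And>z k. norm z = 1 \<Longrightarrow> k < p \<Longrightarrow> dist ((lens_rotation p q ^^ k) z) z < r \<Longrightarrow> (lens_rotation p q ^^ k) z = z"
proof -
  have c: "continuous_on S (lens_rotation p q ^^ j)" for S j
    using linear_lens_rotation_funpow linear_continuous_on linear_conv_bounded_linear by blast
  have one: "\<exists>r>0. \<forall>z. norm z = 1 \<longrightarrow> r \<le> dist ((lens_rotation p q ^^ k) z) z" if k: "k \<in> {1..<p}" for k
  proof -
    have ne: "sphere (0 :: complex \<times> complex) 1 \<noteq> {}" by simp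
    have cd: "continuous_on (sphere 0 1) (\<lambda>z. dist ((lens_rotation p q ^^ k) z) z)"
      by (intro continuous_intros c)
    from continuous_attains_inf[OF compact_sphere ne cd] obtain z where z: "z \<in> sphere 0 1"
      "\<forall>y \<in> sphere 0 1. dist ((lens_rotation p q ^^ k) z) z \<le> dist ((lens_rotation p q ^^ k) y) y"
      by (elim bexE)
    have "(lens_rotation p q ^^ k) z \<noteq> z"
      using lens_rotation_free[OF assms, of z k 0] z(1) k by auto
    then show ?thesis using z(2) by (intro exI[of _ "dist ((lens_rotation p q ^^ k) z) z"]) auto
  qed
  then obtain \<rho> where \<rho>: "\<And>k. k \<in> {1..<p} \<Longrightarrow> \<rho> k > 0"
    "\<And>k z. k \<in> {1..<p} \<Longrightarrow> norm z = 1 \<Longrightarrow> \<rho> k \<le> dist ((lens_rotation p q ^^ k) z) z"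
    by metis
  define r where "r = Min (insert 1 (\<rho> ` {1..<p}))"
  have "r > 0" unfolding r_def using \<rho>(1) by (subst Min_gr_iff) auto
  moreover have "(lens_rotation p q ^^ k) z = z"
    if "norm z = 1" "k < p" "dist ((lens_rotation p q ^^ k) z) z < r" for z k
  proof (rule ccontr)
    assume ne: "(lens_rotation p q ^^ k) z \<noteq> z"
    then have "k \<noteq> 0" by (metis funpow_0)
    then have k: "k \<in> {1..<p}" using that by simp
    have "r \<le> \<rho> k" unfolding r_def using k by (intro Min_le) auto
    then show False using \<rho>(2)[OF k that(1)] that(3) by simp
  qed
  ultimately show ?thesis using that by blast
qed

subsection \<open>Fibre orientation along a reversing loop\<close>

text \<open>On the right half of the unit circle the imaginary part is a coordinate. This is how
  circle-valued fibre coordinates turn into real ones.\<close>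

lemma unit_complex_eqI:
  assumes "norm u = 1" "norm v = 1" "Im u = Im v" "Re u > 0" "Re v > 0"
  shows "u = v"
proof -
  have "(Re u)\<^sup>2 + (Im u)\<^sup>2 = (Re v)\<^sup>2 + (Im v)\<^sup>2" using assms(1,2) by (simp add: cmod_def)
  then have "(Re u)\<^sup>2 = (Re v)\<^sup>2" using assms(3) by simp
  then have "Re u = Re v" using assms(4,5) by (simp add: power2_eq_iff_nonneg)
  then show ?thesis using assms(3) by (simp add: complex_eq_iff)
qed

lemma Re_pos_if_close_1: "norm (u - 1) < 1 \<Longrightarrow> Re u > 0"
  using abs_Re_le_cmod[of "u - 1"] by simp

lemma norm_Complex_sqrt: "\<bar>v\<bar> \<le> 1 \<Longrightarrow> norm (Complex (sqrt (1 - v\<^sup>2)) v) = 1"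
  by (simp add: cmod_def abs_square_le_1)

lemma Hausdorff_projective_plane: "Hausdorff_space projective_plane"
proof -
  obtain \<kappa> where "homeomorphic_map projective_plane (top_of_set (veronese ` sphere 0 1)) \<kappa>"
    using projective_plane_embedding by blast
  then have "projective_plane homeomorphic_space top_of_set (veronese ` sphere 0 1)"
    by (rule homeomorphic_map_imp_homeomorphic_space)
  moreover have "Hausdorff_space (top_of_set (veronese ` sphere 0 1))"
    by (intro Hausdorff_space_subtopology) simp
  ultimately show ?thesis using homeomorphic_Hausdorff_space by blast
qed

lemma Hausdorff_lens_space:
  assumes "p > 0" "coprime (int p) q"
  shows "Hausdorff_space (lens_space p q)"
proof -
  obtain \<iota> where "homeomorphic_map (lens_space p q) (top_of_set (lens_invariants p q ` sphere 0 1)) \<iota>"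
    using lens_space_embedding[OF assms] by blast
  then have "lens_space p q homeomorphic_space top_of_set (lens_invariants p q ` sphere 0 1)"
    by (rule homeomorphic_map_imp_homeomorphic_space)
  moreover have "Hausdorff_space (top_of_set (lens_invariants p q ` sphere 0 1))"
    by (intro Hausdorff_space_subtopology) simp
  ultimately show ?thesis using homeomorphic_Hausdorff_space by blast
qed

lemma continuous_map_lens_orbit: "continuous_map (top_of_set (sphere 0 1)) (lens_space p q) (lens_orbit p q)"
  unfolding lens_space_def by (rule quotient_imp_continuous_map[OF quotient_map_quotient_topology])

lemma topspace_lens_space: "topspace (lens_space p q) = lens_orbit p q ` sphere 0 1"
  by (simp add: lens_space_def topspace_quotient_topology)

lemma lens_map_to_projective_plane_lift:
  assumes f: "continuous_map (lens_space p q) projective_plane f"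
  obtains F :: "complex \<times> complex \<Rightarrow> real^3" where "continuous_on (sphere 0 1) F"
    "\<And>z. norm z = 1 \<Longrightarrow> norm (F z) = 1" "\<And>z. norm z = 1 \<Longrightarrow> f (lens_orbit p q z) = {F z, - F z}"
proof -
  obtain \<kappa> where \<kappa>: "homeomorphic_map projective_plane (top_of_set (veronese ` sphere 0 1)) \<kappa>"
    "\<And>u. norm u = 1 \<Longrightarrow> \<kappa> {u, - u} = veronese u"
    using projective_plane_embedding by blast
  have "continuous_map (top_of_set (sphere 0 1)) (top_of_set (veronese ` sphere 0 1)) (\<kappa> \<circ> (f \<circ> lens_orbit p q))"
    by (intro continuous_map_compose[OF _ homeomorphic_imp_continuous_map[OF \<kappa>(1)]]
        continuous_map_compose[OF continuous_map_lens_orbit f])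
  then have c: "continuous_on (sphere 0 1) (\<kappa> \<circ> (f \<circ> lens_orbit p q))"
      "\<kappa> \<circ> (f \<circ> lens_orbit p q) \<in> sphere 0 1 \<rightarrow> veronese ` sphere 0 1"
    by simp_all
  have sc: "simply_connected (sphere (0 :: complex \<times> complex) 1)"
    by (rule simply_connected_sphere) simp
  obtain F where F: "continuous_on (sphere 0 1) F" "F \<in> sphere 0 1 \<rightarrow> sphere 0 1"
    "\<And>z. z \<in> sphere 0 1 \<Longrightarrow> veronese (F z) = (\<kappa> \<circ> (f \<circ> lens_orbit p q)) z"
    by (rule covering_space_lift[OF covering_space_veronese sc locally_path_connected_sphere c]) (rule that)
  show ?thesis
  proof (rule that[OF F(1)])
    show nF: "norm (F z) = 1" if "norm z = 1" for z
      using F(2) that by (simp add: Pi_iff)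
    fix z :: "complex \<times> complex" assume z: "norm z = 1"
    have "f (lens_orbit p q z) \<in> topspace projective_plane"
      using continuous_map_image_subset_topspace[OF f] z topspace_lens_space[of p q] by fastforce
    moreover have "{F z, - F z} \<in> topspace projective_plane"
      using nF[OF z] by (auto simp: topspace_projective_plane)
    moreover have "\<kappa> (f (lens_orbit p q z)) = \<kappa> {F z, - F z}"
      using F(3)[of z] z \<kappa>(2)[OF nF[OF z]] by simp
    ultimately show "f (lens_orbit p q z) = {F z, - F z}"
      using homeomorphic_imp_injective_map[OF \<kappa>(1)] by (metis inj_onD)
  qed
qed

lemma lens_path_lift:
  assumes p: "p > 0" "coprime (int p) q" and y: "continuous_map (top_of_set {0..1}) (lens_space p q) y"
  obtains x :: "real \<Rightarrow> complex \<times> complex" where "continuous_on {0..1} x"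
    "\<And>t. t \<in> {0..1} \<Longrightarrow> norm (x t) = 1" "\<And>t. t \<in> {0..1} \<Longrightarrow> lens_orbit p q (x t) = y t"
proof -
  obtain \<iota> where \<iota>: "homeomorphic_map (lens_space p q) (top_of_set (lens_invariants p q ` sphere 0 1)) \<iota>"
    "\<And>z. norm z = 1 \<Longrightarrow> \<iota> (lens_orbit p q z) = lens_invariants p q z"
    using lens_space_embedding[OF p] by blast
  have c: "continuous_map (top_of_set {0..1}) (top_of_set (lens_invariants p q ` sphere 0 1)) (\<iota> \<circ> y)"
    by (rule continuous_map_compose[OF y homeomorphic_imp_continuous_map[OF \<iota>(1)]])
  then have "path (\<iota> \<circ> y)" by (simp add: path_def)
  moreover have "path_image (\<iota> \<circ> y) \<subseteq> lens_invariants p q ` sphere 0 1"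
    using continuous_map_image_subset_topspace[OF c] unfolding path_image_def topspace_euclidean_subtopology .
  ultimately obtain x where x: "path x" "path_image x \<subseteq> sphere 0 1"
      "\<And>t. t \<in> {0..1} \<Longrightarrow> lens_invariants p q (x t) = (\<iota> \<circ> y) t"
    using covering_space_lift_path[OF covering_space_lens_invariants[OF p]] by blast
  show ?thesis
  proof (rule that)
    show "continuous_on {0..1} x" using x(1) by (simp add: path_def)
    show nx: "norm (x t) = 1" if "t \<in> {0..1}" for t
      using x(2) that unfolding path_image_def by (simp add: image_subset_iff)
    fix t :: real assume t: "t \<in> {0..1}"
    have "y t \<in> topspace (lens_space p q)"
      using continuous_map_image_subset_topspace[OF y] t by (simp add: image_subset_iff)
    moreover have "lens_orbit p q (x t) \<in> topspace (lens_space p q)"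
      using nx[OF t] by (simp add: topspace_lens_space)
    moreover have "\<iota> (lens_orbit p q (x t)) = \<iota> (y t)"
      using \<iota>(2)[OF nx[OF t]] x(3)[OF t] by simp
    ultimately show "lens_orbit p q (x t) = y t"
      using homeomorphic_imp_injective_map[OF \<iota>(1)] by (metis inj_onD)
  qed
qed

text \<open>\<open>F\<close> after \<open>T\<close> and \<open>- F\<close> are lifts of one map
  through the double covering by the two-sphere. They agree at \<open>a\<close>, and the
  three-sphere is connected.\<close>

lemma lift_deck_transformation:
  fixes F :: "complex \<times> complex \<Rightarrow> real^3"
  assumes F: "continuous_on (sphere 0 1) F" "\<And>z. norm z = 1 \<Longrightarrow> norm (F z) = 1"
    and T: "continuous_on (sphere 0 1) T" "\<And>z. norm z = 1 \<Longrightarrow> norm (T z) = 1"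
    and eq: "\<And>z. norm z = 1 \<Longrightarrow> {F (T z), - F (T z)} = {F z, - F z}"
    and a: "norm a = 1" "F (T a) = - F a" and z: "norm z = 1"
  shows "F (T z) = - F z"
proof -
  have TS: "T ` sphere 0 1 \<subseteq> sphere 0 1" using T(2) by (simp add: image_subset_iff)
  have "(\<lambda>z. F (T z)) z = (\<lambda>z. - F z) z"
  proof (rule covering_space_lift_unique[OF covering_space_veronese, where T = "sphere 0 1" and f = "\<lambda>z. veronese (F z)"])
    show "continuous_on (sphere 0 1) (\<lambda>z. veronese (F z))"
      by (rule continuous_on_compose2[OF continuous_on_veronese[of UNIV] F(1)]) simp
    show "continuous_on (sphere 0 1) (\<lambda>z. F (T z))"
      by (rule continuous_on_compose2[OF F(1) T(1) TS])
    show "continuous_on (sphere 0 1) (\<lambda>z. - F z)" by (intro continuous_intros F(1))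
    show "connected (sphere (0 :: complex \<times> complex) 1)" by (rule connected_sphere) simp
    show "veronese (F z) = veronese (F (T z))" if "z \<in> sphere 0 1" for z
    proof -
      have "F z = F (T z) \<or> F z = - F (T z)" using eq[of z] that by (simp add: antipodal_class_eq_iff)
      then have "F (T z) = F z \<or> F (T z) = - F z" by (elim disjE) simp_all
      then show ?thesis using that by (simp add: veronese_eq_iff F(2) T(2))
    qed
  qed (use a z F(2) T(2) in \<open>auto simp: Pi_iff\<close>)
  then show ?thesis by simp
qed

text \<open>A trivialization supplies the data that \<open>no_fibre_orientation_reversal\<close>
  refutes: \<open>a\<close> extends the imaginary part of its circle coordinate, \<open>b\<close> is
  up to sign the imaginary part of a chart coordinate near \<open>x 0\<close>, and \<open>x\<close>
  lifts a section of the trivial bundle.\<close>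

lemma seifert_bundle_over_reversing_loop_nontrivial:
  fixes f :: "(complex \<times> complex) set \<Rightarrow> (real^3) set"
  assumes p: "p > 0" "coprime (int p) q"
    and seif: "seifert_fibration (lens_space p q) projective_plane \<mu> f"
    and rev: "orientation_reversing_loop 2 projective_plane \<gamma>"
    and C: "C = \<gamma> ` {0..1}" "\<And>b. b \<in> C \<Longrightarrow> \<mu> b = 1"
  shows "\<not> trivial_circle_bundle (preimage_space (lens_space p q) f C) (subtopology projective_plane C) f"
proof
  let ?L = "lens_space p q" and ?B = projective_plane
  let ?S = "sphere 0 1 :: (complex \<times> complex) set"
  define P where "P = lens_orbit p q"
  assume "trivial_circle_bundle (preimage_space ?L f C) (subtopology ?B C) f"
  then obtain h where h: "homeomorphic_map (preimage_space ?L f C) (prod_topology (subtopology ?B C) unit_circle) h"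
    and "\<forall>x \<in> topspace (preimage_space ?L f C). fst (h x) = f x"
    unfolding trivial_circle_bundle_def by (elim exE conjE)
  then have fh: "\<And>x. x \<in> topspace ?L \<Longrightarrow> f x \<in> C \<Longrightarrow> fst (h x) = f x" by simp
  have f: "continuous_map ?L ?B f" using seif by (simp add: seifert_fibration_def)
  have \<gamma>: "continuous_map (top_of_set {0..1}) ?B \<gamma>" and \<gamma>01: "\<gamma> 0 = \<gamma> 1"
    using rev by (simp_all add: orientation_reversing_loop_def pathin_def)
  have CB: "C \<subseteq> topspace ?B"
    using continuous_map_image_subset_topspace[OF \<gamma>] by (simp add: C(1))
  have I: "0 \<in> {0..1::real}" "1 \<in> {0..1::real}" by auto
  have \<gamma>C: "\<gamma> t \<in> C" if "t \<in> {0..1}" for t using that C(1) by blast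
  have cP: "continuous_map (top_of_set ?S) ?L P" unfolding P_def by (rule continuous_map_lens_orbit)
  have PL: "P z \<in> topspace ?L" if "norm z = 1" for z
    using that by (simp add: P_def topspace_lens_space)
  have P_iff: "P z = P w \<longleftrightarrow> (\<exists>k\<in>{..<p}. w = (lens_rotation p q ^^ k) z)" for z w
    unfolding P_def by (rule lens_orbit_eq_iff[OF p(1)])
  obtain k where k: "continuous_map (prod_topology (subtopology ?B C) unit_circle) (preimage_space ?L f C) k"
    and Wc: "continuous_map (preimage_space ?L f C) unit_circle (\<lambda>x. snd (h x))"
    and W1: "\<And>x. x \<in> topspace ?L \<Longrightarrow> f x \<in> C \<Longrightarrow> norm (snd (h x)) = 1"
    and kW: "\<And>x. x \<in> topspace ?L \<Longrightarrow> f x \<in> C \<Longrightarrow> k (f x, snd (h x)) = x"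
    and kL: "\<And>u w. u \<in> C \<Longrightarrow> norm w = 1 \<Longrightarrow> k (u, w) \<in> topspace ?L"
    and fk: "\<And>u w. u \<in> C \<Longrightarrow> norm w = 1 \<Longrightarrow> f (k (u, w)) = u"
    and Wk: "\<And>u w. u \<in> C \<Longrightarrow> norm w = 1 \<Longrightarrow> snd (h (k (u, w))) = w"
    by (rule circle_chart_inverse[OF CB h fh]) (assumption, assumption, rule that)
  define W where "W z = snd (h (P z))" for z
  obtain F :: "complex \<times> complex \<Rightarrow> real^3" where F: "continuous_on ?S F"
    "\<And>z. norm z = 1 \<Longrightarrow> norm (F z) = 1" and fP: "\<And>z. norm z = 1 \<Longrightarrow> f (P z) = {F z, - F z}"
    by (rule lens_map_to_projective_plane_lift[OF f, folded P_def]) (rule that)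
  \<comment> \<open>The section on which the circle coordinate of the trivialization is 1. It closes
    up because \<open>\<gamma>\<close> does, so the two ends of its lift \<open>x\<close> lie in one
    orbit.\<close>
  define y where "y t = k (\<gamma> t, 1)" for t
  have fy: "f (y t) = \<gamma> t" "snd (h (y t)) = 1" if "t \<in> {0..1}" for t
    unfolding y_def using fk[OF \<gamma>C[OF that]] Wk[OF \<gamma>C[OF that]] by simp_all
  have cy: "continuous_map (top_of_set {0..1}) ?L y"
  proof -
    have "continuous_map (top_of_set {0..1}) (subtopology ?B C) \<gamma>"
      using \<gamma> \<gamma>C by (auto simp: continuous_map_in_subtopology)
    then have "continuous_map (top_of_set {0..1}) (prod_topology (subtopology ?B C) unit_circle) (\<lambda>t. (\<gamma> t, 1))"
      by (rule continuous_map_pairedI) simp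
    from continuous_map_compose[OF this k] show ?thesis
      by (simp add: continuous_map_in_subtopology y_def[abs_def] o_def)
  qed
  obtain x where x: "continuous_on {0..1} x" "\<And>t. t \<in> {0..1} \<Longrightarrow> norm (x t) = 1"
      and Px: "\<And>t. t \<in> {0..1} \<Longrightarrow> P (x t) = y t"
    by (rule lens_path_lift[OF p cy, folded P_def]) (rule that)
  have fPx: "f (P (x t)) = \<gamma> t" "W (x t) = 1" if "t \<in> {0..1}" for t
    using fy[OF that] Px[OF that] by (simp_all add: W_def)
  have F01: "F (x 1) = - F (x 0)"
  proof -
    have "continuous_on {0..1} (\<lambda>t. F (x t))"
      by (rule continuous_on_compose2[OF F(1) x(1)]) (use x(2) in auto)
    \<comment> \<open>\<open>F (x t)\<close> lifts \<open>\<gamma>\<close> to the two-sphere.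
      Reversal keeps it from closing, which leaves only the antipode of the initial value.\<close>
    then have "F (x 1) \<noteq> F (x 0)"
      using orientation_reversing_loop_lift_not_closed[OF rev, of "\<lambda>t. F (x t)"] F(2) x(2) fP fPx(1) by metis
    moreover have "{F (x 0), - F (x 0)} = {F (x 1), - F (x 1)}"
      using fP[OF x(2)[OF I(1)]] fP[OF x(2)[OF I(2)]] fPx(1)[OF I(1)] fPx(1)[OF I(2)] \<gamma>01 by simp
    ultimately show ?thesis by (simp add: antipodal_class_eq_iff)
  qed
  have "P (x 0) = P (x 1)" using Px I \<gamma>01 by (simp add: y_def)
  then obtain j where "x 1 = (lens_rotation p q ^^ j) (x 0)" using P_iff by blast
  define T where "T = lens_rotation p q ^^ j"
  have x1: "x 1 = T (x 0)" using \<open>x 1 = _\<close> by (simp add: T_def)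
  have linT: "linear T" unfolding T_def by (rule linear_lens_rotation_funpow)
  have normT: "norm (T z) = norm z" for z by (simp add: T_def)
  have PT: "P (T z) = P z" for z
  proof -
    have "T z = (lens_rotation p q ^^ (j mod p)) z"
      using lens_rotation_funpow_mod[OF p(1)] by (simp add: T_def)
    then have "P z = P (T z)" unfolding P_iff using p(1) by (intro bexI[of _ "j mod p"]) auto
    then show ?thesis by (rule sym)
  qed
  have contT: "continuous_on A T" for A
    using linT linear_continuous_on linear_conv_bounded_linear by blast
  have FT: "F (T z) = - F z" if "norm z = 1" for z
  proof (rule lift_deck_transformation[OF F contT _ _ x(2)[OF I(1)] _ that])
    show "{F (T z), - F (T z)} = {F z, - F z}" if "norm z = 1" for z
    proof -
      have "{F (T z), - F (T z)} = f (P (T z))" by (rule fP[symmetric]) (simp add: normT that)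
      also have "\<dots> = {F z, - F z}" unfolding PT by (rule fP[OF that])
      finally show ?thesis .
    qed
    show "F (T (x 0)) = - F (x 0)" using F01 x1 by simp
  qed (simp_all add: normT)
  define Z where "Z = {z \<in> ?S. f (P z) \<in> C}"
  have "compact Z"
  proof -
    have "compactin ?B C" unfolding C(1)
      using image_compactin[OF _ \<gamma>, of "{0..1}"] by (simp add: compactin_subtopology)
    then have "closedin ?B C" by (rule compactin_imp_closedin[OF Hausdorff_projective_plane])
    from closedin_continuous_map_preimage[OF continuous_map_compose[OF cP f] this]
    have "closedin (top_of_set ?S) Z" by (simp add: Z_def)
    then show ?thesis using closedin_compact compact_sphere by blast
  qed
  have ZS: "Z \<subseteq> ?S" by (auto simp: Z_def)
  have cW: "continuous_on Z W"
  proof -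
    have "continuous_map (top_of_set Z) ?L P"
      using continuous_map_from_subtopology[OF cP, of Z] ZS by (simp add: subtopology_subtopology Int_absorb1)
    then have "continuous_map (top_of_set Z) (preimage_space ?L f C) P"
      using PL by (auto simp: continuous_map_in_subtopology Z_def)
    from continuous_map_compose[OF this Wc] show ?thesis by (simp add: W_def[abs_def] o_def)
  qed
  have W1': "norm (W z) = 1" if "z \<in> Z" for z
    using W1[OF PL] that by (simp add: W_def Z_def)
  \<comment> \<open>\<open>Z\<close> is the closed preimage of the curve, so the Tietze theorem
    extends the coordinate from there to the whole sphere.\<close>
  obtain a where a: "continuous_on ?S a" "\<And>z. z \<in> Z \<Longrightarrow> a z = Im (W z)"
  proof -
    have "continuous_on Z (\<lambda>z. Im (W z))" by (intro continuous_intros cW)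
    moreover have "closedin (top_of_set ?S) Z"
      using \<open>compact Z\<close> ZS compact_imp_closed closed_subset by blast
    ultimately show ?thesis using Tietze_unbounded that by metis
  qed
  have h_inj: "P z = P w" if "z \<in> Z" "w \<in> Z" "f (P z) = f (P w)" "W z = W w" for z w
  proof -
    have kWP: "k (f (P u), W u) = P u" if "u \<in> Z" for u
      unfolding W_def by (rule kW[OF PL]) (use that in \<open>auto simp: Z_def\<close>)
    have "P z = k (f (P z), W z)" by (rule kWP[OF that(1), symmetric])
    also have "\<dots> = k (f (P w), W w)" by (simp only: that(3,4))
    also have "\<dots> = P w" by (rule kWP[OF that(2)])
    finally show ?thesis .
  qed
  \<comment> \<open>Uniform continuity on the compact \<open>Z\<close> gives one radius for all
    times: \<open>W\<close> is 1 on the path, so within this radius it stays in the right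
    half-plane.\<close>
  obtain r1 where r1: "r1 > 0" "\<And>z w. z \<in> Z \<Longrightarrow> w \<in> Z \<Longrightarrow> dist z w < r1 \<Longrightarrow> dist (W z) (W w) < 1"
    using compact_uniformly_continuous[OF cW \<open>compact Z\<close>] unfolding uniformly_continuous_on_def
    by (metis zero_less_one)
  obtain r2 where r2: "r2 > 0"
    "\<And>z k. norm z = 1 \<Longrightarrow> k < p \<Longrightarrow> dist ((lens_rotation p q ^^ k) z) z < r2 \<Longrightarrow> (lens_rotation p q ^^ k) z = z"
    using lens_rotation_displacement[OF p] by blast
  have P_inj: "w = z" if "norm z = 1" "P z = P w" "dist w z < r2" for z w
  proof -
    from that(2) obtain k where k: "k < p" "w = (lens_rotation p q ^^ k) z" unfolding P_iff by blast
    show ?thesis using r2(2)[OF that(1) k(1)] that(3) unfolding k(2) by blast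
  qed
  have FZ: "y \<in> Z" "f (P y) = \<gamma> t" if "norm y = 1" "t \<in> {0..1}" "F y = F (x t)" for y t
  proof -
    show "f (P y) = \<gamma> t" using fP[OF that(1)] fP[OF x(2)[OF that(2)]] that(3) fPx(1)[OF that(2)] by simp
    then show "y \<in> Z" using that(1) \<gamma>C[OF that(2)] by (simp add: Z_def)
  qed
  have xZ: "x t \<in> Z" if "t \<in> {0..1}" for t using FZ(1)[OF x(2)[OF that] that] by simp
  have \<gamma>0: "\<gamma> 0 \<in> topspace ?B" "\<mu> (\<gamma> 0) = 1" using \<gamma>C[OF I(1)] CB C(2) by auto
  obtain U h' where U: "openin ?B U" "\<gamma> 0 \<in> U"
    and h': "homeomorphic_map (preimage_space ?L f U) (prod_topology (subtopology ?B U) unit_circle) h'"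
    and fh': "\<And>x. x \<in> topspace ?L \<Longrightarrow> f x \<in> U \<Longrightarrow> fst (h' x) = f x"
    by (rule seifert_regular_chart[OF seif \<gamma>0]) (rule that)
  obtain k' where k': "continuous_map (prod_topology (subtopology ?B U) unit_circle) (preimage_space ?L f U) k'"
    and \<omega>c: "continuous_map (preimage_space ?L f U) unit_circle (\<lambda>x. snd (h' x))"
    and \<omega>1: "\<And>x. x \<in> topspace ?L \<Longrightarrow> f x \<in> U \<Longrightarrow> norm (snd (h' x)) = 1"
    and k\<omega>: "\<And>x. x \<in> topspace ?L \<Longrightarrow> f x \<in> U \<Longrightarrow> k' (f x, snd (h' x)) = x"
    and k'L: "\<And>u w. u \<in> U \<Longrightarrow> norm w = 1 \<Longrightarrow> k' (u, w) \<in> topspace ?L"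
    and fk': "\<And>u w. u \<in> U \<Longrightarrow> norm w = 1 \<Longrightarrow> f (k' (u, w)) = u"
    and \<omega>k: "\<And>u w. u \<in> U \<Longrightarrow> norm w = 1 \<Longrightarrow> snd (h' (k' (u, w))) = w"
    by (rule circle_chart_inverse[OF openin_subset[OF U(1)] h' fh']) (assumption, assumption, rule that)
  define V where "V = {z \<in> ?S. f (P z) \<in> U}"
  have opV: "openin (top_of_set ?S) V"
    using openin_continuous_map_preimage[OF continuous_map_compose[OF cP f] U(1)] by (simp add: V_def)
  have VS: "V \<subseteq> ?S" by (auto simp: V_def)
  have x0V: "x 0 \<in> V" using x(2)[OF I(1)] fPx(1)[OF I(1)] U(2) by (simp add: V_def)
  define \<omega> where "\<omega> z = snd (h' (P z))" for z
  have c\<omega>: "continuous_on V \<omega>"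
  proof -
    have "continuous_map (top_of_set V) ?L P"
      using continuous_map_from_subtopology[OF cP, of V] VS by (simp add: subtopology_subtopology Int_absorb1)
    then have "continuous_map (top_of_set V) (preimage_space ?L f U) P"
      using PL by (auto simp: continuous_map_in_subtopology V_def)
    from continuous_map_compose[OF this \<omega>c] show ?thesis by (simp add: \<omega>_def[abs_def] o_def)
  qed
  have \<omega>1': "norm (\<omega> z) = 1" if "z \<in> V" for z
    using \<omega>1[OF PL] that by (simp add: \<omega>_def V_def)
  \<comment> \<open>The chart coordinate is rotated to be 1 at \<open>x 0\<close>, where its
    imaginary part is then a coordinate.\<close>
  define \<rho> where "\<rho> z = \<omega> z / \<omega> (x 0)" for z
  have \<omega>0: "norm (\<omega> (x 0)) = 1" "\<omega> (x 0) \<noteq> 0" using \<omega>1'[OF x0V] by auto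
  have \<rho>1: "norm (\<rho> z) = 1" if "z \<in> V" for z
    using \<omega>1'[OF that] \<omega>0 by (simp add: \<rho>_def norm_divide)
  have c\<rho>: "continuous_on V \<rho>" unfolding \<rho>_def using \<omega>0 by (intro continuous_intros c\<omega>) auto
  have \<rho>0: "\<rho> (x 0) = 1" using \<omega>0 by (simp add: \<rho>_def)
  have h'_inj: "P z = P w" if "z \<in> V" "w \<in> V" "f (P z) = f (P w)" "\<rho> z = \<rho> w" for z w
  proof -
    have eq: "\<omega> z = \<omega> w" using that(4) \<omega>0 by (simp add: \<rho>_def)
    have k\<omega>P: "k' (f (P u), \<omega> u) = P u" if "u \<in> V" for u
      unfolding \<omega>_def by (rule k\<omega>[OF PL]) (use that in \<open>auto simp: V_def\<close>)
    have "P z = k' (f (P z), \<omega> z)" by (rule k\<omega>P[OF that(1), symmetric])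
    also have "\<dots> = k' (f (P w), \<omega> w)" by (simp only: that(3) eq)
    also have "\<dots> = P w" by (rule k\<omega>P[OF that(2)])
    finally show ?thesis .
  qed
  \<comment> \<open>An arc of the fibre over \<open>\<gamma> 0\<close>, parametrized by the
    imaginary part of the chart coordinate. Along it this coordinate is compared with that of the
    trivialization.\<close>
  define \<psi> where "\<psi> v = k' (\<gamma> 0, \<omega> (x 0) * Complex (sqrt (1 - v\<^sup>2)) v)" for v
  have n\<psi>: "norm (\<omega> (x 0) * Complex (sqrt (1 - v\<^sup>2)) v) = 1" if "\<bar>v\<bar> \<le> 1" for v
    using norm_Complex_sqrt[OF that] \<omega>0 by (simp add: norm_mult)
  have \<psi>: "\<psi> v \<in> topspace ?L" "f (\<psi> v) = \<gamma> 0" "snd (h' (\<psi> v)) = \<omega> (x 0) * Complex (sqrt (1 - v\<^sup>2)) v"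
    if "\<bar>v\<bar> \<le> 1" for v
    unfolding \<psi>_def using k'L[OF U(2) n\<psi>[OF that]] fk'[OF U(2) n\<psi>[OF that]] \<omega>k[OF U(2) n\<psi>[OF that]] by auto
  have P\<psi>: "P z = \<psi> v"
    if "z \<in> V" "f (P z) = \<gamma> 0" "Im (\<rho> z) = v" "Re (\<rho> z) > 0" for z v
  proof -
    have "\<bar>v\<bar> \<le> 1" using abs_Im_le_cmod[of "\<rho> z"] \<rho>1[OF that(1)] that(3) by simp
    have "\<rho> z = Complex (sqrt (1 - v\<^sup>2)) v"
    proof -
      have "(Re (\<rho> z))\<^sup>2 + (Im (\<rho> z))\<^sup>2 = 1"
        using \<rho>1[OF that(1)] by (simp add: cmod_def)
      then have "(Re (\<rho> z))\<^sup>2 = 1 - v\<^sup>2" using that(3) by simp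
      then have "Re (\<rho> z) = sqrt (1 - v\<^sup>2)" using that(4) by (metis less_imp_le real_sqrt_unique)
      then show ?thesis using that(3) by (simp add: complex_eq_iff)
    qed
    then have "\<omega> z = \<omega> (x 0) * Complex (sqrt (1 - v\<^sup>2)) v" using \<omega>0 by (simp add: \<rho>_def field_simps)
    moreover have "k' (\<gamma> 0, \<omega> z) = P z"
      using k\<omega>[OF PL, of z] that(1,2) by (simp add: V_def \<omega>_def)
    ultimately show ?thesis by (simp add: \<psi>_def)
  qed
  define w where "w v = snd (h (\<psi> v))" for v
  have cw: "continuous_on {-1..1} w"
  proof -
    have "continuous_on {-1..1} (\<lambda>v. \<omega> (x 0) * Complex (sqrt (1 - v\<^sup>2)) v)"
      unfolding Complex_eq by (intro continuous_intros)
    then have "continuous_map (top_of_set {-1..1}) unit_circle (\<lambda>v. \<omega> (x 0) * Complex (sqrt (1 - v\<^sup>2)) v)"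
      using n\<psi> by (simp add: Pi_iff abs_le_iff)
    moreover have "continuous_map (top_of_set {-1..1}) (subtopology ?B U) (\<lambda>v. \<gamma> 0)"
      using U(2) \<gamma>0(1) by simp
    ultimately have "continuous_map (top_of_set {-1..1}) (prod_topology (subtopology ?B U) unit_circle)
        (\<lambda>v. (\<gamma> 0, \<omega> (x 0) * Complex (sqrt (1 - v\<^sup>2)) v))"
      by (intro continuous_map_pairedI)
    from continuous_map_compose[OF this k']
    have "continuous_map (top_of_set {-1..1}) ?L \<psi>"
      by (simp add: continuous_map_in_subtopology \<psi>_def[abs_def] o_def)
    then have "continuous_map (top_of_set {-1..1}) (preimage_space ?L f C) \<psi>"
      using \<psi>(1,2) \<gamma>C[OF I(1)] by (auto simp: continuous_map_in_subtopology abs_le_iff)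
    from continuous_map_compose[OF this Wc] show ?thesis by (simp add: w_def[abs_def] o_def)
  qed
  have w1: "norm (w v) = 1" if "\<bar>v\<bar> \<le> 1" for v
    using W1[OF \<psi>(1)[OF that]] \<psi>(2)[OF that] \<gamma>C[OF I(1)] by (simp add: w_def)
  have w0: "w 0 = 1"
  proof -
    have "P (x 0) = \<psi> 0" using P\<psi>[OF x0V fPx(1)[OF I(1)], of 0] \<rho>0 by simp
    then show ?thesis using fPx(2)[OF I(1)] by (simp add: w_def W_def)
  qed
  obtain \<delta> where \<delta>: "0 < \<delta>" "\<delta> < 1" "\<And>v. \<bar>v\<bar> \<le> \<delta> \<Longrightarrow> Re (w v) > 0"
  proof -
    have "0 \<in> {-1..1::real}" by simp
    with cw obtain d where d: "d > 0" "\<And>v. v \<in> {-1..1} \<Longrightarrow> dist v 0 < d \<Longrightarrow> dist (w v) (w 0) < 1"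
      unfolding continuous_on_iff by (metis zero_less_one)
    show ?thesis
    proof (rule that[of "min (1/2) (d/2)"])
      fix v assume v: "\<bar>v\<bar> \<le> min (1/2) (d/2)"
      have "v \<in> {-1..1}" "dist v 0 < d" using v d(1) by (auto simp: abs_le_iff)
      then have "norm (w v - 1) < 1" using d(2)[of v] w0 by (simp add: dist_norm)
      then show "Re (w v) > 0" by (rule Re_pos_if_close_1)
    qed (use d in auto)
  qed
  have \<delta>1: "\<bar>v\<bar> \<le> 1" "\<bar>v\<bar> \<le> \<delta>" if "v \<in> {- \<delta>..\<delta>}" for v using that \<delta> by auto
  have inj_w: "inj_on (\<lambda>v. Im (w v)) {- \<delta>..\<delta>}"
  proof (rule inj_onI)
    fix u v assume u: "u \<in> {- \<delta>..\<delta>}" and v: "v \<in> {- \<delta>..\<delta>}" and eq: "Im (w u) = Im (w v)"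
    have "w u = w v"
      by (rule unit_complex_eqI[OF w1[OF \<delta>1(1)[OF u]] w1[OF \<delta>1(1)[OF v]] eq \<delta>(3)[OF \<delta>1(2)[OF u]] \<delta>(3)[OF \<delta>1(2)[OF v]]])
    then have "\<psi> u = \<psi> v"
      using kW[OF \<psi>(1)[OF \<delta>1(1)[OF u]]] kW[OF \<psi>(1)[OF \<delta>1(1)[OF v]]] \<psi>(2)[OF \<delta>1(1)[OF u]] \<psi>(2)[OF \<delta>1(1)[OF v]] \<gamma>C[OF I(1)]
      by (simp add: w_def)
    then have "\<omega> (x 0) * Complex (sqrt (1 - u\<^sup>2)) u = \<omega> (x 0) * Complex (sqrt (1 - v\<^sup>2)) v"
      using \<psi>(3)[OF \<delta>1(1)[OF u]] \<psi>(3)[OF \<delta>1(1)[OF v]] by metis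
    then show "u = v" using \<omega>0 by simp
  qed
  have "continuous_on {- \<delta>..\<delta>} (\<lambda>v. Im (w v))"
    by (intro continuous_intros continuous_on_subset[OF cw]) (use \<delta> in auto)
  \<comment> \<open>On the arc the coordinate of the trivialization is an injective function of the
    chart coordinate; \<open>d\<close> tells whether the two orient the fibre alike.\<close>
  then obtain d where d: "d = 1 \<or> d = (-1::real)"
    "\<And>v. v \<in> {- \<delta>..\<delta>} \<Longrightarrow> v \<noteq> 0 \<Longrightarrow> Im (w v) * (d * v) > 0"
    using injective_sign[OF \<delta>(1) _ inj_w] w0 by auto
  obtain r4 where r4: "r4 > 0" "\<And>z. norm z = 1 \<Longrightarrow> dist z (x 0) < r4 \<Longrightarrow> z \<in> V \<and> norm (\<rho> z - 1) < \<delta>"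
  proof -
    obtain e1 where e1: "e1 > 0" "\<And>z. z \<in> ?S \<Longrightarrow> dist z (x 0) < e1 \<Longrightarrow> z \<in> V"
      using opV x0V unfolding openin_euclidean_subtopology_iff by metis
    obtain e2 where e2: "e2 > 0" "\<And>z. z \<in> V \<Longrightarrow> dist z (x 0) < e2 \<Longrightarrow> dist (\<rho> z) (\<rho> (x 0)) < \<delta>"
      using c\<rho> x0V \<delta>(1) unfolding continuous_on_iff by metis
    show ?thesis
      by (rule that[of "min e1 e2"]) (use e1 e2 \<rho>0 in \<open>auto simp: dist_norm\<close>)
  qed
  \<comment> \<open>\<open>r1\<close> keeps \<open>W\<close> in the right half-plane;
    \<open>r2 / 2\<close> makes the orbit map injective on the ball, since any two of its points are
    closer than \<open>r2\<close>; \<open>r4\<close> keeps the ball inside the chart, with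
    \<open>\<rho>\<close> within \<open>\<delta>\<close> of 1.\<close>
  define r where "r = min r1 (min (r2 / 2) r4)"
  have r: "r > 0" "r \<le> r1" "2 * r \<le> r2" "r \<le> r4" using r1(1) r2(1) r4(1) by (auto simp: r_def)
  \<comment> \<open>The factor \<open>d\<close> turns the chart coordinate into the direction of the
    trivialization, which makes its product with \<open>a\<close> positive on the fibre.\<close>
  define b where "b z = d * Im (\<rho> z)" for z
  have near: "z \<in> V" "Re (\<rho> z) > 0" "\<bar>Im (\<rho> z)\<bar> < \<delta>" if "norm z = 1" "dist z (x 0) < r" for z
  proof -
    have *: "z \<in> V" "norm (\<rho> z - 1) < \<delta>" using r4(2)[OF that(1)] that(2) r(4) by auto
    then show "z \<in> V" by blast
    show "Re (\<rho> z) > 0" using * \<delta>(2) by (intro Re_pos_if_close_1) simp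
    show "\<bar>Im (\<rho> z)\<bar> < \<delta>" using abs_Im_le_cmod[of "\<rho> z - 1"] * by simp
  qed
  have ball: "norm z = 1" "dist z (x 0) < r" if "z \<in> ?S \<inter> ball (x 0) r" for z
    using that by (auto simp: dist_commute)
  show False
  proof (rule no_fibre_orientation_reversal[where F = F and a = a and b = b and x = x and T = T and r = r,
        OF F a(1) x linT normT _ x1 FT _ r(1)])
    show "homotopic_with_canon (\<lambda>x. True) ?S ?S T id"
      unfolding T_def by (rule lens_rotation_funpow_homotopic_id)
    show "a (T z) = a z" if "norm z = 1" "F z = F (x 0)" for z
    proof -
      have z: "z \<in> Z" by (rule FZ(1)[OF that(1) I(1) that(2)])
      then have "T z \<in> Z" by (simp add: Z_def PT normT)
      then show ?thesis using z by (simp add: a(2) W_def PT)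
    qed
    show "z = x t" if t: "t \<in> {0..1}" and z: "norm z = 1" "dist z (x t) < r" "F z = F (x t)" "a z = 0" for t z
    proof -
      note zZ = FZ[OF z(1) t z(3)]
      have "dist (W z) (W (x t)) < 1" using r1(2)[OF zZ(1) xZ[OF t]] z(2) r(2) by simp
      then have "Re (W z) > 0" using fPx(2)[OF t] by (intro Re_pos_if_close_1) (simp add: dist_norm)
      moreover have "Im (W z) = 0" using a(2)[OF zZ(1)] z(4) by simp
      ultimately have "W z = 1" using W1'[OF zZ(1)] by (intro unit_complex_eqI) auto
      then have "P z = P (x t)" using h_inj[OF zZ(1) xZ[OF t]] zZ(2) fPx[OF t] by simp
      then show ?thesis using P_inj[OF x(2)[OF t], of z] z(2) r by simp
    qed
    show "continuous_on (?S \<inter> ball (x 0) r) b"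
      unfolding b_def by (intro continuous_intros continuous_on_subset[OF c\<rho>]) (use near(1) ball in blast)
    show "b (x 0) = 0" by (simp add: b_def \<rho>0)
    show "inj_on (\<lambda>y. (F y, b y)) (?S \<inter> ball (x 0) r)"
    proof (rule inj_onI)
      fix u v assume uv: "u \<in> ?S \<inter> ball (x 0) r" "v \<in> ?S \<inter> ball (x 0) r" and eq: "(F u, b u) = (F v, b v)"
      note u = near[OF ball[OF uv(1)]] and v = near[OF ball[OF uv(2)]]
      have "Im (\<rho> u) = Im (\<rho> v)" using eq d(1) by (auto simp: b_def)
      then have "\<rho> u = \<rho> v" by (rule unit_complex_eqI[OF \<rho>1[OF u(1)] \<rho>1[OF v(1)] _ u(2) v(2)])
      moreover have "f (P u) = f (P v)" using fP[OF ball(1)[OF uv(1)]] fP[OF ball(1)[OF uv(2)]] eq by simp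
      ultimately have "P v = P u" using h'_inj[OF v(1) u(1)] by simp
      moreover have "dist u v < r2"
        using dist_triangle_half_r[of "x 0" u "2 * r" v] ball(2)[OF uv(1)] ball(2)[OF uv(2)] r(3) by (simp add: dist_commute)
      ultimately show "u = v" by (rule P_inj[OF ball(1)[OF uv(2)]])
    qed
    show "0 < a z * b z" if z: "norm z = 1" "dist z (x 0) < r" "F z = F (x 0)" "z \<noteq> x 0" for z
    proof -
      note zZ = FZ[OF z(1) I(1) z(3)] and nz = near[OF z(1,2)]
      have "P z = \<psi> (Im (\<rho> z))" by (rule P\<psi>[OF nz(1) zZ(2) refl nz(2)])
      then have az: "a z = Im (w (Im (\<rho> z)))" using a(2)[OF zZ(1)] by (simp add: w_def W_def)
      have "Im (\<rho> z) \<noteq> 0"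
      proof
        assume "Im (\<rho> z) = 0"
        then have "\<rho> z = 1" using \<rho>1[OF nz(1)] nz(2) by (intro unit_complex_eqI) auto
        then have "P (x 0) = P z" using h'_inj[OF x0V nz(1)] \<rho>0 zZ(2) fPx(1)[OF I(1)] by simp
        then have "z = x 0" using P_inj[OF x(2)[OF I(1)], of z] z(2) r by simp
        then show False using z(4) by simp
      qed
      then show ?thesis using d(2)[of "Im (\<rho> z)"] nz(3) az by (simp add: b_def abs_less_iff)
    qed
  qed
qed

subsection \<open>The preimage of a reversing curve\<close>

text \<open>\<open>q\<close> is its own inverse modulo \<open>4 * n\<close>: the squares of
  \<open>2n + 1\<close> and \<open>2n - 1\<close> are \<open>4n(n + 1) + 1\<close> and
  \<open>4n(n - 1) + 1\<close>.\<close>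

lemma coprime_4n_2n_plus_minus_1:
  assumes "q = 2 * int n + 1 \<or> q = 2 * int n - 1"
  shows "coprime (int (4 * n)) q"
proof (rule coprimeI)
  fix d assume d: "d dvd int (4 * n)" "d dvd q"
  obtain m where "q * q - int (4 * n) * m = 1"
  proof (cases "q = 2 * int n + 1")
    case True
    then show ?thesis by (intro that[of "int n + 1"]) (simp add: algebra_simps)
  next
    case False
    then have q: "q = 2 * int n - 1" using assms by simp
    show ?thesis by (intro that[of "int n - 1"]) (simp add: q algebra_simps)
  qed
  then show "d dvd 1" using d by (metis dvd_diff dvd_mult2)
qed

theorem mainTheorem4:
  fixes n :: nat and q :: int
    and f :: "(complex \<times> complex) set \<Rightarrow> (real ^ 3) set"
    and x0 :: "(real ^ 3) set" and \<gamma> :: "real \<Rightarrow> (real ^ 3) set"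
  defines "L \<equiv> lens_space (4 * n) q"
    and "C \<equiv> \<gamma> ` {0..1}"
  assumes "n \<ge> 1"
    and "q = 2 * int n + 1 \<or> q = 2 * int n - 1"
    and "seifert_fibration_over_RP2 L n x0 f"
    and "simple_closed_curve projective_plane \<gamma>"
    and "x0 \<notin> C"
    and "orientation_reversing_loop 2 projective_plane \<gamma>"
  shows "circle_bundle (preimage_space L f C) (subtopology projective_plane C) f \<and>
         \<not> trivial_circle_bundle (preimage_space L f C) (subtopology projective_plane C) f \<and>
         (\<exists>e. embedding_map klein_bottle L e \<and>
              e ` topspace klein_bottle = {x \<in> topspace L. f x \<in> C})"
proof -
  let ?E = "preimage_space L f C" and ?B = "subtopology projective_plane C"
  define \<mu> where "\<mu> b = (if b = x0 then n else 1)" for b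
  have p: "4 * n > 0" "coprime (int (4 * n)) q"
    using assms(3) coprime_4n_2n_plus_minus_1[OF assms(4)] by simp_all
  have seif: "seifert_fibration L projective_plane \<mu> f"
    using assms(5) unfolding seifert_fibration_over_RP2_def \<mu>_def by blast
  have \<mu>1: "\<mu> b = 1" if "b \<in> C" for b
    using that assms(7) by (auto simp: \<mu>_def)
  have \<gamma>: "continuous_map (top_of_set {0..1}) projective_plane \<gamma>" "\<gamma> 0 = \<gamma> 1" "inj_on \<gamma> {0..<1}"
    using assms(6) by (simp_all add: simple_closed_curve_def pathin_def)
  have C: "C \<subseteq> topspace projective_plane"
    using continuous_map_image_subset_topspace[OF \<gamma>(1)] by (simp add: C_def)
  have bun: "circle_bundle ?E ?B f"
    by (rule seifert_fibration_restrict_circle_bundle[OF seif C \<mu>1])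
  have nontrivial: "\<not> trivial_circle_bundle ?E ?B f"
    unfolding L_def
    by (rule seifert_bundle_over_reversing_loop_nontrivial[OF p seif[unfolded L_def] assms(8) C_def[THEN meta_eq_to_obj_eq] \<mu>1])
  have "\<exists>e. embedding_map klein_bottle ?E e \<and> e ` topspace klein_bottle = topspace ?E"
  proof -
    have "continuous_map (top_of_set {0..1}) ?B \<gamma>"
      using \<gamma>(1) by (auto simp: continuous_map_in_subtopology C_def)
    moreover have "\<gamma> ` {0..1} = topspace ?B" using C by (auto simp: C_def)
    moreover have "Hausdorff_space ?E"
      using Hausdorff_lens_space[OF p] by (simp add: L_def Hausdorff_space_subtopology)
    moreover have "Hausdorff_space ?B"
      by (rule Hausdorff_space_subtopology[OF Hausdorff_projective_plane])
    ultimately show ?thesis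
      using circle_bundle_over_loop[OF _ _ bun _ \<gamma>(2,3)] nontrivial by blast
  qed
  then obtain e where "embedding_map klein_bottle ?E e" "e ` topspace klein_bottle = topspace ?E"
    by blast
  then have "embedding_map klein_bottle L e \<and> e ` topspace klein_bottle = {x \<in> topspace L. f x \<in> C}"
    by (auto simp: embedding_map_in_subtopology)
  then show ?thesis using bun nontrivial by blast
qed

end
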